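(* Let $X$ be an infinite compact metrizable abelian group and let $\mathbf{u}=\{u_n\}_{n\ge1}$ be a $T$-sequence in $\widehat{X}$. Let $s_{\mathbf{u}}(X)=\{x\in X:(u_n,x)\to1\}$ and let $G_{\mathbf{u}}=\{(g,((u_n,g))_{n\ge1}):g\in s_{\mathbf{u}}(X)\}$, a subgroup of $X\times\mathbb{T}^H_0$ with the subspace topology. Then $(\widehat{X},\mathbf{u})^{\wedge}=G_{\mathbf{u}}$, i.e. the map sending $(g,((u_n,g))_n)\in G_{\mathbf{u}}$ to the character $y\mapsto(y,g)$ of $(\widehat{X},\mathbf{u})$ is a topological isomorphism from $G_{\mathbf{u}}$ onto $(\widehat{X},\mathbf{u})^{\wedge}$; and the von Neumann radical $\mathbf{n}(\widehat{X},\mathbf{u})$ is equal, as an abstract subgroup of $\widehat{X}$, to $s_{\mathbf{u}}(X)^{\perp}$.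
   Context: All groups are abelian. $\mathbb{T}=\{z\in\mathbb{C}:|z|=1\}$. For a topological group $Y$, $\widehat{Y}$ is the group of continuous characters $Y\to\mathbb{T}$, and $Y^{\wedge}$ is $\widehat{Y}$ with the compact-open topology; $(\chi,y)$ is the value of $\chi$ at $y$. For a subgroup $H$ of $Y$, $H^{\perp}=\{\chi\in\widehat{Y}:(\chi,h)=1\ \forall h\in H\}$. The von Neumann radical of $Y$ is $\mathbf{n}(Y)=\bigcap_{\chi\in\widehat{Y}}\ker\chi$. $\mathbb{T}^H_0=\{(z_n)_{n\ge1}\in\mathbb{T}^{\mathbb{N}}:z_n\to1\}$ with coordinatewise multiplication and the metric $d_0((z^1_n),(z^2_n))=\sup_n|z^1_n-z^2_n|$; it is a Polish group. A sequence $\mathbf{u}=\{u_n\}$ in an abelian group $G$ is a $T$-sequence if there is a Hausdorff group topology on $G$ in which $u_n\to0$; then $(G,\mathbf{u})$ denotes $G$ with the finest group topology in which $u_n\to0$. *)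

theory Defs
  imports "HOL-Analysis.Analysis" "HOL-Algebra.Coset"
begin

definition circle_group :: "complex monoid" where
  "circle_group = \<lparr>carrier = sphere 0 1, mult = (*), one = 1\<rparr>"

abbreviation circle_topology :: "complex topology" where
  "circle_topology \<equiv> top_of_set (sphere 0 1)"

text \<open>
  All topological groups are abelian. No separation axiom is built in: \<open>topological_ab_group G T\<close>
  says that \<open>T\<close> is a group topology on \<open>G\<close>.
\<close>

definition topological_ab_group :: "('a, 'm) monoid_scheme \<Rightarrow> 'a topology \<Rightarrow> bool" where
  "topological_ab_group G T \<longleftrightarrow>
     comm_group G \<and> topspace T = carrier G \<and>
     continuous_map (prod_topology T T) T (\<lambda>(x, y). x \<otimes>\<^bsub>G\<^esub> y) \<and>
     continuous_map T T (\<lambda>x. inv\<^bsub>G\<^esub> x)"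

text \<open>
  Characters are made extensional (equal to \<open>undefined\<close> off the carrier), so that two characters
  are equal iff they agree on the group.
\<close>

definition char_group :: "('a, 'm) monoid_scheme \<Rightarrow> 'a topology \<Rightarrow> ('a \<Rightarrow> complex) monoid" where
  "char_group G T =
     \<lparr>carrier = {c \<in> extensional (carrier G).
                  c \<in> hom G circle_group \<and> continuous_map T circle_topology c},
      mult = (\<lambda>c d. \<lambda>x\<in>carrier G. c x * d x),
      one = (\<lambda>x\<in>carrier G. 1)\<rparr>"

definition char_topology :: "('a, 'm) monoid_scheme \<Rightarrow> 'a topology \<Rightarrow> ('a \<Rightarrow> complex) topology" where
  "char_topology G T =
     topology_generated_by
       {{c \<in> carrier (char_group G T). c ` K \<subseteq> U} | K U. compactin T K \<and> openin circle_topology U}"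

definition annihilator ::
    "('a, 'm) monoid_scheme \<Rightarrow> 'a topology \<Rightarrow> 'a set \<Rightarrow> ('a \<Rightarrow> complex) set" where
  "annihilator G T H = {c \<in> carrier (char_group G T). \<forall>h\<in>H. c h = 1}"

definition von_Neumann_radical :: "('a, 'm) monoid_scheme \<Rightarrow> 'a topology \<Rightarrow> 'a set" where
  "von_Neumann_radical G T = (\<Inter>c\<in>carrier (char_group G T). kernel G circle_group c)"

text \<open>
  The group \<open>T\<^sub>0\<^sup>H\<close> of circle-valued sequences converging to 1, with the supremum metric. The
  distance is set to 0 off the carrier because \<open>Metric_space\<close> asks for nonnegativity and symmetry
  of a total function.
\<close>

definition null_seq_group :: "(nat \<Rightarrow> complex) monoid" where
  "null_seq_group =
     \<lparr>carrier = {z. (\<forall>n. z n \<in> sphere 0 1) \<and> z \<longlonglongrightarrow> 1},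
      mult = (\<lambda>z w n. z n * w n),
      one = (\<lambda>n. 1)\<rparr>"

definition null_seq_dist :: "(nat \<Rightarrow> complex) \<Rightarrow> (nat \<Rightarrow> complex) \<Rightarrow> real" where
  "null_seq_dist z w =
     (if z \<in> carrier null_seq_group \<and> w \<in> carrier null_seq_group
      then SUP n. cmod (z n - w n) else 0)"

definition null_seq_topology :: "(nat \<Rightarrow> complex) topology" where
  "null_seq_topology = Metric_space.mtopology (carrier null_seq_group) null_seq_dist"

lemma Metric_space_null_seq: "Metric_space (carrier null_seq_group) null_seq_dist"
proof -
  have bd: "bdd_above (range (\<lambda>n. cmod (z n - w n)))"
    if "z \<in> carrier null_seq_group" "w \<in> carrier null_seq_group" for z w
  proof (rule bdd_aboveI2)
    fix n
    show "cmod (z n - w n) \<le> 2"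
      using that norm_triangle_ineq4[of "z n" "w n"] by (simp add: null_seq_group_def)
  qed
  have up: "cmod (z n - w n) \<le> null_seq_dist z w"
    if "z \<in> carrier null_seq_group" "w \<in> carrier null_seq_group" for z w n
    using that cSUP_upper[OF _ bd[OF that], of n] by (simp add: null_seq_dist_def)
  have le: "null_seq_dist z w \<le> B"
    if "z \<in> carrier null_seq_group" "w \<in> carrier null_seq_group"
      "\<And>n. cmod (z n - w n) \<le> B" for z w B
    using that by (auto simp: null_seq_dist_def intro!: cSUP_least)
  show ?thesis
  proof
    show "0 \<le> null_seq_dist z w" for z w
    proof (cases "z \<in> carrier null_seq_group \<and> w \<in> carrier null_seq_group")
      case True
      then show ?thesis using up[of z w 0] norm_ge_zero order_trans by blast
    qed (auto simp: null_seq_dist_def)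
    show "null_seq_dist z w = null_seq_dist w z" for z w
      by (simp add: null_seq_dist_def norm_minus_commute)
  next
    fix z w assume zw: "z \<in> carrier null_seq_group" "w \<in> carrier null_seq_group"
    show "null_seq_dist z w = 0 \<longleftrightarrow> z = w"
    proof
      assume "null_seq_dist z w = 0"
      then show "z = w" using up[OF zw] by (auto simp: fun_eq_iff)
    qed (simp add: null_seq_dist_def)
  next
    fix x y z
    assume xyz: "x \<in> carrier null_seq_group" "y \<in> carrier null_seq_group"
      "z \<in> carrier null_seq_group"
    show "null_seq_dist x z \<le> null_seq_dist x y + null_seq_dist y z"
    proof (rule le[OF xyz(1,3)])
      fix n
      have "cmod (x n - z n) \<le> cmod (x n - y n) + cmod (y n - z n)"
        using norm_triangle_ineq[of "x n - y n" "y n - z n"] by simp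
      also have "\<dots> \<le> null_seq_dist x y + null_seq_dist y z"
        using up[OF xyz(1,2)] up[OF xyz(2,3)] by (rule add_mono)
      finally show "cmod (x n - z n) \<le> null_seq_dist x y + null_seq_dist y z" .
    qed
  qed
qed

definition T_sequence :: "('a, 'm) monoid_scheme \<Rightarrow> (nat \<Rightarrow> 'a) \<Rightarrow> bool" where
  "T_sequence G u \<longleftrightarrow>
     range u \<subseteq> carrier G \<and>
     (\<exists>T. topological_ab_group G T \<and> Hausdorff_space T \<and> limitin T u \<one>\<^bsub>G\<^esub> sequentially)"

text \<open>
  The finest group topology in which \<open>u\<close> tends to the identity, given as the supremum of all such
  topologies; the two lemmas below show that it belongs to the family and is its finest member.
\<close>

definition finest_topology :: "('a, 'm) monoid_scheme \<Rightarrow> (nat \<Rightarrow> 'a) \<Rightarrow> 'a topology" where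
  "finest_topology G u =
     topology_generated_by
       {U. \<exists>T. topological_ab_group G T \<and> limitin T u \<one>\<^bsub>G\<^esub> sequentially \<and> openin T U}"

lemma finest_topology_finest:
  assumes "topological_ab_group G T" "limitin T u \<one>\<^bsub>G\<^esub> sequentially" "openin T U"
  shows "openin (finest_topology G u) U"
  unfolding finest_topology_def using assms by (intro topology_generated_by_Basis) blast

lemma finest_topology_group_topology:
  assumes "T_sequence G u"
  shows "topological_ab_group G (finest_topology G u)"
    and "limitin (finest_topology G u) u \<one>\<^bsub>G\<^esub> sequentially"
proof -
  let ?S = "{U. \<exists>T. topological_ab_group G T \<and> limitin T u \<one>\<^bsub>G\<^esub> sequentially \<and> openin T U}"
  let ?F = "finest_topology G u"
  obtain T0 where T0: "topological_ab_group G T0" "limitin T0 u \<one>\<^bsub>G\<^esub> sequentially"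
    using assms unfolding T_sequence_def by blast
  have comm: "comm_group G" and top0: "topspace T0 = carrier G"
    using T0 by (auto simp: topological_ab_group_def)
  have "openin T0 (carrier G)" using top0 by (metis openin_topspace)
  then have "carrier G \<in> ?S" using T0 by blast
  moreover have "U \<subseteq> carrier G" if "U \<in> ?S" for U
    using that by (auto simp: topological_ab_group_def dest!: openin_subset)
  ultimately have US: "\<Union>?S = carrier G" by (intro equalityI Union_least Union_upper)
  then have top: "topspace ?F = carrier G" unfolding finest_topology_def by simp
  have finer: "continuous_map ?F T (\<lambda>x. x)"
    if "topological_ab_group G T" "limitin T u \<one>\<^bsub>G\<^esub> sequentially" for T
  proof -
    have "topspace T = carrier G" using that by (simp add: topological_ab_group_def)
    moreover have "{x \<in> carrier G. x \<in> U} = U" if "openin T U" for U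
      using openin_subset[OF that] \<open>topspace T = carrier G\<close> by auto
    ultimately show ?thesis
      using finest_topology_finest[OF that] by (simp add: continuous_map_def top)
  qed
  have into: "continuous_map Z ?F f"
    if "\<And>T. topological_ab_group G T \<Longrightarrow> limitin T u \<one>\<^bsub>G\<^esub> sequentially \<Longrightarrow> continuous_map Z T f"
    for Z :: "'c topology" and f
    unfolding finest_topology_def
  proof (rule continuous_on_generated_topo)
    show "openin Z (f -` U \<inter> topspace Z)" if "U \<in> ?S" for U
    proof -
      from that obtain T where "topological_ab_group G T" "limitin T u \<one>\<^bsub>G\<^esub> sequentially"
        "openin T U" by blast
      with \<open>\<And>T. _ \<Longrightarrow> _ \<Longrightarrow> continuous_map Z T f\<close> show ?thesis
        by (simp add: continuous_map_alt)
    qed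
    show "f ` topspace Z \<subseteq> \<Union>?S"
      using that[OF T0] top0 US by (auto simp: continuous_map_def)
  qed
  show "topological_ab_group G ?F"
    unfolding topological_ab_group_def
  proof (intro conjI comm top into)
    fix T assume T: "topological_ab_group G T" "limitin T u \<one>\<^bsub>G\<^esub> sequentially"
    have "continuous_map (prod_topology ?F ?F) (prod_topology T T) (\<lambda>(x, y). (x, y))"
      using finer[OF T] continuous_map_prod_top[of ?F ?F T T "\<lambda>x. x" "\<lambda>x. x"] by simp
    moreover have "continuous_map (prod_topology T T) T (\<lambda>(x, y). x \<otimes>\<^bsub>G\<^esub> y)"
      using T by (simp add: topological_ab_group_def)
    ultimately show "continuous_map (prod_topology ?F ?F) T (\<lambda>(x, y). x \<otimes>\<^bsub>G\<^esub> y)"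
      using continuous_map_compose by (fastforce simp: o_def case_prod_beta)
    show "continuous_map ?F T (\<lambda>x. inv\<^bsub>G\<^esub> x)"
      using continuous_map_compose[OF finer[OF T], of T "\<lambda>x. inv\<^bsub>G\<^esub> x"] T
      by (simp add: topological_ab_group_def o_def)
  qed
  show "limitin ?F u \<one>\<^bsub>G\<^esub> sequentially"
    unfolding limitin_def
  proof (intro conjI allI impI)
    interpret comm_group G by (rule comm)
    show "\<one>\<^bsub>G\<^esub> \<in> topspace ?F" by (simp add: top)
    fix U assume "openin ?F U \<and> \<one>\<^bsub>G\<^esub> \<in> U"
    then have "generate_topology_on ?S U" "\<one>\<^bsub>G\<^esub> \<in> U"
      by (auto simp: finest_topology_def openin_topology_generated_by_iff)
    then show "\<forall>\<^sub>F n in sequentially. u n \<in> U"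
    proof induction
      case (Int a b)
      then show ?case by (auto intro: eventually_conj)
    next
      case (UN K)
      then obtain k where "k \<in> K" "\<forall>\<^sub>F n in sequentially. u n \<in> k" by blast
      then show ?case by (auto elim: eventually_mono)
    next
      case (Basis s)
      then show ?case by (auto dest: limitinD)
    qed simp
  qed
qed

text \<open>
  In the following, \<open>u\<close> is a sequence of characters of \<open>A\<close>, indexed from 0.
\<close>

definition s_set :: "('a, 'm) monoid_scheme \<Rightarrow> (nat \<Rightarrow> 'a \<Rightarrow> complex) \<Rightarrow> 'a set" where
  "s_set A u = {x \<in> carrier A. (\<lambda>n. u n x) \<longlonglongrightarrow> 1}"

definition G_set :: "('a, 'm) monoid_scheme \<Rightarrow> (nat \<Rightarrow> 'a \<Rightarrow> complex) \<Rightarrow> ('a \<times> (nat \<Rightarrow> complex)) set"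
  where "G_set A u = (\<lambda>g. (g, \<lambda>n. u n g)) ` s_set A u"

definition G_group ::
    "('a, 'm) monoid_scheme \<Rightarrow> (nat \<Rightarrow> 'a \<Rightarrow> complex) \<Rightarrow> ('a \<times> (nat \<Rightarrow> complex)) monoid" where
  "G_group A u = (A \<times>\<times> null_seq_group)\<lparr>carrier := G_set A u\<rparr>"

definition G_topology ::
    "('a, 'm) monoid_scheme \<Rightarrow> 'a topology \<Rightarrow> (nat \<Rightarrow> 'a \<Rightarrow> complex) \<Rightarrow>
      ('a \<times> (nat \<Rightarrow> complex)) topology" where
  "G_topology A T u = subtopology (prod_topology T null_seq_topology) (G_set A u)"

definition eval_char ::
    "('a, 'm) monoid_scheme \<Rightarrow> 'a topology \<Rightarrow> 'a \<times> (nat \<Rightarrow> complex) \<Rightarrow> ('a \<Rightarrow> complex) \<Rightarrow> complex"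
  where "eval_char A T p = (\<lambda>y\<in>carrier (char_group A T). y (fst p))"

end

theory Submission
  imports Defs "HOL-Complex_Analysis.Great_Picard"
begin

text \<open>
  Write \<open>F\<close> for the finest group topology on the dual of \<open>G\<close> in which \<open>u\<close> tends to the identity.
  A homomorphism \<open>h\<close> from the dual into a topological abelian group is \<open>F\<close>-continuous as soon as
  \<open>h (u n)\<close> tends to the identity, because the pullback topology is one of the topologies that \<open>F\<close>
  dominates (\<open>finest_topology_hom_continuous\<close>). Applied to evaluation at a point \<open>g\<close> this says that
  the evaluations at points of \<open>s_set\<close> are \<open>F\<close>-continuous. Conversely an \<open>F\<close>-continuous character is
  evaluation at some point \<open>g\<close> by Pontryagin duality, and continuity along \<open>u\<close> forces \<open>u n g\<close> to tend
  to 1. This gives the bijection and, at once, the von Neumann radical.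

  The heart of the topological statement is that \<open>G_topology\<close> is finer than the compact-open topology
  (\<open>uniform_convergence_on_compact\<close>). Let \<open>g j\<close> converge to \<open>g0\<close> in the sense of \<open>G_topology\<close>, and
  send a character \<open>y\<close> to the sequence \<open>y (g j) * cnj (y g0)\<close>. This sequence tends to 1 because
  \<open>g j\<close> converges in \<open>G\<close>, so this is a homomorphism into \<open>null_seq_group\<close>. Convergence
  of the second coordinate, together with the convergence of \<open>u n (g j)\<close> to 1 for each \<open>j\<close>, shows that
  the images of the \<open>u n\<close> tend to the identity in the supremum metric; hence the homomorphism is \<open>F\<close>-continuous, it maps an \<open>F\<close>-compact set to a totally bounded set of
  null sequences, and such a set has uniformly small tails. In the other direction the compact
  set consisting of the \<open>u n\<close> and their limit controls the second coordinate, and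
  finitely many characters control the first one, since \<open>G\<close> is compact.

  Two facts of duality theory are used: characters separate the points of \<open>G\<close>, and
  every homomorphism from the dual to the circle is an evaluation. Both are proved from an invariant
  mean, which exists because averaging a continuous function over suitable
  translates makes it nearly constant.

  For the first fact (\<open>characters_separate_from_one\<close>) consider functions of positive type; morally
  these are the sums \<open>\<Sum> p\<^sub>\<xi> \<xi>\<close> over characters with coefficients \<open>p\<^sub>\<xi> \<ge> 0\<close>. For a fixed such
  function \<open>\<phi>\<close>, the functional \<open>\<psi> \<mapsto> mean (cnj \<phi> * \<psi>)\<close> attains its maximum
  on the normalized functions of positive type; its maximizers form a compact convex set, and
  a maximizer of the strictly convex functional \<open>mean (\<psi> * cnj \<psi>)\<close> on this set is an extreme
  point, which forces it to be multiplicative. It is a character with non-zero coefficient in \<open>\<phi>\<close>, and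
  \<open>\<phi>\<close> can be chosen without contributions from characters that are 1 at the given point.

  For the second fact (\<open>dual_homomorphism_is_evaluation\<close>), compactness reduces the claim to finitely
  many characters. There it is Bohr's argument for Kronecker's theorem: twisting a
  trigonometric polynomial by a homomorphism does not change the mean of any of its powers, hence does
  not lower the maximum of a non-negative one.
\<close>

section \<open>Averages over translates in a compact abelian group\<close>

locale compact_ab_group = comm_group G for G :: "('a, 'm) monoid_scheme" (structure) +
  fixes T
  assumes group_topology: "topological_ab_group G T" and compact: "compact_space T"
begin

abbreviation cont :: "('a \<Rightarrow> 'b::topological_space) \<Rightarrow> bool" where
  "cont \<equiv> continuous_map T euclidean"

lemma topspace_T [simp]: "topspace T = carrier G"
  using group_topology by (simp add: topological_ab_group_def)

lemma continuous_mult: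
  assumes "continuous_map X T f" "continuous_map X T g"
  shows "continuous_map X T (\<lambda>x. f x \<otimes> g x)"
proof -
  have "continuous_map (prod_topology T T) T (\<lambda>(x, y). x \<otimes> y)"
    using group_topology by (simp add: topological_ab_group_def)
  from continuous_map_compose[OF continuous_map_pairedI[OF assms] this]
  show ?thesis by (simp add: o_def)
qed

lemma continuous_translate:
  assumes "a \<in> carrier G"
  shows "continuous_map T T (\<lambda>x. a \<otimes> x)"
  by (rule continuous_mult) (auto simp: assms)

lemma continuous_inv: "continuous_map T T (\<lambda>x. inv x)"
  using group_topology by (simp add: topological_ab_group_def)

lemma continuous_translate_fun:
  assumes "continuous_map T Y f" "a \<in> carrier G"
  shows "continuous_map T Y (\<lambda>x. f (a \<otimes> x))"
  using continuous_map_compose[OF continuous_translate[OF assms(2)] assms(1)] by (simp add: o_def)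

text \<open>
  Uniform continuity, in the form that one neighbourhood of the identity serves all points; it
  follows from the tube lemma, as the group is compact.
\<close>

lemma uniform_nbhd:
  fixes f :: "'a \<Rightarrow> 'b::real_normed_vector"
  assumes f: "cont f" and "e > 0"
  obtains W where "openin T W" "\<one> \<in> W" "\<And>w x. w \<in> W \<Longrightarrow> x \<in> carrier G \<Longrightarrow> norm (f (w \<otimes> x) - f x) < e"
proof -
  let ?P = "prod_topology T T"
  let ?g = "\<lambda>p. norm (f (fst p \<otimes> snd p) - f (snd p))"
  have "continuous_map ?P T (\<lambda>p. fst p \<otimes> snd p)"
    by (intro continuous_mult continuous_map_fst continuous_map_snd)
  then have "continuous_map ?P euclidean ?g"
    using continuous_map_compose[OF _ f, of ?P "\<lambda>p. fst p \<otimes> snd p"]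
      continuous_map_compose[OF continuous_map_snd f]
    by (intro continuous_intros) (auto simp: o_def)
  then have 1: "openin ?P {p \<in> topspace ?P. ?g p \<in> {..<e}}"
    by (rule openin_continuous_map_preimage) auto
  have 2: "compactin T (carrier G)"
    using compact by (simp add: compact_space_def)
  have 3: "{\<one>} \<times> carrier G \<subseteq> {p \<in> topspace ?P. ?g p \<in> {..<e}}"
    using \<open>e > 0\<close> by auto
  obtain U V where UV: "openin T U" "\<one> \<in> U" "carrier G \<subseteq> V"
      "U \<times> V \<subseteq> {p \<in> topspace ?P. ?g p \<in> {..<e}}"
    using tube_lemma_right[OF 1 2 _ 3] by auto
  show ?thesis
  proof (rule that[OF UV(1,2)])
    fix w x assume "w \<in> U" "x \<in> carrier G"
    then have "(w, x) \<in> {p \<in> topspace ?P. ?g p \<in> {..<e}}" using UV(3,4) by blast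
    then show "norm (f (w \<otimes> x) - f x) < e" by simp
  qed
qed

lemma continuousI_uniform_nbhd:
  fixes f :: "'a \<Rightarrow> 'b::real_normed_vector"
  assumes "\<And>e. e > 0 \<Longrightarrow> \<exists>W. openin T W \<and> \<one> \<in> W \<and> (\<forall>w\<in>W. \<forall>x\<in>carrier G. norm (f (w \<otimes> x) - f x) \<le> e)"
  shows "cont f"
proof -
  have "\<exists>U. openin T U \<and> x \<in> U \<and> (\<forall>y\<in>U. f y \<in> ball (f x) e)" if "x \<in> carrier G" "e > 0" for x e
  proof -
    obtain W where W: "openin T W" "\<one> \<in> W" "\<And>w x. w \<in> W \<Longrightarrow> x \<in> carrier G \<Longrightarrow> norm (f (w \<otimes> x) - f x) \<le> e/2"
      using assms[of "e/2"] \<open>e > 0\<close> by auto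
    let ?U = "{y \<in> carrier G. y \<otimes> inv x \<in> W}"
    have "continuous_map T T (\<lambda>y. y \<otimes> inv x)"
      using that by (intro continuous_mult) auto
    then have "openin T ?U"
      using openin_continuous_map_preimage[OF _ W(1)] by fastforce
    moreover have "x \<in> ?U"
      using that W by simp
    moreover have "f y \<in> ball (f x) e" if "y \<in> ?U" for y
    proof -
      have "y \<otimes> inv x \<otimes> x = y"
        using that \<open>x \<in> carrier G\<close> by (simp add: m_assoc)
      then have "norm (f y - f x) \<le> e/2"
        using W(3)[of "y \<otimes> inv x" x] that \<open>x \<in> carrier G\<close> by simp
      then show ?thesis using \<open>e > 0\<close> by (simp add: dist_norm norm_minus_commute)
    qed
    ultimately show ?thesis by blast
  qed
  then show ?thesis
    using Met_TC.continuous_map_to_metric[of T f] by simp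
qed

abbreviation point_list :: "'a list \<Rightarrow> bool" where
  "point_list as \<equiv> as \<noteq> [] \<and> set as \<subseteq> carrier G"

lemma translates_cover:
  assumes "openin T U" "u \<in> U"
  shows "\<exists>as. point_list as \<and> (\<forall>x\<in>carrier G. \<exists>a\<in>set as. a \<otimes> x \<in> U)"
proof -
  let ?V = "\<lambda>a. {x \<in> carrier G. a \<otimes> x \<in> U}"
  have u: "u \<in> U" "u \<in> carrier G" using assms openin_subset by fastforce+
  have "openin T (?V a)" if "a \<in> carrier G" for a
    using openin_continuous_map_preimage[OF continuous_translate[OF that] assms(1)] by simp
  moreover have "carrier G \<subseteq> \<Union>(?V ` carrier G)"
  proof
    fix x assume "x \<in> carrier G"
    then have "x \<in> ?V (u \<otimes> inv x)" "u \<otimes> inv x \<in> carrier G"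
      using u by (auto simp: m_assoc)
    then show "x \<in> \<Union>(?V ` carrier G)" by blast
  qed
  ultimately obtain \<F> where "finite \<F>" "\<F> \<subseteq> ?V ` carrier G" "carrier G \<subseteq> \<Union>\<F>"
    using compact[unfolded compact_space_alt, rule_format, of "?V ` carrier G"] by auto
  then obtain S where S: "finite S" "S \<subseteq> carrier G" "carrier G \<subseteq> \<Union>(?V ` S)"
    using finite_subset_image[of \<F> ?V "carrier G"] by blast
  obtain as where "set as = S" using S finite_list by blast
  moreover have "S \<noteq> {}" using S by auto
  ultimately show ?thesis
    using S by (intro exI[of _ as]) auto
qed

definition avg :: "'a list \<Rightarrow> ('a \<Rightarrow> 'b::real_normed_vector) \<Rightarrow> 'a \<Rightarrow> 'b" where
  "avg as f x = (\<Sum>a\<leftarrow>as. f (a \<otimes> x)) /\<^sub>R real (length as)"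



lemma avg_cong:
  assumes "point_list as" "x \<in> carrier G" "\<And>y. y \<in> carrier G \<Longrightarrow> f y = g y"
  shows "avg as f x = avg as g x"
proof -
  have "map (\<lambda>a. f (a \<otimes> x)) as = map (\<lambda>a. g (a \<otimes> x)) as"
    using assms by (auto intro!: map_cong)
  then show ?thesis by (simp only: avg_def)
qed

lemma avg_linear:
  assumes "linear h"
  shows "avg as (\<lambda>x. h (f x)) x = h (avg as f x)"
proof -
  have "(\<Sum>a\<leftarrow>as. h (f (a \<otimes> x))) = h (\<Sum>a\<leftarrow>as. f (a \<otimes> x))"
    by (induction as) (auto simp: linear_0[OF assms] linear_add[OF assms])
  then show ?thesis by (simp add: avg_def linear_scale[OF assms])
qed

lemma avg_add: "avg as (\<lambda>x. f x + g x) x = avg as f x + avg as g x"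
  by (simp add: avg_def sum_list_addf scaleR_add_right)

lemma avg_const: "as \<noteq> [] \<Longrightarrow> avg as (\<lambda>x. c) x = c"
proof -
  have "(\<Sum>a\<leftarrow>as. c) = real (length as) *\<^sub>R c"
    by (induction as) (auto simp: scaleR_add_left)
  then show "as \<noteq> [] \<Longrightarrow> ?thesis" by (simp add: avg_def)
qed

lemma avg_diff: "avg as (\<lambda>x. f x - g x) x = avg as f x - avg as g x"
  by (simp add: avg_def sum_list_subtractf scaleR_diff_right)

lemma norm_avg_le:
  assumes "point_list as" "x \<in> carrier G" "\<And>y. y \<in> carrier G \<Longrightarrow> norm (f y) \<le> e"
  shows "norm (avg as f x) \<le> e"
proof -
  have "norm (\<Sum>a\<leftarrow>as. f (a \<otimes> x)) \<le> real (length as) * e" if "set as \<subseteq> carrier G" for as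
    using that
  proof (induction as)
    case (Cons a as)
    then have "norm (f (a \<otimes> x)) \<le> e" using assms by simp
    with Cons show ?case by (auto simp: algebra_simps intro: norm_triangle_le add_mono)
  qed simp
  with assms show ?thesis by (auto simp: avg_def field_simps)
qed

lemma avg_near_const:
  assumes "point_list as" "x \<in> carrier G" "\<And>y. y \<in> carrier G \<Longrightarrow> norm (f y - c) \<le> e"
  shows "norm (avg as f x - c) \<le> e"
  using norm_avg_le[of as x "\<lambda>y. f y - c" e] assms by (simp add: avg_diff avg_const)

lemma avg_mono:
  fixes f g :: "'a \<Rightarrow> real"
  assumes "point_list as" "x \<in> carrier G" "\<And>y. y \<in> carrier G \<Longrightarrow> f y \<le> g y"
  shows "avg as f x \<le> avg as g x"
  unfolding avg_def using assms by (auto intro!: scaleR_left_mono sum_list_mono)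

lemma avg_avg:
  assumes "point_list as" "point_list bs"
  obtains cs where "point_list cs"
    "\<And>(f :: 'a \<Rightarrow> 'b::real_normed_vector) x. x \<in> carrier G \<Longrightarrow> avg as (avg bs f) x = avg cs f x"
proof
  let ?cs = "concat (map (\<lambda>a. map (\<lambda>b. b \<otimes> a) bs) as)"
  show "point_list ?cs" using assms by (auto dest!: subsetD)
  have len: "length ?cs = length as * length bs"
    by (induction as) auto
  fix f :: "'a \<Rightarrow> 'b" and x assume x: "x \<in> carrier G"
  have "(\<Sum>a\<leftarrow>as. \<Sum>b\<leftarrow>bs. f (b \<otimes> (a \<otimes> x))) = (\<Sum>c\<leftarrow>?cs. f (c \<otimes> x))"
    using assms(1)[THEN conjunct2]
  proof (induction as)
    case (Cons a as)
    have "map (\<lambda>b. f (b \<otimes> (a \<otimes> x))) bs = map (\<lambda>b. f (b \<otimes> a \<otimes> x)) bs"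
      using assms(2) Cons.prems x by (intro map_cong refl) (simp add: m_assoc subset_eq)
    then have "(\<Sum>b\<leftarrow>bs. f (b \<otimes> (a \<otimes> x))) = (\<Sum>b\<leftarrow>bs. f (b \<otimes> a \<otimes> x))"
      by (simp only:)
    with Cons show ?case by (simp add: o_def)
  qed simp
  moreover have "(\<Sum>a\<leftarrow>as. (\<Sum>b\<leftarrow>bs. f (b \<otimes> (a \<otimes> x))) /\<^sub>R real (length bs))
      = (\<Sum>a\<leftarrow>as. \<Sum>b\<leftarrow>bs. f (b \<otimes> (a \<otimes> x))) /\<^sub>R real (length bs)"
    by (induction as) (auto simp: scaleR_add_right)
  ultimately show "avg as (avg bs f) x = avg ?cs f x"
    unfolding avg_def len by simp
qed

text \<open>As the group is commutative, so are averages; this makes the constant that they approximate unique.\<close>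

lemma avg_commute:
  assumes "point_list as" "point_list bs" "x \<in> carrier G"
  shows "avg as (avg bs f) x = avg bs (avg as f) x"
proof -
  have *: "avg as (avg bs f) x = (\<Sum>a\<leftarrow>as. \<Sum>b\<leftarrow>bs. f (b \<otimes> (a \<otimes> x))) /\<^sub>R (real (length bs) * real (length as))" for as bs
  proof -
    have "(\<Sum>a\<leftarrow>as. (\<Sum>b\<leftarrow>bs. f (b \<otimes> (a \<otimes> x))) /\<^sub>R real (length bs))
        = (\<Sum>a\<leftarrow>as. \<Sum>b\<leftarrow>bs. f (b \<otimes> (a \<otimes> x))) /\<^sub>R real (length bs)"
      by (induction as) (auto simp: scaleR_add_right)
    then show ?thesis unfolding avg_def by simp
  qed
  have "(\<Sum>a\<leftarrow>as. \<Sum>b\<leftarrow>bs. f (b \<otimes> (a \<otimes> x))) = (\<Sum>b\<leftarrow>bs. \<Sum>a\<leftarrow>as. f (b \<otimes> (a \<otimes> x)))"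
    by (induction as) (auto simp: sum_list_addf)
  also have "\<dots> = (\<Sum>b\<leftarrow>bs. \<Sum>a\<leftarrow>as. f (a \<otimes> (b \<otimes> x)))"
    using assms by (intro arg_cong[of _ _ sum_list] map_cong refl) (auto simp: m_lcomm subset_eq)
  finally show ?thesis
    unfolding * by (simp add: mult.commute)
qed

lemma continuous_avg:
  fixes f :: "'a \<Rightarrow> 'b::real_normed_vector"
  assumes "point_list as" "cont f"
  shows "cont (avg as f)"
proof -
  have "cont (\<lambda>x. \<Sum>a\<leftarrow>as. f (a \<otimes> x))" if "set as \<subseteq> carrier G" for as
    using that
  proof (induction as)
    case (Cons a as)
    then show ?case by (auto intro!: continuous_map_add continuous_translate_fun assms)
  qed simp
  with assms have "cont (\<lambda>x. \<Sum>a\<leftarrow>as. f (a \<otimes> x))" by blast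
  then have "cont ((\<lambda>y. y /\<^sub>R real (length as)) \<circ> (\<lambda>x. \<Sum>a\<leftarrow>as. f (a \<otimes> x)))"
    by (rule continuous_map_compose) (auto intro!: continuous_intros)
  then show ?thesis by (simp add: avg_def[abs_def] o_def)
qed

lemma continuous_bounded:
  fixes f :: "'a \<Rightarrow> 'b::real_normed_vector"
  assumes "cont f"
  obtains B where "B > 0" "\<And>x. x \<in> carrier G \<Longrightarrow> norm (f x) \<le> B"
proof -
  have "compactin T (carrier G)" using compact by (simp add: compact_space_def)
  then have "compact (f ` carrier G)"
    using image_compactin[OF _ assms] by simp
  then show ?thesis
    using that compact_imp_bounded bounded_pos by (metis image_eqI)
qed

text \<open>
  All averages \<open>h\<close> of \<open>f\<close> share one modulus of continuity. Hence there is a list of \<open>N\<close> translates such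
  that, at each point, one of the \<open>N\<close> translated values of \<open>h\<close> differs from \<open>h \<one>\<close> by at most \<open>e'\<close>. As
  \<open>h \<one>\<close> lies in the lower or in the upper half of the range of \<open>h\<close>, averaging over the list shrinks
  the excess of the oscillation over \<open>2 * e'\<close> by the factor \<open>1 - 1/(2N)\<close>, and iteration makes this
  excess arbitrarily small.
\<close>

lemma real_averages_nearly_constant:
  fixes f :: "'a \<Rightarrow> real"
  assumes f: "cont f" and "e > 0"
  obtains as c where "point_list as" "\<And>x. x \<in> carrier G \<Longrightarrow> \<bar>avg as f x - c\<bar> \<le> e"
proof -
  \<comment> \<open>The oscillation will be at most \<open>2 * e'\<close> plus a term that becomes smaller than \<open>e'\<close>.\<close>
  define e' where "e' = e/3"
  have e': "e' > 0" using \<open>e > 0\<close> by (simp add: e'_def)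
  obtain W where W: "openin T W" "\<one> \<in> W" "\<And>w x. w \<in> W \<Longrightarrow> x \<in> carrier G \<Longrightarrow> norm (f (w \<otimes> x) - f x) < e'"
    using uniform_nbhd[OF f e'] by blast
  obtain bs where bs: "point_list bs" "\<And>x. x \<in> carrier G \<Longrightarrow> \<exists>b\<in>set bs. b \<otimes> x \<in> W"
    using translates_cover[OF W(1,2)] by blast
  define N where "N = real (length bs)"
  have N: "N \<ge> 1" using bs(1) by (cases bs) (auto simp: N_def)
  define P where "P L \<longleftrightarrow> (\<exists>as c. point_list as \<and> (\<forall>x\<in>carrier G. c \<le> avg as f x \<and> avg as f x \<le> c + L))" for L
  have step: "P (2*e' + D * (1 - 1/(2*N)))" if PD: "P (2*e' + D)" "D > 0" for D
  proof -
    let ?L = "2*e' + D"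
    obtain as c where as: "point_list as" and c: "\<And>x. x \<in> carrier G \<Longrightarrow> c \<le> avg as f x \<and> avg as f x \<le> c + ?L"
      using PD unfolding P_def by blast
    define h where "h = avg as f"
    have close: "\<exists>b\<in>set bs. \<bar>h (b \<otimes> x) - h \<one>\<bar> \<le> e'" if x: "x \<in> carrier G" for x
    proof -
      obtain b where b: "b \<in> set bs" "b \<otimes> x \<in> W" using bs(2)[OF x] by blast
      have "norm (f (b \<otimes> x \<otimes> y) - f y) \<le> e'" if "y \<in> carrier G" for y
        using W(3)[of "b \<otimes> x" y] b that by (auto intro: less_imp_le)
      then have "norm (avg as (\<lambda>y. f (b \<otimes> x \<otimes> y) - f y) \<one>) \<le> e'"
        using as by (intro norm_avg_le) auto
      moreover have "avg as (\<lambda>y. f (b \<otimes> x \<otimes> y)) \<one> = h (b \<otimes> x)"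
      proof -
        have "b \<in> carrier G" using b bs by blast
        then have "map (\<lambda>a. f (b \<otimes> x \<otimes> (a \<otimes> \<one>))) as = map (\<lambda>a. f (a \<otimes> (b \<otimes> x))) as"
          using as x by (auto simp: m_comm subset_eq)
        then show ?thesis by (simp only: avg_def h_def)
      qed
      ultimately show ?thesis using b by (auto simp: avg_diff h_def)
    qed
    have sum_bound: "(\<Sum>b\<leftarrow>bs. k b) \<le> N * M - (M - m)"
      if k: "\<And>b. b \<in> set bs \<Longrightarrow> k b \<le> M" and "b0 \<in> set bs" "k b0 \<le> m" for k :: "'a \<Rightarrow> real" and M m b0
    proof -
      obtain l r where lr: "bs = l @ b0 # r" using split_list[OF \<open>b0 \<in> set bs\<close>] by blast
      have "(\<Sum>b\<leftarrow>xs. k b) \<le> real (length xs) * M" if "set xs \<subseteq> set bs" for xs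
        using that
      proof (induction xs)
        case (Cons b xs)
        then have "k b \<le> M" using k by simp
        with Cons show ?case by (simp add: algebra_simps)
      qed simp
      then have "(\<Sum>b\<leftarrow>l. k b) \<le> real (length l) * M" "(\<Sum>b\<leftarrow>r. k b) \<le> real (length r) * M"
        using lr by auto
      then show ?thesis
        using lr \<open>k b0 \<le> m\<close> by (simp add: N_def algebra_simps)
    qed
    have avg_bound: "avg bs k x \<le> M - (M - m) / N"
      if "\<And>y. y \<in> carrier G \<Longrightarrow> k y \<le> M" "x \<in> carrier G" "b0 \<in> set bs" "k (b0 \<otimes> x) \<le> m"
      for k :: "'a \<Rightarrow> real" and x M m b0
    proof -
      have "(\<Sum>b\<leftarrow>bs. k (b \<otimes> x)) \<le> N * M - (M - m)"
        using that bs(1) by (intro sum_bound[of _ _ b0]) auto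
      then show ?thesis
        using N by (simp add: avg_def flip: N_def) (simp add: field_simps)
    qed
    obtain cs where cs: "point_list cs" "\<And>(g :: 'a \<Rightarrow> real) x. x \<in> carrier G \<Longrightarrow> avg bs (avg as g) x = avg cs g x"
      using avg_avg[OF bs(1) as] by blast
    have L': "2*e' + D * (1 - 1/(2*N)) = ?L - D/(2*N)"
      by (simp add: algebra_simps)
    have low: "c \<le> avg bs h x" and up: "avg bs h x \<le> c + ?L" if "x \<in> carrier G" for x
      using avg_mono[OF bs(1) that, of "\<lambda>_. c" h] avg_mono[OF bs(1) that, of h "\<lambda>_. c + ?L"] c bs(1)
      by (auto simp: avg_const h_def)
    show ?thesis
    proof (cases "h \<one> \<le> c + ?L/2")
      case True
      have "avg bs h x \<le> c + (?L - D/(2*N))" if x: "x \<in> carrier G" for x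
      proof -
        obtain b where b: "b \<in> set bs" "\<bar>h (b \<otimes> x) - h \<one>\<bar> \<le> e'" using close[OF x] by blast
        have "avg bs h x \<le> (c + ?L) - ((c + ?L) - (c + ?L/2 + e')) / N"
          using c b True x by (intro avg_bound[of h "c + ?L" x b]) (auto simp: h_def)
        then show ?thesis by (simp add: field_simps)
      qed
      with low cs show ?thesis unfolding P_def L'
        by (intro exI[of _ cs] exI[of _ c]) (auto simp: h_def)
    next
      case False
      have "c + D/(2*N) \<le> avg bs h x" if x: "x \<in> carrier G" for x
      proof -
        obtain b where b: "b \<in> set bs" "\<bar>h (b \<otimes> x) - h \<one>\<bar> \<le> e'" using close[OF x] by blast
        have "avg bs (\<lambda>x. - h x) x \<le> (- c) - ((- c) - (- c - ?L/2 + e')) / N"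
          using c b False x by (intro avg_bound[of _ "- c" x b]) (auto simp: h_def)
        moreover have "avg bs (\<lambda>x. - h x) x = - avg bs h x"
          by (rule avg_linear) (auto intro: linearI)
        ultimately show ?thesis by (simp add: field_simps)
      qed
      with up cs show ?thesis unfolding P_def L' 
        by (intro exI[of _ cs] exI[of _ "c + D/(2*N)"]) (auto simp: h_def)
    qed
  qed
  obtain B where B: "B > 0" "\<And>x. x \<in> carrier G \<Longrightarrow> norm (f x) \<le> B"
    using continuous_bounded[OF f] by blast
  have P: "P (2*e' + 2*B * (1 - 1/(2*N))^k)" for k
  proof (induction k)
    case 0
    have "- B \<le> avg [\<one>] f x \<and> avg [\<one>] f x \<le> - B + (2*e' + 2*B)" if "x \<in> carrier G" for x
      using B(2)[OF that] that e' by (auto simp: avg_def)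
    then have "\<exists>as c. point_list as \<and> (\<forall>x\<in>carrier G. c \<le> avg as f x \<and> avg as f x \<le> c + (2*e' + 2*B))"
      by (intro exI[of _ "[\<one>]"] exI[of _ "-B"]) auto
    then show ?case by (simp add: P_def)
  next
    case (Suc k)
    have "2*B * (1 - 1/(2*N))^k > 0" using B N by (auto simp: field_simps)
    from step[OF Suc this] show ?case by (simp add: mult.commute mult.left_commute)
  qed
  have "(\<lambda>k. 2*B * (1 - 1/(2*N))^k) \<longlonglongrightarrow> 2*B * 0"
    using N by (intro tendsto_intros LIMSEQ_realpow_zero) (auto simp: field_simps)
  then have "\<forall>\<^sub>F k in sequentially. 2*B * (1 - 1/(2*N))^k < e'"
    using e' by (auto dest: order_tendstoD)
  then obtain k where k: "2*B * (1 - 1/(2*N))^k < e'"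
    by (auto simp: eventually_sequentially)
  obtain as c where "point_list as" "\<And>x. x \<in> carrier G \<Longrightarrow> c \<le> avg as f x \<and> avg as f x \<le> c + (2*e' + 2*B * (1 - 1/(2*N))^k)"
    using P[of k] unfolding P_def by blast
  with k show ?thesis by (intro that[of as c]) (force simp: e'_def)+
qed

end

section \<open>The invariant mean\<close>

context compact_ab_group
begin

text \<open>
  The mean of a continuous function is the only constant that is a uniform limit of averages of its
  translates. It is integration against normalized Haar measure.
\<close>

definition is_mean :: "('a \<Rightarrow> complex) \<Rightarrow> complex \<Rightarrow> bool" where
  "is_mean f c \<longleftrightarrow> (\<forall>e>0. \<exists>as. point_list as \<and> (\<forall>x\<in>carrier G. cmod (avg as f x - c) \<le> e))"

definition mean :: "('a \<Rightarrow> complex) \<Rightarrow> complex" where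
  "mean f = (THE c. is_mean f c)"

text \<open>
  Two averages commute, and an average of a nearly constant function stays near the
  same constant; so the double average is near both constants.
\<close>

lemma near_constants_close:
  assumes "point_list as" "\<And>x. x \<in> carrier G \<Longrightarrow> norm (avg as f x - c) \<le> d"
    and "point_list bs" "\<And>x. x \<in> carrier G \<Longrightarrow> norm (avg bs f x - c') \<le> d'"
  shows "norm (c - c') \<le> d + d'"
proof -
  have "norm (avg bs (avg as f) \<one> - c) \<le> d"
    by (rule avg_near_const[OF assms(3) one_closed assms(2)])
  moreover have "norm (avg as (avg bs f) \<one> - c') \<le> d'"
    by (rule avg_near_const[OF assms(1) one_closed assms(4)])
  moreover have "avg as (avg bs f) \<one> = avg bs (avg as f) \<one>"
    by (rule avg_commute[OF assms(1,3) one_closed])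
  ultimately show ?thesis
    using norm_triangle_ineq4[of "avg bs (avg as f) \<one> - c'" "avg bs (avg as f) \<one> - c"] by simp
qed

lemma is_mean_unique:
  assumes "is_mean f c" "is_mean f d"
  shows "c = d"
proof -
  have "cmod (c - d) \<le> 0 + e" if "e > 0" for e
  proof -
    obtain as where as: "point_list as" "\<forall>x\<in>carrier G. cmod (avg as f x - c) \<le> e/2"
      using assms(1) \<open>e > 0\<close> unfolding is_mean_def by (meson half_gt_zero)
    obtain bs where bs: "point_list bs" "\<forall>x\<in>carrier G. cmod (avg bs f x - d) \<le> e/2"
      using assms(2) \<open>e > 0\<close> unfolding is_mean_def by (meson half_gt_zero)
    show ?thesis
      using near_constants_close[of as f c "e/2" bs d "e/2"] as bs by simp
  qed
  then have "cmod (c - d) \<le> 0" by (rule field_le_epsilon)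
  then show ?thesis by simp
qed

lemma averages_nearly_constant:
  fixes f :: "'a \<Rightarrow> complex"
  assumes f: "cont f" and "e > 0"
  shows "\<exists>as c. point_list as \<and> (\<forall>x\<in>carrier G. cmod (avg as f x - c) \<le> e)"
proof -
  have "cont (Re \<circ> f)" "cont (Im \<circ> f)"
    by (rule continuous_map_compose[OF f], auto intro: continuous_on_Re continuous_on_Im continuous_on_id)+
  then have cont: "cont (\<lambda>x. Re (f x))" "cont (\<lambda>x. Im (f x))"
    by (simp_all add: o_def)
  obtain as c where as: "point_list as" "\<And>x. x \<in> carrier G \<Longrightarrow> \<bar>avg as (\<lambda>x. Re (f x)) x - c\<bar> \<le> e/2"
    using real_averages_nearly_constant[OF cont(1), of "e/2"] \<open>e > 0\<close> by (metis half_gt_zero)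
  obtain bs d where bs: "point_list bs" "\<And>x. x \<in> carrier G \<Longrightarrow> \<bar>avg bs (avg as (\<lambda>x. Im (f x))) x - d\<bar> \<le> e/2"
    using real_averages_nearly_constant[OF continuous_avg[OF as(1) cont(2)], of "e/2"] \<open>e > 0\<close> by (metis half_gt_zero)
  obtain cs where cs: "point_list cs" "\<And>(f :: 'a \<Rightarrow> complex) x. x \<in> carrier G \<Longrightarrow> avg bs (avg as f) x = avg cs f x"
    using avg_avg[OF bs(1) as(1)] by blast
  have "cmod (avg cs f x - Complex c d) \<le> e" if x: "x \<in> carrier G" for x
  proof -
    have lin: "linear Re" "linear Im" by (auto intro: linearI)
    have "Re (avg cs f x) = avg bs (avg as (\<lambda>x. Re (f x))) x"
      using cs(2)[OF x, of f, symmetric] by (simp flip: avg_linear[OF lin(1)])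
    then have "\<bar>Re (avg cs f x - Complex c d)\<bar> \<le> e/2"
      using avg_near_const[OF bs(1) x, of "avg as (\<lambda>x. Re (f x))" c "e/2"] as(2) by simp
    moreover have "Im (avg cs f x) = avg bs (avg as (\<lambda>x. Im (f x))) x"
      using cs(2)[OF x, of f, symmetric] by (simp flip: avg_linear[OF lin(2)])
    then have "\<bar>Im (avg cs f x - Complex c d)\<bar> \<le> e/2"
      using bs(2)[OF x] by simp
    ultimately show ?thesis
      using cmod_le[of "avg cs f x - Complex c d"] by linarith
  qed
  then show ?thesis using cs(1) by blast
qed

lemma is_mean_exists:
  assumes "cont f"
  shows "\<exists>c. is_mean f c"
proof -
  define \<epsilon> where "\<epsilon> n = inverse (real (Suc n))" for n
  have pos: "\<epsilon> n > 0" for n by (simp add: \<epsilon>_def)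
  have lim: "\<epsilon> \<longlonglongrightarrow> 0" unfolding \<epsilon>_def by (rule LIMSEQ_inverse_real_of_nat)
  have small: "\<exists>N. \<forall>n\<ge>N. \<epsilon> n < e" if "e > 0" for e
    using order_tendstoD(2)[OF lim that] by (simp add: eventually_sequentially)
  have "\<forall>n. \<exists>as c. point_list as \<and> (\<forall>x\<in>carrier G. cmod (avg as f x - c) \<le> \<epsilon> n)"
    using averages_nearly_constant[OF assms pos] by blast
  then obtain as c where as: "\<And>n. point_list (as n)"
      and c: "\<And>n x. x \<in> carrier G \<Longrightarrow> cmod (avg (as n) f x - c n) \<le> \<epsilon> n"
    by metis
  have close: "cmod (c m - c n) \<le> \<epsilon> m + \<epsilon> n" for m n
    by (rule near_constants_close[OF as c as c])
  have "Cauchy c"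
  proof (rule metric_CauchyI)
    fix e :: real assume "e > 0"
    then obtain N where "\<forall>n\<ge>N. \<epsilon> n < e/2" using small[of "e/2"] by auto
    then have "dist (c m) (c n) < e" if "m \<ge> N" "n \<ge> N" for m n
      using order_le_less_trans[OF close[of m n]] that
      by (metis add_strict_mono dist_norm field_sum_of_halves)
    then show "\<exists>M. \<forall>m\<ge>M. \<forall>n\<ge>M. dist (c m) (c n) < e" by blast
  qed
  then obtain L where L: "c \<longlonglongrightarrow> L" using Cauchy_convergent by (auto simp: convergent_def)
  have "is_mean f L"
    unfolding is_mean_def
  proof (intro allI impI)
    fix e :: real assume "e > 0"
    then have "\<exists>N. \<forall>n\<ge>N. \<epsilon> n < e/2" by (intro small) simp
    then obtain N where N: "\<forall>n\<ge>N. \<epsilon> n < e/2" ..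
    have "\<forall>\<^sub>F n in sequentially. cmod (c n - L) < e/2"
      using tendstoD[OF L, of "e/2"] \<open>e > 0\<close> by (simp add: dist_norm)
    then obtain M where M: "\<And>n. n \<ge> M \<Longrightarrow> cmod (c n - L) < e/2" by (auto simp: eventually_sequentially)
    define n where "n = max M N"
    have "cmod (avg (as n) f x - L) \<le> e" if "x \<in> carrier G" for x
    proof -
      have "\<epsilon> n < e/2" "cmod (c n - L) < e/2" using N M by (simp_all add: n_def)
      then show ?thesis
        using c[OF that, of n] norm_triangle_ineq[of "avg (as n) f x - c n" "c n - L"] by simp
    qed
    then show "\<exists>as. point_list as \<and> (\<forall>x\<in>carrier G. cmod (avg as f x - L) \<le> e)" using as by blast
  qed
  then show ?thesis ..
qed

lemma mean_eqI: "is_mean f c \<Longrightarrow> mean f = c"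
  unfolding mean_def using is_mean_unique by blast

lemma is_mean_mean: "cont f \<Longrightarrow> is_mean f (mean f)"
  using is_mean_exists mean_eqI by metis

lemma mean_approx:
  assumes "cont f" "e > 0"
  shows "\<exists>as. point_list as \<and> (\<forall>x\<in>carrier G. cmod (avg as f x - mean f) \<le> e)"
  using is_mean_mean[OF assms(1)] assms(2) by (simp add: is_mean_def)

lemma mean_cong:
  assumes "\<And>x. x \<in> carrier G \<Longrightarrow> f x = g x"
  shows "mean f = mean g"
proof -
  have "(\<forall>x\<in>carrier G. cmod (avg as f x - c) \<le> e) \<longleftrightarrow> (\<forall>x\<in>carrier G. cmod (avg as g x - c) \<le> e)"
    if "point_list as" for as c e
    using avg_cong[OF that _ assms] by simp
  then have "is_mean f c \<longleftrightarrow> is_mean g c" for c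
    by (simp add: is_mean_def cong: conj_cong)
  then show ?thesis by (simp add: mean_def)
qed

lemma mean_const: "mean (\<lambda>x. c) = c"
  by (rule mean_eqI) (auto simp: is_mean_def avg_const intro!: exI[of _ "[\<one>]"])

lemma mean_add:
  assumes "cont f" "cont g"
  shows "mean (\<lambda>x. f x + g x) = mean f + mean g"
proof (rule mean_eqI, unfold is_mean_def, intro allI impI)
  fix e :: real assume "e > 0"
  then have e2: "e/2 > 0" by simp
  obtain as where as: "point_list as" "\<And>x. x \<in> carrier G \<Longrightarrow> cmod (avg as f x - mean f) \<le> e/2"
    using mean_approx[OF assms(1) e2] by blast
  obtain bs where bs: "point_list bs" "\<And>x. x \<in> carrier G \<Longrightarrow> cmod (avg bs g x - mean g) \<le> e/2"
    using mean_approx[OF assms(2) e2] by blast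
  obtain cs where cs: "point_list cs" "\<And>(f :: 'a \<Rightarrow> complex) x. x \<in> carrier G \<Longrightarrow> avg as (avg bs f) x = avg cs f x"
    using avg_avg[OF as(1) bs(1)] by blast
  have "cmod (avg cs (\<lambda>x. f x + g x) x - (mean f + mean g)) \<le> e" if x: "x \<in> carrier G" for x
  proof -
    have "avg cs f x = avg bs (avg as f) x" "avg cs g x = avg as (avg bs g) x"
      using cs(2)[OF x] avg_commute[OF as(1) bs(1) x] by metis+
    then have "cmod (avg cs f x - mean f) \<le> e/2" "cmod (avg cs g x - mean g) \<le> e/2"
      using avg_near_const[OF bs(1) x as(2)] avg_near_const[OF as(1) x bs(2)] by simp_all
    then show ?thesis
      using norm_triangle_ineq[of "avg cs f x - mean f" "avg cs g x - mean g"]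
      by (simp add: avg_add algebra_simps)
  qed
  then show "\<exists>as. point_list as \<and> (\<forall>x\<in>carrier G. cmod (avg as (\<lambda>x. f x + g x) x - (mean f + mean g)) \<le> e)"
    using cs(1) by blast
qed

lemma mean_bounded_linear:
  assumes h: "bounded_linear h" and "cont f"
  shows "mean (\<lambda>x. h (f x)) = h (mean f)"
proof (rule mean_eqI, unfold is_mean_def, intro allI impI)
  fix e :: real assume "e > 0"
  obtain K where K: "K > 0" "\<And>z. norm (h z) \<le> norm z * K"
    using bounded_linear.pos_bounded[OF h] by blast
  have eK: "e/K > 0" using K \<open>e > 0\<close> by simp
  obtain as where as: "point_list as" "\<And>x. x \<in> carrier G \<Longrightarrow> cmod (avg as f x - mean f) \<le> e/K"
    using mean_approx[OF assms(2) eK] by blast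
  have "cmod (avg as (\<lambda>x. h (f x)) x - h (mean f)) \<le> e" if "x \<in> carrier G" for x
  proof -
    have "avg as (\<lambda>x. h (f x)) x - h (mean f) = h (avg as f x - mean f)"
      using avg_linear[OF bounded_linear.linear[OF h]] by (simp add: bounded_linear.linear[OF h] linear_diff)
    then have "cmod (avg as (\<lambda>x. h (f x)) x - h (mean f)) \<le> cmod (avg as f x - mean f) * K"
      using K by simp
    also have "\<dots> \<le> e/K * K" using as(2)[OF that] K by (intro mult_right_mono) auto
    finally show ?thesis using K by simp
  qed
  then show "\<exists>as. point_list as \<and> (\<forall>x\<in>carrier G. cmod (avg as (\<lambda>x. h (f x)) x - h (mean f)) \<le> e)"
    using as by blast
qed

lemma mean_cmult: "cont f \<Longrightarrow> mean (\<lambda>x. c * f x) = c * mean f"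
  by (rule mean_bounded_linear[OF bounded_linear_mult_right])

lemma mean_cnj: "cont f \<Longrightarrow> mean (\<lambda>x. cnj (f x)) = cnj (mean f)"
  by (rule mean_bounded_linear[OF bounded_linear_cnj])

lemma mean_translate:
  assumes "cont f" "a \<in> carrier G"
  shows "mean (\<lambda>x. f (a \<otimes> x)) = mean f"
proof (rule mean_eqI, unfold is_mean_def, intro allI impI)
  fix e :: real assume e: "e > 0"
  obtain as where as: "point_list as" "\<And>x. x \<in> carrier G \<Longrightarrow> cmod (avg as f x - mean f) \<le> e"
    using mean_approx[OF assms(1) e] by blast
  have "avg as (\<lambda>x. f (a \<otimes> x)) x = avg as f (a \<otimes> x)" if "x \<in> carrier G" for x
  proof -
    have "map (\<lambda>b. f (a \<otimes> (b \<otimes> x))) as = map (\<lambda>b. f (b \<otimes> (a \<otimes> x))) as"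
      using as(1) that assms(2) by (intro map_cong refl) (simp add: m_lcomm subset_eq)
    then show ?thesis by (simp only: avg_def)
  qed
  with as assms(2) show "\<exists>as. point_list as \<and> (\<forall>x\<in>carrier G. cmod (avg as (\<lambda>x. f (a \<otimes> x)) x - mean f) \<le> e)"
    by (intro exI[of _ as]) auto
qed

lemma mean_inv:
  assumes "cont f"
  shows "mean (\<lambda>x. f (inv x)) = mean f"
proof (rule mean_eqI, unfold is_mean_def, intro allI impI)
  fix e :: real assume e: "e > 0"
  obtain as where as: "point_list as" "\<And>x. x \<in> carrier G \<Longrightarrow> cmod (avg as f x - mean f) \<le> e"
    using mean_approx[OF assms(1) e] by blast
  let ?bs = "map (\<lambda>a. inv a) as"
  have "avg ?bs (\<lambda>x. f (inv x)) x = avg as f (inv x)" if "x \<in> carrier G" for x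
  proof -
    have "map (\<lambda>b. f (inv (inv b \<otimes> x))) as = map (\<lambda>b. f (b \<otimes> inv x)) as"
      using as(1) that by (intro map_cong refl) (auto simp: inv_mult_group m_comm subset_eq)
    then have "(\<Sum>b\<leftarrow>as. f (inv (inv b \<otimes> x))) = (\<Sum>b\<leftarrow>as. f (b \<otimes> inv x))" by (simp only:)
    then show ?thesis by (simp add: avg_def o_def)
  qed
  moreover have "point_list ?bs" using as(1) by (auto simp: subset_eq)
  ultimately show "\<exists>as. point_list as \<and> (\<forall>x\<in>carrier G. cmod (avg as (\<lambda>x. f (inv x)) x - mean f) \<le> e)"
    using as by (intro exI[of _ ?bs]) (simp del: set_map)
qed

lemma norm_mean_le:
  assumes "cont f" "\<And>x. x \<in> carrier G \<Longrightarrow> cmod (f x) \<le> B"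
  shows "cmod (mean f) \<le> B"
proof (rule field_le_epsilon)
  fix e :: real assume e: "e > 0"
  obtain as where as: "point_list as" "\<And>x. x \<in> carrier G \<Longrightarrow> cmod (avg as f x - mean f) \<le> e"
    using mean_approx[OF assms(1) e] by blast
  have "cmod (avg as f \<one>) \<le> B" using as(1) assms(2) by (intro norm_avg_le) auto
  moreover have "cmod (avg as f \<one> - mean f) \<le> e" using as(2) by simp
  ultimately show "cmod (mean f) \<le> B + e"
    using norm_triangle_ineq4[of "avg as f \<one>" "avg as f \<one> - mean f"] by simp
qed

text \<open>
  A quantitative form of strict positivity: finitely many translates of \<open>U\<close> cover the group, and an
  average over them has the same mean. The constant must not depend on \<open>f\<close>, since it will be applied
  to all powers of one function.
\<close>

lemma mean_lower_bound:
  assumes "openin T U" "u \<in> U"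
  shows "\<exists>C>0. \<forall>f d. cont f \<longrightarrow> (\<forall>x\<in>carrier G. 0 \<le> Re (f x)) \<longrightarrow>
       (\<forall>x\<in>U. d \<le> Re (f x)) \<longrightarrow> C * d \<le> Re (mean f)"
proof -
  obtain bs where bs: "point_list bs" and cover: "\<And>x. x \<in> carrier G \<Longrightarrow> \<exists>b\<in>set bs. b \<otimes> x \<in> U"
    using translates_cover[OF assms] by blast
  define C where "C = inverse (real (length bs))"
  have C: "C > 0" using bs by (simp add: C_def)
  have "C * d \<le> Re (mean f)"
    if f: "cont f" and nonneg: "\<And>x. x \<in> carrier G \<Longrightarrow> 0 \<le> Re (f x)"
      and low: "\<And>x. x \<in> U \<Longrightarrow> d \<le> Re (f x)" for f d
  proof (rule field_le_epsilon)
    fix e :: real assume e: "e > 0"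
    obtain as where as: "point_list as" "\<And>x. x \<in> carrier G \<Longrightarrow> cmod (avg as f x - mean f) \<le> e"
      using mean_approx[OF f e] by blast
    have lin: "linear Re" by (auto intro: linearI)
    have ge: "C * d \<le> avg bs (\<lambda>x. Re (f x)) x" if x: "x \<in> carrier G" for x
    proof -
      obtain b where b: "b \<in> set bs" "b \<otimes> x \<in> U" using cover[OF x] by blast
      obtain l r where lr: "bs = l @ b # r" using split_list[OF b(1)] by blast
      have "0 \<le> (\<Sum>b\<leftarrow>l. Re (f (b \<otimes> x)))" "0 \<le> (\<Sum>b\<leftarrow>r. Re (f (b \<otimes> x)))"
        using bs lr x by (auto intro!: sum_list_nonneg nonneg m_closed)
      then have "d \<le> (\<Sum>b\<leftarrow>bs. Re (f (b \<otimes> x)))"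
        using low[OF b(2)] by (simp add: lr)
      then show ?thesis using C by (simp add: avg_def C_def divide_inverse)
    qed
    have "C * d = avg as (\<lambda>_. C * d) \<one>" using as(1) by (simp add: avg_const)
    also have "\<dots> \<le> avg as (avg bs (\<lambda>x. Re (f x))) \<one>"
      using as(1) ge by (intro avg_mono) auto
    also have "\<dots> = avg bs (\<lambda>x. avg as (\<lambda>x. Re (f x)) x) \<one>"
      by (rule avg_commute[OF as(1) bs one_closed])
    also have "\<dots> = Re (avg bs (avg as f) \<one>)"
      by (simp only: avg_linear[OF lin])
    also have "\<dots> \<le> Re (mean f) + e"
    proof -
      have "cmod (avg bs (avg as f) \<one> - mean f) \<le> e"
        by (rule avg_near_const[OF bs one_closed as(2)])
      then show ?thesis
        using complex_Re_le_cmod[of "avg bs (avg as f) \<one> - mean f"] by simp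
    qed
    finally show "C * d \<le> Re (mean f) + e" .
  qed
  with C show ?thesis by (intro exI[of _ C]) simp
qed

lemma mean_Re_nonneg:
  assumes "cont f" "\<And>x. x \<in> carrier G \<Longrightarrow> 0 \<le> Re (f x)"
  shows "0 \<le> Re (mean f)"
proof -
  have "openin T (carrier G)" using openin_topspace[of T] by simp
  from mean_lower_bound[OF this one_closed] obtain C where
    "\<forall>f d. cont f \<longrightarrow> (\<forall>x\<in>carrier G. 0 \<le> Re (f x)) \<longrightarrow>
       (\<forall>x\<in>carrier G. d \<le> Re (f x)) \<longrightarrow> C * d \<le> Re (mean f)" by blast
  from this[rule_format, of f 0] assms show ?thesis by simp
qed

lemma mean_Re_pos:
  assumes f: "cont f" and nonneg: "\<And>x. x \<in> carrier G \<Longrightarrow> 0 \<le> Re (f x)"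
    and u: "u \<in> carrier G" "0 < Re (f u)"
  shows "0 < Re (mean f)"
proof -
  let ?U = "{x \<in> topspace T. Re (f x) \<in> {Re (f u) / 2<..}}"
  have "cont (Re \<circ> f)"
    by (rule continuous_map_compose[OF f]) (auto intro: continuous_on_Re continuous_on_id)
  then have "openin T ?U"
    using openin_continuous_map_preimage[of T euclidean "Re \<circ> f" "{Re (f u) / 2<..}"] by simp
  moreover have "u \<in> ?U" using u by simp
  ultimately obtain C where C: "C > 0"
    "\<forall>f d. cont f \<longrightarrow> (\<forall>x\<in>carrier G. 0 \<le> Re (f x)) \<longrightarrow>
       (\<forall>x\<in>?U. d \<le> Re (f x)) \<longrightarrow> C * d \<le> Re (mean f)"
    using mean_lower_bound[of ?U u] by blast
  have "C * (Re (f u) / 2) \<le> Re (mean f)"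
    using f nonneg by (intro C(2)[rule_format]) auto
  moreover have "C * (Re (f u) / 2) > 0" using C(1) u(2) by simp
  ultimately show ?thesis by linarith
qed

end

section \<open>Functions of positive type\<close>

lemma continuous_map_complex_mult:
  fixes f g :: "'a \<Rightarrow> complex"
  shows "continuous_map X euclidean f \<Longrightarrow> continuous_map X euclidean g \<Longrightarrow> continuous_map X euclidean (\<lambda>x. f x * g x)"
  by (simp add: continuous_map_atin tendsto_mult)

lemma continuous_map_cnj:
  "continuous_map X euclidean f \<Longrightarrow> continuous_map X euclidean (\<lambda>x. cnj (f x))"
  by (simp add: continuous_map_atin tendsto_cnj)

lemma continuous_map_constant: "continuous_map X euclidean (\<lambda>x. c)"
  by simp

text \<open>Bounds on the modulus will follow from bounds on \<open>Re (c * z)\<close> for all unit scalars \<open>c\<close>.\<close>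

lemma rotate_to_negative: "\<exists>c. cmod c = 1 \<and> Re (c * z) = - cmod z"
proof (cases "z = 0")
  case True
  then show ?thesis by (intro exI[of _ 1]) simp
next
  case False
  let ?c = "- cnj z / cmod z"
  have "cmod ?c = 1" using False by (simp add: norm_divide)
  moreover have "?c * z = - of_real (cmod z)"
    using False by (simp add: mult.commute complex_norm_square[symmetric] power2_eq_square)
  ultimately show ?thesis by (intro exI[of _ ?c]) simp
qed

context compact_ab_group
begin

lemmas cont_intros = continuous_map_complex_mult continuous_map_cnj continuous_map_constant
  continuous_map_add continuous_map_diff continuous_translate_fun inv_closed m_closed one_closed

lemma mean_diff:
  assumes "cont f" "cont g"
  shows "mean (\<lambda>x. f x - g x) = mean f - mean g"
proof -
  have "mean (\<lambda>x. f x + (-1) * g x) = mean f + mean (\<lambda>x. (-1) * g x)"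
    by (rule mean_add; intro cont_intros assms)
  also have "mean (\<lambda>x. (-1) * g x) = (-1) * mean g"
    by (rule mean_cmult[OF assms(2)])
  finally have "mean (\<lambda>x. f x + (-1) * g x) = mean f + (-1) * mean g" .
  then show ?thesis by simp
qed

text \<open>
  On a character \<open>\<xi>\<close> this operator is multiplication by the non-negative number
  \<open>2 + 2 * Re (c * \<xi> a) = \<bar>1 + c * \<xi> a\<bar>\<^sup>2\<close> when \<open>\<bar>c\<bar> = 1\<close>.
\<close>

definition twist :: "complex \<Rightarrow> 'a \<Rightarrow> ('a \<Rightarrow> complex) \<Rightarrow> 'a \<Rightarrow> complex" where
  "twist c a f x = 2 * f x + c * f (a \<otimes> x) + cnj c * f (inv a \<otimes> x)"

text \<open>
  A variant of positive definiteness: instead of all finite sums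
  \<open>\<Sum> c\<^sub>i * cnj c\<^sub>j * f (x\<^sub>i \<otimes> inv x\<^sub>j)\<close>, only those are tested that come from products of
  factors \<open>1 + c a\<close>. The coinductive form makes closure under
  \<open>twist\<close> part of the definition, and it is enough for all arguments below, which only compare two points.
\<close>

coinductive pos_type :: "('a \<Rightarrow> complex) \<Rightarrow> bool" where
  "\<lbrakk>cont f; \<And>x. x \<in> carrier G \<Longrightarrow> f (inv x) = cnj (f x); 0 \<le> Re (f \<one>);
    \<And>c a. cmod c = 1 \<Longrightarrow> a \<in> carrier G \<Longrightarrow> pos_type (twist c a f)\<rbrakk> \<Longrightarrow> pos_type f"

lemma pos_type_cont: "pos_type f \<Longrightarrow> cont f"
  and pos_type_inv: "pos_type f \<Longrightarrow> x \<in> carrier G \<Longrightarrow> f (inv x) = cnj (f x)"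
  and pos_type_one: "pos_type f \<Longrightarrow> 0 \<le> Re (f \<one>)"
  and pos_type_twist: "pos_type f \<Longrightarrow> cmod c = 1 \<Longrightarrow> a \<in> carrier G \<Longrightarrow> pos_type (twist c a f)"
  by (erule pos_type.cases, simp)+

lemma twist_cont:
  assumes "cont f" "a \<in> carrier G"
  shows "cont (twist c a f)"
  unfolding twist_def[abs_def] by (intro cont_intros assms)

text \<open>The coinduction principle in the form in which it is applied: a class of functions closed under \<open>twist\<close>.\<close>

lemma pos_type_coinduct:
  assumes "X f"
    and "\<And>f. X f \<Longrightarrow> cont f"
    and "\<And>f x. X f \<Longrightarrow> x \<in> carrier G \<Longrightarrow> f (inv x) = cnj (f x)"
    and "\<And>f. X f \<Longrightarrow> 0 \<le> Re (f \<one>)"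
    and "\<And>f c a. X f \<Longrightarrow> cmod c = 1 \<Longrightarrow> a \<in> carrier G \<Longrightarrow> X (twist c a f)"
  shows "pos_type f"
  using assms(1) by (rule pos_type.coinduct[of X]) (simp add: assms(2-5))

lemma twist_at_one:
  assumes "\<And>x. x \<in> carrier G \<Longrightarrow> f (inv x) = cnj (f x)" "a \<in> carrier G"
  shows "Re (twist c a f \<one>) = 2 * Re (f \<one>) + 2 * Re (c * f a)"
  using assms(1)[OF assms(2)] assms(2) by (simp add: twist_def)

lemma pos_type_bound:
  assumes f: "pos_type f" and x: "x \<in> carrier G"
  shows "cmod (f x) \<le> Re (f \<one>)"
proof -
  obtain c where c: "cmod c = 1" "Re (c * f x) = - cmod (f x)" using rotate_to_negative by blast
  have "0 \<le> Re (twist c x f \<one>)"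
    by (intro pos_type_one pos_type_twist f x c(1))
  then show ?thesis
    using twist_at_one[of f x c] pos_type_inv[OF f] x c(2) by simp
qed

lemma pos_type_one_real: "pos_type f \<Longrightarrow> f \<one> = of_real (Re (f \<one>))"
  using pos_type_inv[of f \<one>] by (simp add: complex_eq_iff)

lemma pos_type_scale:
  assumes "pos_type f" "0 \<le> r"
  shows "pos_type (\<lambda>x. complex_of_real r * f x)"
proof -
  define X where "X h \<longleftrightarrow> (\<exists>f. pos_type f \<and> h = (\<lambda>x. complex_of_real r * f x))" for h
  have "X (\<lambda>x. complex_of_real r * f x)" using assms(1) by (auto simp: X_def)
  then show ?thesis
  proof (rule pos_type_coinduct[of X])
    fix f assume cont: "X f"
    then obtain f' where f': "pos_type f'" "f = (\<lambda>x. complex_of_real r * f' x)" unfolding X_def by blast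
    show "cont f" unfolding f'(2) by (intro cont_intros pos_type_cont f')
  next
    fix f x assume inv: "X f" "x \<in> carrier G"
    then show "f (inv x) = cnj (f x)" by (auto simp: X_def pos_type_inv)
  next
    fix f assume one: "X f"
    then obtain f' where f': "pos_type f'" "f = (\<lambda>x. complex_of_real r * f' x)" unfolding X_def by blast
    show "0 \<le> Re (f \<one>)" using \<open>0 \<le> r\<close> pos_type_one[OF f'(1)] by (simp add: f'(2))
  next
    fix h c a assume twist: "X h" "cmod c = 1" "a \<in> carrier G"
    then obtain f where f: "pos_type f" "h = (\<lambda>x. complex_of_real r * f x)" unfolding X_def by blast
    have "twist c a h = (\<lambda>x. complex_of_real r * twist c a f x)"
      by (simp add: f(2) twist_def fun_eq_iff algebra_simps)
    then show "X (twist c a h)" using pos_type_twist[OF f(1) twist(2,3)] by (auto simp: X_def)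
  qed
qed

lemma pos_type_limit:
  assumes F: "\<And>n. pos_type (F n)" and f: "cont f"
    and lim: "\<And>x. x \<in> carrier G \<Longrightarrow> (\<lambda>n. F n x) \<longlonglongrightarrow> f x"
  shows "pos_type f"
proof -
  define X where "X f \<longleftrightarrow> cont f \<and>
      (\<exists>F. (\<forall>n. pos_type (F n)) \<and> (\<forall>x\<in>carrier G. (\<lambda>n::nat. F n x) \<longlonglongrightarrow> f x))" for f
  have "X f" unfolding X_def using assms by blast
  then show ?thesis
  proof (rule pos_type_coinduct[of X])
    fix f assume cont: "X f"
    then show "cont f" by (simp add: X_def)
  next
    fix f x assume inv: "X f" "x \<in> carrier G"
    then obtain F where F: "\<And>n. pos_type (F n)" "\<forall>x\<in>carrier G. (\<lambda>n::nat. F n x) \<longlonglongrightarrow> f x"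
      unfolding X_def by blast
    have "(\<lambda>n. F n (inv x)) \<longlonglongrightarrow> f (inv x)" using F(2) inv(2) by simp
    moreover have "(\<lambda>n. F n (inv x)) = (\<lambda>n. cnj (F n x))" using pos_type_inv[OF F(1) inv(2)] by simp
    moreover have "(\<lambda>n. cnj (F n x)) \<longlonglongrightarrow> cnj (f x)" using F(2) inv(2) by (intro tendsto_cnj) simp
    ultimately show "f (inv x) = cnj (f x)" using LIMSEQ_unique by metis
  next
    fix f assume one: "X f"
    then obtain F where F: "\<And>n. pos_type (F n)" "\<forall>x\<in>carrier G. (\<lambda>n::nat. F n x) \<longlonglongrightarrow> f x"
      unfolding X_def by blast
    have "(\<lambda>n. Re (F n \<one>)) \<longlonglongrightarrow> Re (f \<one>)" using F(2) by (intro tendsto_Re) simp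
    then show "0 \<le> Re (f \<one>)" by (rule LIMSEQ_le_const) (simp add: pos_type_one[OF F(1)])
  next
    fix f c a assume twist: "X f" "cmod c = 1" "a \<in> carrier G"
    then obtain F where F: "\<And>n. pos_type (F n)" "\<forall>x\<in>carrier G. (\<lambda>n::nat. F n x) \<longlonglongrightarrow> f x"
      and f: "cont f"
      unfolding X_def by blast
    have "(\<lambda>n. twist c a (F n) x) \<longlonglongrightarrow> twist c a f x" if "x \<in> carrier G" for x
      unfolding twist_def using F(2) twist(3) that by (intro tendsto_intros) auto
    moreover have "pos_type (twist c a (F n))" for n by (rule pos_type_twist[OF F(1) twist(2,3)])
    ultimately show "X (twist c a f)"
      unfolding X_def using twist_cont[OF f twist(3)] by (intro conjI exI[of _ "\<lambda>n. twist c a (F n)"]) auto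
  qed
qed

text \<open>The source of functions of positive type: the coefficient of \<open>autocorr f\<close> at \<open>\<xi>\<close> is \<open>\<bar>mean (f * cnj \<xi>)\<bar>\<^sup>2\<close>.\<close>

definition autocorr :: "('a \<Rightarrow> complex) \<Rightarrow> 'a \<Rightarrow> complex" where
  "autocorr f x = mean (\<lambda>y. f (x \<otimes> y) * cnj (f y))"

lemma autocorr_cont:
  assumes f: "cont f"
  shows "cont (autocorr f)"
proof (rule continuousI_uniform_nbhd)
  fix e :: real assume "e > 0"
  obtain B where B: "B > 0" "\<And>x. x \<in> carrier G \<Longrightarrow> cmod (f x) \<le> B" 
    using continuous_bounded[OF f] by blast
  obtain W where W: "openin T W" "\<one> \<in> W"
     "\<And>w x. w \<in> W \<Longrightarrow> x \<in> carrier G \<Longrightarrow> norm (f (w \<otimes> x) - f x) < e / B"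
    using uniform_nbhd[OF f, of "e / B"] B \<open>e > 0\<close> by (metis divide_pos_pos)
  have "cmod (autocorr f (w \<otimes> x) - autocorr f x) \<le> e" if w: "w \<in> W" and x: "x \<in> carrier G" for w x
  proof -
    have wG: "w \<in> carrier G" using w openin_subset[OF W(1)] by auto
    have "autocorr f (w \<otimes> x) - autocorr f x
        = mean (\<lambda>y. f (w \<otimes> x \<otimes> y) * cnj (f y) - f (x \<otimes> y) * cnj (f y))"
      unfolding autocorr_def by (rule mean_diff[symmetric]; intro cont_intros f wG x)
    also have "cmod \<dots> \<le> e"
    proof (rule norm_mean_le)
      fix y assume y: "y \<in> carrier G"
      have "cmod (f (w \<otimes> x \<otimes> y) * cnj (f y) - f (x \<otimes> y) * cnj (f y))
          = cmod (f (w \<otimes> (x \<otimes> y)) - f (x \<otimes> y)) * cmod (f y)"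
        using wG x y by (simp add: m_assoc norm_mult left_diff_distrib[symmetric])
      also have "\<dots> \<le> e / B * B"
        using W(3)[OF w, of "x \<otimes> y"] x y B \<open>e > 0\<close> by (intro mult_mono) (auto intro: less_imp_le)
      finally show "cmod (f (w \<otimes> x \<otimes> y) * cnj (f y) - f (x \<otimes> y) * cnj (f y)) \<le> e"
        using B(1) by simp
    qed (intro cont_intros f wG x)
    finally show ?thesis .
  qed
  with W show "\<exists>W. openin T W \<and> \<one> \<in> W \<and> (\<forall>w\<in>W. \<forall>x\<in>carrier G. cmod (autocorr f (w \<otimes> x) - autocorr f x) \<le> e)"
    by (intro exI[of _ W]) simp
qed

lemma autocorr_inv:
  assumes f: "cont f" and x: "x \<in> carrier G"
  shows "autocorr f (inv x) = cnj (autocorr f x)"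
proof -
  have "autocorr f (inv x) = mean (\<lambda>y. f (inv x \<otimes> (x \<otimes> y)) * cnj (f (x \<otimes> y)))"
    unfolding autocorr_def by (rule mean_translate[symmetric]; intro cont_intros f x)
  also have "\<dots> = mean (\<lambda>y. cnj (f (x \<otimes> y) * cnj (f y)))"
    using x by (intro mean_cong) (simp add: m_assoc[symmetric])
  also have "\<dots> = cnj (autocorr f x)"
    unfolding autocorr_def by (rule mean_cnj; intro cont_intros f x)
  finally show ?thesis .
qed

text \<open>
  In terms of coefficients both sides have \<open>\<bar>(1 + c * \<xi> a) * mean (f * cnj \<xi>)\<bar>\<^sup>2\<close> at \<open>\<xi>\<close>. The
  identity makes the autocorrelations a class closed under \<open>twist\<close>, hence of positive type.
\<close>

lemma twist_autocorr:
  assumes f: "cont f" and a: "a \<in> carrier G" and z: "z \<in> carrier G" and c: "cmod c = 1"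
  shows "twist c a (autocorr f) z = autocorr (\<lambda>y. f y + c * f (a \<otimes> y)) z"
proof -
  have cc: "c * cnj c = 1" using c by (simp add: complex_norm_square[symmetric])
  let ?m = "\<lambda>y. f (z \<otimes> y) * cnj (f y)"
  have "autocorr (\<lambda>y. f y + c * f (a \<otimes> y)) z
      = mean (\<lambda>y. ?m y + ?m (a \<otimes> y) + c * (f (a \<otimes> z \<otimes> y) * cnj (f y)) + cnj c * (f (z \<otimes> y) * cnj (f (a \<otimes> y))))"
    unfolding autocorr_def
  proof (rule mean_cong)
    fix y assume y: "y \<in> carrier G"
    have "c * (cnj c * w) = w" for w using cc by (simp add: mult.assoc[symmetric])
    moreover have "a \<otimes> (z \<otimes> y) = z \<otimes> (a \<otimes> y)" "a \<otimes> z \<otimes> y = z \<otimes> (a \<otimes> y)"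
      using a y z by (simp_all add: m_ac)
    ultimately show "(f (z \<otimes> y) + c * f (a \<otimes> (z \<otimes> y))) * cnj (f y + c * f (a \<otimes> y))
       = ?m y + ?m (a \<otimes> y) + c * (f (a \<otimes> z \<otimes> y) * cnj (f y)) + cnj c * (f (z \<otimes> y) * cnj (f (a \<otimes> y)))"
      by (simp add: algebra_simps)
  qed
  also have "\<dots> = mean ?m + mean (\<lambda>y. ?m (a \<otimes> y)) + c * mean (\<lambda>y. f (a \<otimes> z \<otimes> y) * cnj (f y))
      + cnj c * mean (\<lambda>y. f (z \<otimes> y) * cnj (f (a \<otimes> y)))"
    by (subst mean_add mean_cmult; (intro cont_intros f a z)?)+ simp
  also have "mean (\<lambda>y. ?m (a \<otimes> y)) = mean ?m"
    by (rule mean_translate; intro cont_intros f a z)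
  also have "mean (\<lambda>y. f (z \<otimes> y) * cnj (f (a \<otimes> y))) = mean (\<lambda>y. f (inv a \<otimes> z \<otimes> (a \<otimes> y)) * cnj (f (a \<otimes> y)))"
  proof (rule mean_cong)
    fix y assume y: "y \<in> carrier G"
    have "inv a \<otimes> z \<otimes> (a \<otimes> y) = (inv a \<otimes> a) \<otimes> (z \<otimes> y)"
      using a y z by (simp only: m_ac inv_closed m_closed)
    then have "inv a \<otimes> z \<otimes> (a \<otimes> y) = z \<otimes> y"
      using a y z by simp
    then show "f (z \<otimes> y) * cnj (f (a \<otimes> y)) = f (inv a \<otimes> z \<otimes> (a \<otimes> y)) * cnj (f (a \<otimes> y))" by simp
  qed
  also have "\<dots> = mean (\<lambda>y. f (inv a \<otimes> z \<otimes> y) * cnj (f y))"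
    by (rule mean_translate; intro cont_intros f a z)
  finally show ?thesis by (simp add: twist_def autocorr_def)
qed

lemma autocorr_one:
  "autocorr f \<one> = mean (\<lambda>y. f y * cnj (f y))"
  unfolding autocorr_def by (rule mean_cong) simp

lemma autocorr_pos_type:
  assumes "cont f"
  shows "pos_type (autocorr f)"
proof -
  define X where "X h \<longleftrightarrow> cont h \<and>
     (\<exists>f. cont f \<and> (\<forall>x\<in>carrier G. h x = autocorr f x))" for h
  have "X (autocorr f)" unfolding X_def using assms autocorr_cont by blast
  then show ?thesis
  proof (rule pos_type_coinduct[of X])
    fix h assume cont: "X h"
    then show "cont h" by (simp add: X_def)
  next
    fix h x assume inv: "X h" "x \<in> carrier G"
    then show "h (inv x) = cnj (h x)" by (auto simp: X_def autocorr_inv)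
  next
    fix h assume one: "X h"
    then obtain f where f: "cont f" "h \<one> = autocorr f \<one>" by (auto simp: X_def)
    show "0 \<le> Re (h \<one>)" unfolding f(2) autocorr_one
      by (rule mean_Re_nonneg; (intro cont_intros f(1))?) (simp add: complex_mult_cnj)
  next
    fix h c a assume twist: "X h" "cmod c = 1" "a \<in> carrier G"
    then obtain f where f: "cont f" "\<forall>x\<in>carrier G. h x = autocorr f x"
      and h: "cont h"
      unfolding X_def by blast
    have "cont (\<lambda>y. f y + c * f (a \<otimes> y))"
      by (intro cont_intros f twist)
    moreover have "twist c a h x = autocorr (\<lambda>y. f y + c * f (a \<otimes> y)) x" if "x \<in> carrier G" for x
      using twist_autocorr[OF f(1) twist(3) that twist(2)] f(2) twist(3) that by (simp add: twist_def)
    ultimately show "X (twist c a h)"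
      unfolding X_def using twist_cont[OF h twist(3)] by (intro conjI exI[of _ "\<lambda>y. f y + c * f (a \<otimes> y)"]) auto
  qed
qed

text \<open>
  If \<open>\<phi>\<close> and \<open>\<psi>\<close> are of positive type with coefficients \<open>f\<^sub>\<xi>\<close> and \<open>p\<^sub>\<xi>\<close>, then \<open>conv \<phi> \<psi>\<close> has
  coefficients \<open>f\<^sub>\<xi> * p\<^sub>\<xi>\<close>.
\<close>

definition conv :: "('a \<Rightarrow> complex) \<Rightarrow> ('a \<Rightarrow> complex) \<Rightarrow> 'a \<Rightarrow> complex" where
  "conv \<phi> \<psi> x = mean (\<lambda>y. cnj (\<phi> y) * \<psi> (x \<otimes> y))"

lemma conv_inv:
  assumes "pos_type \<phi>" "pos_type \<psi>" "x \<in> carrier G"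
  shows "conv \<phi> \<psi> (inv x) = cnj (conv \<phi> \<psi> x)"
proof -

  have "conv \<phi> \<psi> (inv x) = mean (\<lambda>y. cnj (\<phi> (inv y)) * \<psi> (inv x \<otimes> inv y))"
    unfolding conv_def by (rule mean_inv[symmetric]; intro cont_intros pos_type_cont assms)
  also have "\<dots> = mean (\<lambda>y. cnj (cnj (\<phi> y) * \<psi> (x \<otimes> y)))"
    using assms(3) pos_type_inv[OF assms(1)]
    by (intro mean_cong) (simp add: inv_mult[symmetric] pos_type_inv[OF assms(2)])
  also have "\<dots> = cnj (conv \<phi> \<psi> x)"
    unfolding conv_def by (rule mean_cnj; intro cont_intros pos_type_cont assms)
  finally show ?thesis .
qed

lemma conv_twist:
  assumes "cont \<phi>" "cont \<psi>" "a \<in> carrier G" "x \<in> carrier G"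
  shows "conv \<phi> (twist c a \<psi>) x = twist c a (conv \<phi> \<psi>) x"
proof -
  have "conv \<phi> (twist c a \<psi>) x = mean (\<lambda>y. 2 * (cnj (\<phi> y) * \<psi> (x \<otimes> y))
      + c * (cnj (\<phi> y) * \<psi> (a \<otimes> x \<otimes> y)) + cnj c * (cnj (\<phi> y) * \<psi> (inv a \<otimes> x \<otimes> y)))"
    unfolding conv_def twist_def using assms(3,4)
    by (intro mean_cong) (simp add: m_assoc algebra_simps)
  also have "\<dots> = twist c a (conv \<phi> \<psi>) x"
    unfolding twist_def conv_def
    by (subst mean_add mean_cmult; (intro cont_intros assms)?)+ simp
  finally show ?thesis .
qed

lemma norm_conv_le:
  assumes "cont \<phi>" "cont \<psi>" "x \<in> carrier G"
    and "\<And>y. y \<in> carrier G \<Longrightarrow> cmod (\<phi> y) \<le> B" "\<And>y. y \<in> carrier G \<Longrightarrow> cmod (\<psi> y) \<le> M"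
  shows "cmod (conv \<phi> \<psi> x) \<le> B * M"
  unfolding conv_def
proof (rule norm_mean_le)
  fix y assume y: "y \<in> carrier G"
  have "0 \<le> B" using assms(4)[OF y] norm_ge_zero order_trans by blast
  then show "cmod (cnj (\<phi> y) * \<psi> (x \<otimes> y)) \<le> B * M"
    using assms(3-5) y by (auto simp: norm_mult intro!: mult_mono)
qed (intro cont_intros assms)

text \<open>
  A translation of the argument of \<open>conv \<phi> \<psi>\<close> can be moved to \<open>\<phi>\<close>, so the modulus of continuity of \<open>\<phi>\<close>
  serves all \<open>\<psi>\<close> bounded by 1. This is the compactness of convolution operators.
\<close>

lemma conv_equicontinuous:
  assumes \<phi>: "cont \<phi>" and "e > 0"
  shows "\<exists>W. openin T W \<and> \<one> \<in> W \<and>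
    (\<forall>\<psi>. cont \<psi> \<longrightarrow> (\<forall>x\<in>carrier G. cmod (\<psi> x) \<le> 1) \<longrightarrow>
      (\<forall>w\<in>W. \<forall>x\<in>carrier G. cmod (conv \<phi> \<psi> (w \<otimes> x) - conv \<phi> \<psi> x) \<le> e))"
proof -
  obtain V where V: "openin T V" "\<one> \<in> V"
     "\<And>w x. w \<in> V \<Longrightarrow> x \<in> carrier G \<Longrightarrow> norm (\<phi> (w \<otimes> x) - \<phi> x) < e"
    using uniform_nbhd[OF \<phi> \<open>e > 0\<close>] by blast
  define W where "W = {w \<in> carrier G. inv w \<in> V}"
  have "openin T W"
    using openin_continuous_map_preimage[OF continuous_inv V(1)] by (simp add: W_def)
  moreover have "\<one> \<in> W" using V(2) by (simp add: W_def)
  moreover have "cmod (conv \<phi> \<psi> (w \<otimes> x) - conv \<phi> \<psi> x) \<le> e"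
    if \<psi>: "cont \<psi>" "\<forall>x\<in>carrier G. cmod (\<psi> x) \<le> 1" and w: "w \<in> W" and x: "x \<in> carrier G" for \<psi> w x
  proof -
    have wG: "w \<in> carrier G" and wV: "inv w \<in> V" using w by (auto simp: W_def)
    have "conv \<phi> \<psi> (w \<otimes> x) = mean (\<lambda>y. cnj (\<phi> (inv w \<otimes> y)) * \<psi> (w \<otimes> x \<otimes> (inv w \<otimes> y)))"
      unfolding conv_def by (rule mean_translate[symmetric]; intro cont_intros \<phi> \<psi> wG x)
    also have "\<dots> = mean (\<lambda>y. cnj (\<phi> (inv w \<otimes> y)) * \<psi> (x \<otimes> y))"
    proof (rule mean_cong)
      fix y assume y: "y \<in> carrier G"
      have "w \<otimes> x \<otimes> (inv w \<otimes> y) = (w \<otimes> inv w) \<otimes> (x \<otimes> y)"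
        using wG x y by (simp only: m_ac inv_closed m_closed)
      also have "\<dots> = x \<otimes> y" using wG x y by simp
      finally show "cnj (\<phi> (inv w \<otimes> y)) * \<psi> (w \<otimes> x \<otimes> (inv w \<otimes> y)) = cnj (\<phi> (inv w \<otimes> y)) * \<psi> (x \<otimes> y)" by simp
    qed
    finally have "conv \<phi> \<psi> (w \<otimes> x) - conv \<phi> \<psi> x
        = mean (\<lambda>y. cnj (\<phi> (inv w \<otimes> y)) * \<psi> (x \<otimes> y)) - mean (\<lambda>y. cnj (\<phi> y) * \<psi> (x \<otimes> y))"
      by (simp add: conv_def)
    also have "\<dots> = mean (\<lambda>y. cnj (\<phi> (inv w \<otimes> y)) * \<psi> (x \<otimes> y) - cnj (\<phi> y) * \<psi> (x \<otimes> y))"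
      by (rule mean_diff[symmetric]; intro cont_intros \<phi> \<psi> wG x)
    also have "cmod \<dots> \<le> e"
    proof (rule norm_mean_le)
      fix y assume y: "y \<in> carrier G"
      have "cmod (cnj (\<phi> (inv w \<otimes> y)) * \<psi> (x \<otimes> y) - cnj (\<phi> y) * \<psi> (x \<otimes> y))
          = cmod (\<phi> (inv w \<otimes> y) - \<phi> y) * cmod (\<psi> (x \<otimes> y))"
        by (metis complex_cnj_diff complex_mod_cnj left_diff_distrib norm_mult)
      also have "\<dots> \<le> e * 1"
        using V(3)[OF wV y] \<psi>(2) x y \<open>e > 0\<close> by (intro mult_mono) (auto intro: less_imp_le)
      finally show "cmod (cnj (\<phi> (inv w \<otimes> y)) * \<psi> (x \<otimes> y) - cnj (\<phi> y) * \<psi> (x \<otimes> y)) \<le> e" by simp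
    qed (intro cont_intros \<phi> \<psi> wG x)
    finally show ?thesis .
  qed
  ultimately show ?thesis by (intro exI[of _ W]) simp
qed

end

section \<open>States with maximal coefficient\<close>

context compact_ab_group
begin

text \<open>
  The theorem of Arzela and Ascoli. For each \<open>m\<close> finitely many points approximate all
  values of all functions up to \<open>1 / (m + 1)\<close>; a diagonal subsequence converges on the countable set of all
  these points, and is therefore uniformly Cauchy.
\<close>

lemma equicontinuous_subsequence:
  fixes F :: "nat \<Rightarrow> 'a \<Rightarrow> complex"
  assumes bound: "\<And>n x. x \<in> carrier G \<Longrightarrow> cmod (F n x) \<le> B"
    and equi: "\<And>e. e > 0 \<Longrightarrow> \<exists>W. openin T W \<and> \<one> \<in> W \<and>
      (\<forall>n. \<forall>w\<in>W. \<forall>x\<in>carrier G. cmod (F n (w \<otimes> x) - F n x) \<le> e)"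
  shows "\<exists>k f. strict_mono k \<and> uniform_limit (carrier G) (\<lambda>n. F (k n)) f sequentially"
proof -
  have "\<exists>as. set as \<subseteq> carrier G \<and> (\<forall>x\<in>carrier G. \<exists>a\<in>set as. \<forall>n. cmod (F n x - F n (inv a)) \<le> e)"
    if "e > 0" for e
  proof -
    obtain W where W: "openin T W" "\<one> \<in> W"
      "\<forall>n. \<forall>w\<in>W. \<forall>x\<in>carrier G. cmod (F n (w \<otimes> x) - F n x) \<le> e"
      using equi[OF \<open>e > 0\<close>] by blast
    obtain as where as: "set as \<subseteq> carrier G" "\<forall>x\<in>carrier G. \<exists>a\<in>set as. a \<otimes> x \<in> W"
      using translates_cover[OF W(1,2)] by blast
    have "\<exists>a\<in>set as. \<forall>n. cmod (F n x - F n (inv a)) \<le> e" if x: "x \<in> carrier G" for x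
    proof -
      obtain a where a: "a \<in> set as" "a \<otimes> x \<in> W" using as(2) x by blast
      have aG: "a \<in> carrier G" using a as(1) by blast
      have "a \<otimes> x \<otimes> inv a = (a \<otimes> inv a) \<otimes> x"
        using aG x by (simp only: m_ac inv_closed m_closed)
      then have "a \<otimes> x \<otimes> inv a = x" using aG x by simp
      then have "cmod (F n x - F n (inv a)) \<le> e" for n
        using W(3)[rule_format, OF a(2) inv_closed[OF aG], of n] by simp
      then show ?thesis using a(1) by blast
    qed
    then show ?thesis using as(1) by blast
  qed
  then have "\<forall>m. \<exists>as. set as \<subseteq> carrier G \<and>
      (\<forall>x\<in>carrier G. \<exists>a\<in>set as. \<forall>n. cmod (F n x - F n (inv a)) \<le> inverse (real (Suc m)))"
    by simp
  then obtain as where as: "\<And>m. set (as m) \<subseteq> carrier G"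
    "\<And>m. \<forall>x\<in>carrier G. \<exists>a\<in>set (as m). \<forall>n. cmod (F n x - F n (inv a)) \<le> inverse (real (Suc m))"
    by metis
  define S where "S = (\<Union>m. (\<lambda>a. inv a) ` set (as m))"
  have "countable S" unfolding S_def by (intro countable_UN countableI_type countable_finite) simp
  have "S \<subseteq> carrier G" using as(1) by (auto simp: S_def)
  then have FS: "norm (F n x) \<le> B" if "x \<in> S" for n x using bound that by blast
  obtain k where k: "strict_mono k" "\<And>x. x \<in> S \<Longrightarrow> \<exists>l. (\<lambda>n. F (k n) x) \<longlonglongrightarrow> l"
    using function_convergent_subsequence[of S F B, OF \<open>countable S\<close> FS] by blast
  have "uniformly_Cauchy_on (carrier G) (\<lambda>n. F (k n))"
    unfolding uniformly_Cauchy_on_def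
  proof (intro allI impI)
    fix e :: real assume "e > 0"
    then have "e/4 > 0" by simp
    then obtain m where m: "inverse (real (Suc m)) < e/4" using reals_Archimedean by blast
    let ?K = "(\<lambda>a. inv a) ` set (as m)"
    have "\<exists>M. \<forall>p\<ge>M. \<forall>q\<ge>M. dist (F (k p) s) (F (k q) s) < e/4" if "s \<in> ?K" for s
    proof -
      have "s \<in> S" using that by (auto simp: S_def)
      then have "Cauchy (\<lambda>n. F (k n) s)" using k(2) convergent_Cauchy convergent_def by blast
      then show ?thesis using \<open>e/4 > 0\<close> unfolding Cauchy_def by blast
    qed
    then obtain M where M: "\<And>s p q. s \<in> ?K \<Longrightarrow> p \<ge> M s \<Longrightarrow> q \<ge> M s \<Longrightarrow> dist (F (k p) s) (F (k q) s) < e/4"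
      by metis
    define N where "N = Max (insert 0 (M ` ?K))"
    have N: "M s \<le> N" if "s \<in> ?K" for s
      unfolding N_def using that by (intro Max_ge) auto
    have "dist (F (k p) x) (F (k q) x) < e" if x: "x \<in> carrier G" and pq: "p \<ge> N" "q \<ge> N" for x p q
    proof -
      obtain a where a: "a \<in> set (as m)" "\<forall>n. cmod (F n x - F n (inv a)) \<le> inverse (real (Suc m))"
        using as(2) x by blast
      have "inv a \<in> ?K" using a(1) by blast
      then have "M (inv a) \<le> p" "M (inv a) \<le> q" using N pq order_trans by blast+
      then have 1: "dist (F (k p) (inv a)) (F (k q) (inv a)) < e/4"
        using M \<open>inv a \<in> ?K\<close> by blast
      have 2: "dist (F n x) (F n (inv a)) < e/4" for n
        using a(2)[rule_format, of n] m by (simp add: dist_norm)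
      have "dist (F (k p) x) (F (k q) x) \<le> dist (F (k p) x) (F (k p) (inv a))
          + dist (F (k p) (inv a)) (F (k q) (inv a)) + dist (F (k q) x) (F (k q) (inv a))"
        using dist_triangle[of "F (k p) x" "F (k q) x" "F (k p) (inv a)"]
          dist_triangle[of "F (k p) (inv a)" "F (k q) x" "F (k q) (inv a)"]
        by (simp add: dist_commute)
      then show ?thesis using 1 2[of "k p"] 2[of "k q"] \<open>e > 0\<close> by linarith
    qed
    then show "\<exists>M. \<forall>x\<in>carrier G. \<forall>m\<ge>M. \<forall>n\<ge>M. dist (F (k m) x) (F (k n) x) < e" by blast
  qed
  then have "uniformly_convergent_on (carrier G) (\<lambda>n. F (k n))"
    by (rule Cauchy_uniformly_convergent)
  then show ?thesis using k(1) unfolding uniformly_convergent_on_def by blast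
qed

lemma uniform_limit_cont:
  fixes f :: "'a \<Rightarrow> complex"
  assumes lim: "uniform_limit (carrier G) F f sequentially"
    and F: "\<And>n. cont (F n)"
  shows "cont f"
proof (rule continuousI_uniform_nbhd)
  fix e :: real assume "e > 0"
  then have e3: "e/3 > 0" by simp
  obtain n where n: "\<forall>x\<in>carrier G. dist (F n x) (f x) < e/3"
    using uniform_limitD[OF lim e3] by (auto simp: eventually_sequentially)
  obtain W where W: "openin T W" "\<one> \<in> W"
     "\<And>w x. w \<in> W \<Longrightarrow> x \<in> carrier G \<Longrightarrow> norm (F n (w \<otimes> x) - F n x) < e/3"
    using uniform_nbhd[OF F e3] by blast
  have "norm (f (w \<otimes> x) - f x) \<le> e" if "w \<in> W" "x \<in> carrier G" for w x
  proof -
    have "w \<in> carrier G" using that(1) openin_subset[OF W(1)] by auto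
    then have "dist (F n (w \<otimes> x)) (f (w \<otimes> x)) < e/3" "dist (F n x) (f x) < e/3"
      using n that by auto
    moreover have "dist (F n (w \<otimes> x)) (F n x) < e/3" using W(3)[OF that] by (simp add: dist_norm)
    moreover have "dist (f (w \<otimes> x)) (f x) \<le> dist (F n (w \<otimes> x)) (f (w \<otimes> x)) + dist (F n (w \<otimes> x)) (F n x) + dist (F n x) (f x)"
      using dist_triangle[of "f (w \<otimes> x)" "f x" "F n (w \<otimes> x)"]
        dist_triangle[of "F n (w \<otimes> x)" "f x" "F n x"]
      by (simp add: dist_commute)
    ultimately show ?thesis by (simp add: dist_norm)
  qed
  with W show "\<exists>W. openin T W \<and> \<one> \<in> W \<and> (\<forall>w\<in>W. \<forall>x\<in>carrier G. norm (f (w \<otimes> x) - f x) \<le> e)"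
    by (intro exI[of _ W]) simp
qed

lemma mean_limit:
  assumes lim: "uniform_limit (carrier G) F f sequentially"
    and F: "\<And>n. cont (F n)"
  shows "(\<lambda>n. mean (F n)) \<longlonglongrightarrow> mean f"
proof (rule tendstoI)
  fix e :: real assume "e > 0"
  then have e2: "e/2 > 0" by simp
  note f = uniform_limit_cont[OF lim F]
  show "\<forall>\<^sub>F n in sequentially. dist (mean (F n)) (mean f) < e"
    using uniform_limitD[OF lim e2]
  proof (rule eventually_mono)
    fix n assume n: "\<forall>x\<in>carrier G. dist (F n x) (f x) < e/2"
    have "mean (F n) - mean f = mean (\<lambda>x. F n x - f x)" by (rule mean_diff[OF F f, symmetric])
    also have "cmod \<dots> \<le> e/2"
      by (rule norm_mean_le; (intro cont_intros F f)?) (use n in \<open>auto simp: dist_norm intro: less_imp_le\<close>)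
    finally show "dist (mean (F n)) (mean f) < e" using \<open>e > 0\<close> by (simp add: dist_norm)
  qed
qed

lemma bounded_image:
  fixes f :: "'a \<Rightarrow> complex"
  assumes "cont f"
  shows "bounded (f ` carrier G)"
  by (rule continuous_bounded[OF assms]) (auto simp: bounded_iff)

definition state :: "('a \<Rightarrow> complex) \<Rightarrow> bool" where
  "state \<psi> \<longleftrightarrow> pos_type \<psi> \<and> \<psi> \<one> = 1"

lemma state_bound: "state \<psi> \<Longrightarrow> x \<in> carrier G \<Longrightarrow> cmod (\<psi> x) \<le> 1"
  using pos_type_bound[of \<psi> x] by (simp add: state_def)

text \<open>The largest coefficient of \<open>\<phi>\<close>: a weighted mean of coefficients is maximal when concentrated on the largest one.\<close>

definition max_coeff :: "('a \<Rightarrow> complex) \<Rightarrow> real" where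
  "max_coeff \<phi> = Sup ((\<lambda>\<psi>. Re (conv \<phi> \<psi> \<one>)) ` Collect state)"

lemma normalize_state:
  assumes "pos_type f" "Re (f \<one>) > 0"
  shows "state (\<lambda>x. complex_of_real (1 / Re (f \<one>)) * f x)"
proof -
  have "pos_type (\<lambda>x. complex_of_real (1 / Re (f \<one>)) * f x)"
    using assms by (intro pos_type_scale) auto
  moreover have "complex_of_real (1 / Re (f \<one>)) * f \<one> = 1"
    using assms(2) by (subst (2) pos_type_one_real[OF assms(1)]) (simp flip: of_real_mult)
  ultimately show ?thesis unfolding state_def by blast
qed

lemma state_values_bdd:
  assumes "pos_type \<phi>"
  shows "bdd_above ((\<lambda>\<psi>. Re (conv \<phi> \<psi> \<one>)) ` Collect state)"
proof (rule bdd_aboveI2)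
  fix \<psi> assume "\<psi> \<in> Collect state"
  then have \<psi>: "state \<psi>" by simp
  have "cmod (conv \<phi> \<psi> \<one>) \<le> Re (\<phi> \<one>) * 1"
    using assms \<psi> by (intro norm_conv_le pos_type_bound state_bound) (auto simp: state_def intro: pos_type_cont)
  then show "Re (conv \<phi> \<psi> \<one>) \<le> Re (\<phi> \<one>)"
    using complex_Re_le_cmod[of "conv \<phi> \<psi> \<one>"] by simp
qed

lemma conv_cmult:
  assumes "cont \<phi>" "cont \<psi>" "x \<in> carrier G"
  shows "conv \<phi> (\<lambda>x. c * \<psi> x) x = c * conv \<phi> \<psi> x"
proof -
  have "conv \<phi> (\<lambda>x. c * \<psi> x) x = mean (\<lambda>y. c * (cnj (\<phi> y) * \<psi> (x \<otimes> y)))"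
    unfolding conv_def by (rule mean_cong) simp
  also have "\<dots> = c * conv \<phi> \<psi> x"
    unfolding conv_def by (rule mean_cmult; intro cont_intros assms)
  finally show ?thesis .
qed

lemma conv_le_max_coeff:
  assumes \<phi>: "pos_type \<phi>" and \<psi>: "pos_type \<psi>"
  shows "Re (conv \<phi> \<psi> \<one>) \<le> max_coeff \<phi> * Re (\<psi> \<one>)"
proof (cases "Re (\<psi> \<one>) = 0")
  case True
  have "cmod (\<psi> y) \<le> 0" if "y \<in> carrier G" for y
    using pos_type_bound[OF \<psi> that] True by simp
  then have "conv \<phi> \<psi> \<one> = mean (\<lambda>y. 0)" unfolding conv_def by (intro mean_cong) simp
  then show ?thesis using True by (simp add: mean_const)
next
  case False
  then have pos: "Re (\<psi> \<one>) > 0" using pos_type_one[OF \<psi>] by simp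
  let ?r = "1 / Re (\<psi> \<one>)"
  have "Re (conv \<phi> (\<lambda>x. complex_of_real ?r * \<psi> x) \<one>) \<le> max_coeff \<phi>"
    unfolding max_coeff_def using normalize_state[OF \<psi> pos]
    by (intro cSup_upper state_values_bdd[OF \<phi>]) blast
  also have "conv \<phi> (\<lambda>x. complex_of_real ?r * \<psi> x) \<one> = complex_of_real ?r * conv \<phi> \<psi> \<one>"
    by (intro conv_cmult pos_type_cont \<phi> \<psi>) simp
  finally show ?thesis using pos by (simp add: field_simps)
qed

text \<open>
  The function \<open>max_coeff \<phi> * \<psi> - conv \<phi> \<psi>\<close> has the non-negative coefficients
  \<open>(max_coeff \<phi> - f\<^sub>\<xi>) * p\<^sub>\<xi>\<close>, so its modulus is largest at \<open>\<one>\<close>. In the proof, \<open>conv_le_max_coeff\<close> is applied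
  to \<open>twist c a \<psi>\<close> in place of \<open>\<psi>\<close>.
\<close>

lemma max_coeff_defect:
  assumes \<phi>: "pos_type \<phi>" and \<psi>: "pos_type \<psi>" and a: "a \<in> carrier G"
  shows "cmod (complex_of_real (max_coeff \<phi>) * \<psi> a - conv \<phi> \<psi> a) \<le> max_coeff \<phi> * Re (\<psi> \<one>) - Re (conv \<phi> \<psi> \<one>)"
proof -
  let ?D = "complex_of_real (max_coeff \<phi>) * \<psi> a - conv \<phi> \<psi> a"
  have *: "- Re (c * ?D) \<le> max_coeff \<phi> * Re (\<psi> \<one>) - Re (conv \<phi> \<psi> \<one>)" if c: "cmod c = 1" for c
  proof -
    have "Re (conv \<phi> (twist c a \<psi>) \<one>) \<le> max_coeff \<phi> * Re (twist c a \<psi> \<one>)"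
      by (intro conv_le_max_coeff \<phi> pos_type_twist \<psi> c a)
    also have "conv \<phi> (twist c a \<psi>) \<one> = twist c a (conv \<phi> \<psi>) \<one>"
      by (intro conv_twist pos_type_cont \<phi> \<psi> a one_closed)
    also have "Re \<dots> = 2 * Re (conv \<phi> \<psi> \<one>) + 2 * Re (c * conv \<phi> \<psi> a)"
      by (intro twist_at_one conv_inv \<phi> \<psi> a)
    also have "Re (twist c a \<psi> \<one>) = 2 * Re (\<psi> \<one>) + 2 * Re (c * \<psi> a)"
      by (intro twist_at_one pos_type_inv[OF \<psi>] a)
    finally show ?thesis by (simp add: algebra_simps)
  qed
  obtain c where "cmod c = 1" "Re (c * ?D) = - cmod ?D" using rotate_to_negative by blast
  then show ?thesis using *[of c] by simp
qed

text \<open>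
  The functions \<open>conv \<phi> (\<Psi> n)\<close> are equicontinuous although the \<open>\<Psi> n\<close> need not be. By
  \<open>max_coeff_defect\<close> the difference between \<open>max_coeff \<phi> * \<Psi> n\<close> and \<open>conv \<phi> (\<Psi> n)\<close> tends to 0 uniformly, so
  convergence of a subsequence of the latter passes to the former.
\<close>

lemma maximizing_states_converge:
  assumes \<phi>: "pos_type \<phi>" and top: "max_coeff \<phi> > 0" and \<Psi>: "\<And>n. state (\<Psi> n)"
    and lim: "(\<lambda>n. Re (conv \<phi> (\<Psi> n) \<one>)) \<longlonglongrightarrow> max_coeff \<phi>"
  shows "\<exists>k \<psi>. strict_mono k \<and> state \<psi> \<and> Re (conv \<phi> \<psi> \<one>) = max_coeff \<phi> \<and>
     uniform_limit (carrier G) (\<lambda>n. \<Psi> (k n)) \<psi> sequentially"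
proof -
  have pt: "pos_type (\<Psi> n)" and cont: "cont (\<Psi> n)" for n
    using \<Psi> pos_type_cont by (auto simp: state_def)
  have "\<exists>k f. strict_mono k \<and> uniform_limit (carrier G) (\<lambda>n. conv \<phi> (\<Psi> (k n))) f sequentially"
  proof (rule equicontinuous_subsequence)
    show "cmod (conv \<phi> (\<Psi> n) x) \<le> Re (\<phi> \<one>) * 1" if "x \<in> carrier G" for n x
      using that by (intro norm_conv_le pos_type_cont[OF \<phi>] cont pos_type_bound[OF \<phi>] state_bound \<Psi>)
    fix e :: real assume "e > 0"
    from conv_equicontinuous[OF pos_type_cont[OF \<phi>] this]
    obtain W where "openin T W" "\<one> \<in> W" "\<forall>\<psi>. cont \<psi> \<longrightarrow> (\<forall>x\<in>carrier G. cmod (\<psi> x) \<le> 1) \<longrightarrow>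
      (\<forall>w\<in>W. \<forall>x\<in>carrier G. cmod (conv \<phi> \<psi> (w \<otimes> x) - conv \<phi> \<psi> x) \<le> e)" by blast
    then show "\<exists>W. openin T W \<and> \<one> \<in> W \<and>
      (\<forall>n. \<forall>w\<in>W. \<forall>x\<in>carrier G. cmod (conv \<phi> (\<Psi> n) (w \<otimes> x) - conv \<phi> (\<Psi> n) x) \<le> e)"
      using cont state_bound[OF \<Psi>] by (intro exI[of _ W]) simp
  qed
  then obtain k f where k: "strict_mono k" and f: "uniform_limit (carrier G) (\<lambda>n. conv \<phi> (\<Psi> (k n))) f sequentially"
    by blast
  have lim_k: "(\<lambda>n. Re (conv \<phi> (\<Psi> (k n)) \<one>)) \<longlonglongrightarrow> max_coeff \<phi>"
    using LIMSEQ_subseq_LIMSEQ[OF lim k] by (simp add: o_def)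
  define \<psi> where "\<psi> x = f x / max_coeff \<phi>" for x
  have unif: "uniform_limit (carrier G) (\<lambda>n. \<Psi> (k n)) \<psi> sequentially"
  proof (rule uniform_limitI)
    fix e :: real assume "e > 0"
    define d where "d = e * max_coeff \<phi> / 2"
    have d: "d > 0" using \<open>e > 0\<close> top by (simp add: d_def)
    have "\<forall>\<^sub>F n in sequentially. max_coeff \<phi> - d < Re (conv \<phi> (\<Psi> (k n)) \<one>)"
      using order_tendstoD(1)[OF lim_k, of "max_coeff \<phi> - d"] d by simp
    with uniform_limitD[OF f d]
    show "\<forall>\<^sub>F n in sequentially. \<forall>x\<in>carrier G. dist (\<Psi> (k n) x) (\<psi> x) < e"
    proof (rule eventually_elim2, intro ballI)
      fix n x assume n: "\<forall>x\<in>carrier G. dist (conv \<phi> (\<Psi> (k n)) x) (f x) < d"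
         "max_coeff \<phi> - d < Re (conv \<phi> (\<Psi> (k n)) \<one>)" and x: "x \<in> carrier G"
      have "\<Psi> (k n) \<one> = 1" using \<Psi> by (simp add: state_def)
      then have "cmod (complex_of_real (max_coeff \<phi>) * \<Psi> (k n) x - conv \<phi> (\<Psi> (k n)) x) < d"
        using max_coeff_defect[OF \<phi> pt x, of "k n"] n(2) by simp
      moreover have "cmod (conv \<phi> (\<Psi> (k n)) x - f x) < d" using n(1) x by (simp add: dist_norm)
      ultimately have "cmod (complex_of_real (max_coeff \<phi>) * \<Psi> (k n) x - f x) < 2 * d"
        using norm_triangle_ineq[of "complex_of_real (max_coeff \<phi>) * \<Psi> (k n) x - conv \<phi> (\<Psi> (k n)) x" "conv \<phi> (\<Psi> (k n)) x - f x"]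
        by simp
      moreover have "complex_of_real (max_coeff \<phi>) * \<Psi> (k n) x - f x = complex_of_real (max_coeff \<phi>) * (\<Psi> (k n) x - \<psi> x)"
        using top by (simp add: \<psi>_def algebra_simps)
      ultimately have "max_coeff \<phi> * cmod (\<Psi> (k n) x - \<psi> x) < max_coeff \<phi> * e"
        using top by (simp add: norm_mult d_def mult.commute)
      then show "dist (\<Psi> (k n) x) (\<psi> x) < e" using top by (simp add: dist_norm)
    qed
  qed
  have \<psi>_cont: "cont \<psi>" by (rule uniform_limit_cont[OF unif cont])
  have ptw: "(\<lambda>n. \<Psi> (k n) x) \<longlonglongrightarrow> \<psi> x" if "x \<in> carrier G" for x
    by (rule tendsto_uniform_limitI[OF unif that])
  have "pos_type \<psi>" by (rule pos_type_limit[OF pt \<psi>_cont ptw])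
  moreover have "\<psi> \<one> = 1"
  proof -
    have "(\<lambda>n. \<Psi> (k n) \<one>) = (\<lambda>n. 1)" using \<Psi> by (simp add: state_def)
    then show ?thesis using ptw[OF one_closed] LIMSEQ_unique[OF _ tendsto_const] by metis
  qed
  moreover have "Re (conv \<phi> \<psi> \<one>) = max_coeff \<phi>"
  proof -
    have "uniform_limit (carrier G) (\<lambda>n y. cnj (\<phi> y) * \<Psi> (k n) (\<one> \<otimes> y)) (\<lambda>y. cnj (\<phi> y) * \<psi> (\<one> \<otimes> y)) sequentially"
    proof (rule uniform_lim_mult[OF uniform_limit_const])
      show "uniform_limit (carrier G) (\<lambda>n y. \<Psi> (k n) (\<one> \<otimes> y)) (\<lambda>y. \<psi> (\<one> \<otimes> y)) sequentially"
        using unif by (simp add: uniform_limit_iff)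
    qed (intro bounded_image cont_intros pos_type_cont[OF \<phi>] \<psi>_cont)+
    then have "(\<lambda>n. conv \<phi> (\<Psi> (k n)) \<one>) \<longlonglongrightarrow> conv \<phi> \<psi> \<one>"
      unfolding conv_def by (rule mean_limit) (intro cont_intros pos_type_cont[OF \<phi>] cont)
    then have "(\<lambda>n. Re (conv \<phi> (\<Psi> (k n)) \<one>)) \<longlonglongrightarrow> Re (conv \<phi> \<psi> \<one>)" by (rule tendsto_Re)
    then show ?thesis using lim_k LIMSEQ_unique by blast
  qed
  ultimately show ?thesis using k unif by (auto simp: state_def)
qed

end

section \<open>Characters separate points\<close>

lemma approaches_Sup:
  fixes S :: "real set"
  assumes "S \<noteq> {}" "bdd_above S"
  shows "\<exists>s. (\<forall>n. s n \<in> S) \<and> s \<longlonglongrightarrow> Sup S"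
  using closure_contains_Sup[OF assms] by (simp add: closure_sequential)

lemma convex_combination_norm_sq:
  fixes p q :: complex
  assumes "\<alpha> + \<beta> = 1"
  shows "\<alpha> * (cmod p)^2 + \<beta> * (cmod q)^2 - (cmod (of_real \<alpha> * p + of_real \<beta> * q))^2 = \<alpha> * \<beta> * (cmod (p - q))^2"
proof -
  have \<beta>: "\<beta> = 1 - \<alpha>" using assms by simp
  show ?thesis
    unfolding cmod_power2 \<beta> by (simp add: power2_eq_square algebra_simps)
qed

context compact_ab_group
begin

text \<open>By Parseval this is \<open>\<Sum> p\<^sub>\<xi>\<^sup>2\<close>, a strictly convex function of \<open>\<psi>\<close>.\<close>

definition energy :: "('a \<Rightarrow> complex) \<Rightarrow> real" where
  "energy \<psi> = Re (mean (\<lambda>x. \<psi> x * cnj (\<psi> x)))"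

definition top_state :: "('a \<Rightarrow> complex) \<Rightarrow> ('a \<Rightarrow> complex) \<Rightarrow> bool" where
  "top_state \<phi> \<psi> \<longleftrightarrow> state \<psi> \<and> Re (conv \<phi> \<psi> \<one>) = max_coeff \<phi>"

lemma state_cont: "state \<psi> \<Longrightarrow> cont \<psi>"
  by (simp add: state_def pos_type_cont)

lemma trivial_state: "state (\<lambda>x. 1)"
proof -
  have "pos_type (autocorr (\<lambda>x. 1))" by (rule autocorr_pos_type) (rule continuous_map_constant)
  moreover have "autocorr (\<lambda>x. 1) = (\<lambda>x. 1)" by (simp add: autocorr_def fun_eq_iff mean_const)
  ultimately show ?thesis by (simp add: state_def)
qed

lemma top_state_exists:
  assumes \<phi>: "pos_type \<phi>" and pos: "max_coeff \<phi> > 0"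
  shows "\<exists>\<psi>. top_state \<phi> \<psi>"
proof -
  have "(\<lambda>\<psi>. Re (conv \<phi> \<psi> \<one>)) ` Collect state \<noteq> {}" using trivial_state by blast
  from approaches_Sup[OF this state_values_bdd[OF \<phi>]]
  obtain s where s: "\<forall>n. s n \<in> (\<lambda>\<psi>. Re (conv \<phi> \<psi> \<one>)) ` Collect state" "s \<longlonglongrightarrow> max_coeff \<phi>"
    unfolding max_coeff_def by blast
  then have "\<forall>n. \<exists>\<psi>. state \<psi> \<and> s n = Re (conv \<phi> \<psi> \<one>)" by blast
  then obtain \<Psi> where \<Psi>: "\<forall>n. state (\<Psi> n) \<and> s n = Re (conv \<phi> (\<Psi> n) \<one>)" by metis
  then have "(\<lambda>n. Re (conv \<phi> (\<Psi> n) \<one>)) \<longlonglongrightarrow> max_coeff \<phi>" using s(2) by (simp add: LIMSEQ_def)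
  then show ?thesis
    using maximizing_states_converge[OF \<phi> pos, of \<Psi>] \<Psi> unfolding top_state_def by blast
qed

lemma max_energy_top_state_exists:
  assumes \<phi>: "pos_type \<phi>" and pos: "max_coeff \<phi> > 0"
  shows "\<exists>\<psi>. top_state \<phi> \<psi> \<and> (\<forall>\<psi>'. top_state \<phi> \<psi>' \<longrightarrow> energy \<psi>' \<le> energy \<psi>)"
proof -
  let ?S = "energy ` Collect (top_state \<phi>)"
  have ne: "?S \<noteq> {}" using top_state_exists[OF assms] by blast
  have bdd: "bdd_above ?S"
  proof (rule bdd_aboveI2)
    fix \<psi> assume "\<psi> \<in> Collect (top_state \<phi>)"
    then have \<psi>: "state \<psi>" by (simp add: top_state_def)
    have "cmod (mean (\<lambda>x. \<psi> x * cnj (\<psi> x))) \<le> 1"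
    proof (rule norm_mean_le)
      show "cmod (\<psi> x * cnj (\<psi> x)) \<le> 1" if "x \<in> carrier G" for x
        using state_bound[OF \<psi> that] by (simp add: norm_mult mult_le_one)
    qed (intro cont_intros state_cont \<psi>)
    then show "energy \<psi> \<le> 1"
      using complex_Re_le_cmod[of "mean (\<lambda>x. \<psi> x * cnj (\<psi> x))"] by (simp add: energy_def)
  qed
  obtain s where s: "\<forall>n. s n \<in> ?S" "s \<longlonglongrightarrow> Sup ?S"
    using approaches_Sup[OF ne bdd] by blast
  then have "\<forall>n. \<exists>\<psi>. top_state \<phi> \<psi> \<and> s n = energy \<psi>" by blast
  then obtain \<Psi> where \<Psi>: "\<forall>n. top_state \<phi> (\<Psi> n) \<and> s n = energy (\<Psi> n)" by metis
  then have st: "state (\<Psi> n)" for n by (simp add: top_state_def)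
  have "(\<lambda>n. Re (conv \<phi> (\<Psi> n) \<one>)) = (\<lambda>n. max_coeff \<phi>)" using \<Psi> by (simp add: top_state_def)
  then have "(\<lambda>n. Re (conv \<phi> (\<Psi> n) \<one>)) \<longlonglongrightarrow> max_coeff \<phi>" by simp
  from maximizing_states_converge[OF \<phi> pos st this]
  obtain k \<psi> where k: "strict_mono k" and \<psi>: "state \<psi>" "Re (conv \<phi> \<psi> \<one>) = max_coeff \<phi>"
    and unif: "uniform_limit (carrier G) (\<lambda>n. \<Psi> (k n)) \<psi> sequentially" by blast
  have "uniform_limit (carrier G) (\<lambda>n x. \<Psi> (k n) x * cnj (\<Psi> (k n) x)) (\<lambda>x. \<psi> x * cnj (\<psi> x)) sequentially"
  proof (rule uniform_lim_mult[OF unif])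
    show "uniform_limit (carrier G) (\<lambda>n x. cnj (\<Psi> (k n) x)) (\<lambda>x. cnj (\<psi> x)) sequentially"
      using unif by (simp add: uniform_limit_iff dist_norm flip: complex_cnj_diff)
  qed (intro bounded_image cont_intros state_cont \<psi>)+
  then have "(\<lambda>n. mean (\<lambda>x. \<Psi> (k n) x * cnj (\<Psi> (k n) x))) \<longlonglongrightarrow> mean (\<lambda>x. \<psi> x * cnj (\<psi> x))"
    by (rule mean_limit) (intro cont_intros state_cont st)
  then have "(\<lambda>n. energy (\<Psi> (k n))) \<longlonglongrightarrow> energy \<psi>"
    unfolding energy_def by (rule tendsto_Re)
  moreover have "(\<lambda>n. energy (\<Psi> (k n))) \<longlonglongrightarrow> Sup ?S"
    using LIMSEQ_subseq_LIMSEQ[OF s(2) k] \<Psi> by (simp add: o_def)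
  ultimately have "energy \<psi> = Sup ?S" using LIMSEQ_unique by blast
  then have "energy \<psi>' \<le> energy \<psi>" if "top_state \<phi> \<psi>'" for \<psi>'
    using cSup_upper[OF _ bdd, of "energy \<psi>'"] that by simp
  then show ?thesis using \<psi> unfolding top_state_def by blast
qed

text \<open>
  Strict convexity: by \<open>convex_combination_norm_sq\<close>, a proper convex combination of distinct top states
  has less energy than one of them.
\<close>

lemma max_energy_extreme:
  assumes \<psi>: "top_state \<phi> \<psi>" and max: "\<And>\<psi>'. top_state \<phi> \<psi>' \<Longrightarrow> energy \<psi>' \<le> energy \<psi>"
    and p: "top_state \<phi> p" and q: "top_state \<phi> q"
    and ab: "\<alpha> > 0" "\<beta> > 0" "\<alpha> + \<beta> = 1"
    and comb: "\<And>x. x \<in> carrier G \<Longrightarrow> \<psi> x = of_real \<alpha> * p x + of_real \<beta> * q x"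
    and x: "x \<in> carrier G"
  shows "p x = \<psi> x"
proof -
  have cont: "cont p" "cont q" "cont \<psi>"
    using p q \<psi> state_cont by (auto simp: top_state_def)
  let ?d = "\<lambda>x. (p x - q x) * cnj (p x - q x)"
  have "mean (\<lambda>x. of_real (\<alpha> * \<beta>) * ?d x)
      = mean (\<lambda>x. of_real \<alpha> * (p x * cnj (p x)) + of_real \<beta> * (q x * cnj (q x)) - \<psi> x * cnj (\<psi> x))"
  proof (rule mean_cong)
    fix y assume y: "y \<in> carrier G"
    show "of_real (\<alpha> * \<beta>) * ?d y = of_real \<alpha> * (p y * cnj (p y)) + of_real \<beta> * (q y * cnj (q y)) - \<psi> y * cnj (\<psi> y)"
      unfolding comb[OF y]
      using arg_cong[OF convex_combination_norm_sq[OF ab(3), of "p y" "q y"], of complex_of_real]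
      by (simp only: complex_norm_square of_real_add of_real_diff of_real_mult)
  qed
  also have "\<dots> = of_real \<alpha> * mean (\<lambda>x. p x * cnj (p x)) + of_real \<beta> * mean (\<lambda>x. q x * cnj (q x)) - mean (\<lambda>x. \<psi> x * cnj (\<psi> x))"
    by (subst mean_diff mean_add mean_cmult; (intro cont_intros cont)?)+ simp
  also have "mean (\<lambda>x. of_real (\<alpha> * \<beta>) * ?d x) = of_real (\<alpha> * \<beta>) * mean ?d"
    by (rule mean_cmult; intro cont_intros cont)
  finally have "\<alpha> * \<beta> * Re (mean ?d) = \<alpha> * energy p + \<beta> * energy q - energy \<psi>"
    by (simp add: energy_def complex_eq_iff)
  also have "\<dots> \<le> \<alpha> * energy \<psi> + \<beta> * energy \<psi> - energy \<psi>"
    using ab max[OF p] max[OF q] by (intro diff_right_mono add_mono mult_left_mono) auto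
  also have "\<dots> = 0" using ab(3) by (simp flip: distrib_right)
  finally have le: "Re (mean ?d) \<le> 0" using ab by (simp add: mult_le_0_iff zero_less_mult_iff)
  have "p x = q x"
  proof (rule ccontr)
    assume "p x \<noteq> q x"
    have "0 < Re (mean ?d)"
    proof (rule mean_Re_pos[OF _ _ x])
      show "0 < Re ((p x - q x) * cnj (p x - q x))"
        using \<open>p x \<noteq> q x\<close> by (simp only: complex_norm_square[symmetric]) simp
    qed ((intro cont_intros cont)?, simp only: complex_norm_square[symmetric], simp)
    with le show False by simp
  qed
  then have "\<psi> x = of_real (\<alpha> + \<beta>) * p x" using comb[OF x] by (simp add: algebra_simps)
  then show ?thesis using ab(3) by simp
qed

text \<open>
  Since \<open>twist c a \<psi> + twist (- c) a \<psi> = 4 * \<psi>\<close>, the state \<open>\<psi>\<close> is a convex combination of the two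
  normalized twists. These are again top states, because neither coefficient can exceed the maximum
  while their weighted sum attains it. Hence the twist is a multiple of \<open>\<psi>\<close>.
\<close>

lemma max_energy_twist:
  assumes \<phi>: "pos_type \<phi>"
    and \<psi>: "top_state \<phi> \<psi>" and max: "\<And>\<psi>'. top_state \<phi> \<psi>' \<Longrightarrow> energy \<psi>' \<le> energy \<psi>"
    and c: "cmod c = 1" and a: "a \<in> carrier G" and x: "x \<in> carrier G"
  shows "twist c a \<psi> x = of_real (2 + 2 * Re (c * \<psi> a)) * \<psi> x"
proof -
  have pt: "pos_type \<psi>" and one: "\<psi> \<one> = 1" using \<psi> by (auto simp: top_state_def state_def)
  define p where "p = twist c a \<psi>"
  define q where "q = twist (- c) a \<psi>"
  have p: "pos_type p" and q: "pos_type q"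
    unfolding p_def q_def using c by (auto intro!: pos_type_twist pt a)
  have sum: "p y + q y = 4 * \<psi> y" for y by (simp add: p_def q_def twist_def)
  define P where "P = Re (p \<one>)"
  have P_eq: "P = 2 + 2 * Re (c * \<psi> a)"
    unfolding P_def p_def using twist_at_one[of \<psi> a c, OF pos_type_inv[OF pt] a] one by simp
  have Q_eq: "Re (q \<one>) = 4 - P" using arg_cong[OF sum[of \<one>], of Re] one by (simp add: P_def)
  have PQ: "0 \<le> P" "P \<le> 4" using pos_type_one[OF p] pos_type_one[OF q] Q_eq by (auto simp: P_def)
  have "conv \<phi> p \<one> + conv \<phi> q \<one> = 4 * conv \<phi> \<psi> \<one>"
    unfolding p_def q_def by (simp add: conv_twist pos_type_cont \<phi> pt a) (simp add: twist_def)
  then have sum_conv: "Re (conv \<phi> p \<one>) + Re (conv \<phi> q \<one>) = 4 * max_coeff \<phi>"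
    using \<psi> by (simp add: complex_eq_iff top_state_def)
  have le: "Re (conv \<phi> p \<one>) \<le> max_coeff \<phi> * P" "Re (conv \<phi> q \<one>) \<le> max_coeff \<phi> * (4 - P)"
    using conv_le_max_coeff[OF \<phi> p] conv_le_max_coeff[OF \<phi> q] Q_eq by (simp_all add: P_def)
  then have conv_pq: "Re (conv \<phi> p \<one>) = max_coeff \<phi> * P" "Re (conv \<phi> q \<one>) = max_coeff \<phi> * (4 - P)"
    using sum_conv by (simp_all add: algebra_simps)
  \<comment> \<open>If \<open>P\<close> is 0 or 4, one of the twists vanishes and cannot be normalized.\<close>
  consider "P = 0" | "P = 4" | "0 < P" "P < 4" using PQ by linarith
  then have "p x = of_real P * \<psi> x"
  proof cases
    case 1
    then show ?thesis using pos_type_bound[OF p x] by (simp add: P_def)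
  next
    case 2
    then have "q x = 0" using pos_type_bound[OF q x] Q_eq by simp
    then show ?thesis using sum[of x] 2 by simp
  next
    case 3
    let ?p = "\<lambda>x. of_real (1 / P) * p x" and ?q = "\<lambda>x. of_real (1 / (4 - P)) * q x"
    have "state ?p" using normalize_state[OF p] 3 by (simp add: P_def)
    moreover have "Re (conv \<phi> ?p \<one>) = max_coeff \<phi>"
      using conv_cmult[OF pos_type_cont[OF \<phi>] pos_type_cont[OF p] one_closed, of "of_real (1/P)"] conv_pq(1) 3
      by simp
    ultimately have tp: "top_state \<phi> ?p" by (simp add: top_state_def)
    have "state ?q" using normalize_state[OF q] 3 Q_eq by simp
    moreover have "Re (conv \<phi> ?q \<one>) = max_coeff \<phi>"
      using conv_cmult[OF pos_type_cont[OF \<phi>] pos_type_cont[OF q] one_closed, of "of_real (1/(4-P))"] conv_pq(2) 3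
      by simp
    ultimately have tq: "top_state \<phi> ?q" by (simp add: top_state_def)
    have "P / 4 * (1 / P) = 1 / 4" "(4 - P) / 4 * (1 / (4 - P)) = 1 / 4" using 3 by simp_all
    then have "complex_of_real (P / 4) * of_real (1 / P) = of_real (1 / 4)"
      "complex_of_real ((4 - P) / 4) * of_real (1 / (4 - P)) = of_real (1 / 4)"
      by (simp_all only: of_real_mult[symmetric])
    then have eq: "of_real (P / 4) * ?p y + of_real ((4 - P) / 4) * ?q y = (p y + q y) / 4" for y
      unfolding mult.assoc[symmetric] by (simp only: add_divide_distrib) simp
    have comb: "\<psi> y = of_real (P / 4) * ?p y + of_real ((4 - P) / 4) * ?q y" for y
      unfolding eq sum by simp
    have "?p x = \<psi> x"
      by (rule max_energy_extreme[OF \<psi> max tp tq _ _ _ comb x]) (use 3 in \<open>simp_all add: field_simps\<close>)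
    then show ?thesis using 3 by (auto simp: field_simps)
  qed
  then show ?thesis by (simp add: p_def P_eq)
qed

text \<open>The cases \<open>c = 1\<close> and \<open>c = \<i>\<close> of \<open>max_energy_twist\<close> are two linear equations for \<open>\<psi> (a \<otimes> x)\<close> and \<open>\<psi> (inv a \<otimes> x)\<close>.\<close>

lemma max_energy_mult:
  assumes \<phi>: "pos_type \<phi>"
    and \<psi>: "top_state \<phi> \<psi>" and max: "\<And>\<psi>'. top_state \<phi> \<psi>' \<Longrightarrow> energy \<psi>' \<le> energy \<psi>"
    and a: "a \<in> carrier G" and x: "x \<in> carrier G"
  shows "\<psi> (a \<otimes> x) = \<psi> a * \<psi> x"
proof -
  let ?u = "\<psi> (a \<otimes> x)" and ?v = "\<psi> (inv a \<otimes> x)"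
  have "?u + ?v = of_real (2 * Re (\<psi> a)) * \<psi> x"
    using max_energy_twist[OF \<phi> \<psi> max _ a x, of 1] by (simp add: twist_def algebra_simps)
  moreover have "\<i> * ?u - \<i> * ?v = - of_real (2 * Im (\<psi> a)) * \<psi> x"
    using max_energy_twist[OF \<phi> \<psi> max _ a x, of \<i>] by (simp add: twist_def algebra_simps)
  then have "\<i> * (\<i> * ?u - \<i> * ?v) = \<i> * (- of_real (2 * Im (\<psi> a)) * \<psi> x)" by simp
  then have "?u - ?v = \<i> * of_real (2 * Im (\<psi> a)) * \<psi> x" by (simp add: algebra_simps)
  ultimately have "2 * ?u = (of_real (2 * Re (\<psi> a)) + \<i> * of_real (2 * Im (\<psi> a))) * \<psi> x"
    by (simp add: algebra_simps)
  also have "of_real (2 * Re (\<psi> a)) + \<i> * of_real (2 * Im (\<psi> a)) = 2 * \<psi> a"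
    by (simp add: complex_eq_iff)
  finally show ?thesis by simp
qed

text \<open>
  The largest coefficient is positive because \<open>\<phi>\<close>, suitably normalized, is itself a competitor and
  \<open>mean (cnj \<phi> * \<phi>) > 0\<close>. A top state of maximal energy is multiplicative, and its modulus is 1 because
  the value at \<open>inv x\<close> is the conjugate of the value at \<open>x\<close>.
\<close>

lemma character_with_coefficient:
  assumes \<phi>: "pos_type \<phi>" and x0: "x0 \<in> carrier G" "\<phi> x0 \<noteq> 0"
  shows "\<exists>\<xi>. cont \<xi> \<and> (\<forall>a\<in>carrier G. \<forall>x\<in>carrier G. \<xi> (a \<otimes> x) = \<xi> a * \<xi> x)
     \<and> (\<forall>x\<in>carrier G. cmod (\<xi> x) = 1) \<and> mean (\<lambda>y. cnj (\<phi> y) * \<xi> y) \<noteq> 0"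
proof -
  note cont = pos_type_cont[OF \<phi>]
  have "0 < Re (conv \<phi> \<phi> \<one>)"
    unfolding conv_def
  proof (rule mean_Re_pos[OF _ _ x0(1)])
    show "0 < Re (cnj (\<phi> x0) * \<phi> (\<one> \<otimes> x0))"
      using x0 by (simp add: power2_eq_square[symmetric] sum_power2_gt_zero_iff complex_eq_iff)
  next
    show "0 \<le> Re (cnj (\<phi> x) * \<phi> (\<one> \<otimes> x))" if "x \<in> carrier G" for x using that by simp
  qed (intro cont_intros cont)
  also have "\<dots> \<le> max_coeff \<phi> * Re (\<phi> \<one>)" by (rule conv_le_max_coeff[OF \<phi> \<phi>])
  finally have pos: "max_coeff \<phi> > 0"
    using pos_type_one[OF \<phi>] by (auto simp: zero_less_mult_iff)
  obtain \<psi> where \<psi>: "top_state \<phi> \<psi>" "\<forall>\<psi>'. top_state \<phi> \<psi>' \<longrightarrow> energy \<psi>' \<le> energy \<psi>"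
    using max_energy_top_state_exists[OF \<phi> pos] by blast
  have mult: "\<psi> (a \<otimes> x) = \<psi> a * \<psi> x" if "a \<in> carrier G" "x \<in> carrier G" for a x
    by (rule max_energy_mult[OF \<phi> \<psi>(1) _ that]) (use \<psi>(2) in simp)
  have pt: "pos_type \<psi>" and one: "\<psi> \<one> = 1" using \<psi>(1) by (auto simp: top_state_def state_def)
  have "cmod (\<psi> x) = 1" if "x \<in> carrier G" for x
  proof -
    have "\<psi> x * cnj (\<psi> x) = 1"
      using mult[OF that inv_closed[OF that]] that one by (simp add: pos_type_inv[OF pt])
    then have "(cmod (\<psi> x))^2 = 1" by (metis complex_norm_square of_real_eq_1_iff)
    then show ?thesis by (simp add: power2_eq_1_iff) (smt (verit) norm_ge_zero)
  qed
  moreover have "mean (\<lambda>y. cnj (\<phi> y) * \<psi> y) = conv \<phi> \<psi> \<one>"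
    unfolding conv_def by (rule mean_cong) simp
  then have "mean (\<lambda>y. cnj (\<phi> y) * \<psi> y) \<noteq> 0" using \<psi>(1) pos by (auto simp: top_state_def)
  ultimately show ?thesis using pos_type_cont[OF pt] mult by blast
qed

text \<open>
  Take \<open>F y = f y - f (x0 \<otimes> y)\<close> with \<open>f x0 \<noteq> f \<one>\<close>. A character \<open>\<xi>\<close> with \<open>\<xi> x0 = 1\<close> has coefficient 0 in
  \<open>F\<close>, hence in \<open>autocorr F\<close>; so the character with non-zero coefficient that
  \<open>character_with_coefficient\<close> provides for \<open>autocorr F\<close> is not 1 at \<open>x0\<close>.
\<close>

lemma characters_separate_from_one:
  assumes T: "Hausdorff_space T" and x0: "x0 \<in> carrier G" "x0 \<noteq> \<one>"
  shows "\<exists>\<xi>. cont \<xi> \<and> (\<forall>a\<in>carrier G. \<forall>x\<in>carrier G. \<xi> (a \<otimes> x) = \<xi> a * \<xi> x)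
     \<and> (\<forall>x\<in>carrier G. cmod (\<xi> x) = 1) \<and> \<xi> x0 \<noteq> 1"
proof -
  have "normal_space T" using T compact by (simp add: compact_Hausdorff_or_regular_imp_normal_space)
  moreover have "closedin T {x0}" "closedin T {\<one>}" using closedin_Hausdorff_singleton[OF T] x0 by simp_all
  moreover have "disjnt {x0} {\<one>}" using x0 by simp
  ultimately obtain g :: "'a \<Rightarrow> real" where g: "continuous_map T (top_of_set {0..1}) g" "g ` {x0} \<subseteq> {0}" "g ` {\<one>} \<subseteq> {1}"
    using Urysohn_lemma[of T "{x0}" "{\<one>}" 0 1] by auto
  define f where "f x = complex_of_real (g x)" for x
  have "cont g" using g(1) by (simp add: continuous_map_in_subtopology)
  then have "cont (complex_of_real \<circ> g)"
    by (rule continuous_map_compose) (auto intro: continuous_intros)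
  then have f: "cont f" by (simp add: f_def[abs_def] o_def)
  have f01: "f x0 = 0" "f \<one> = 1" using g by (auto simp: f_def)
  define F where "F y = f y + (-1) * f (x0 \<otimes> y)" for y
  have F: "cont F" unfolding F_def[abs_def] by (intro cont_intros f x0)
  have "0 < Re (autocorr F \<one>)"
    unfolding autocorr_one
  proof (rule mean_Re_pos[OF _ _ one_closed])
    show "0 < Re (F \<one> * cnj (F \<one>))" using f01 x0 by (simp add: F_def)
  qed ((intro cont_intros F)?, simp)
  then have "autocorr F \<one> \<noteq> 0" by auto
  from character_with_coefficient[OF autocorr_pos_type[OF F] one_closed this]
  obtain \<xi> where \<xi>: "cont \<xi>" "\<forall>a\<in>carrier G. \<forall>x\<in>carrier G. \<xi> (a \<otimes> x) = \<xi> a * \<xi> x"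
    "\<forall>x\<in>carrier G. cmod (\<xi> x) = 1" "mean (\<lambda>y. cnj (autocorr F y) * \<xi> y) \<noteq> 0" by blast
  have "\<xi> x0 \<noteq> 1"
  proof
    assume \<xi>1: "\<xi> x0 = 1"
    have "\<xi> \<one> * \<xi> \<one> = \<xi> \<one>" using \<xi>(2)[rule_format, of \<one> \<one>] by simp
    moreover have "\<xi> \<one> \<noteq> 0" using \<xi>(3) by (metis norm_zero one_closed zero_neq_one)
    ultimately have "\<xi> \<one> = 1" by simp
    then have \<xi>i: "\<xi> (inv x0) = 1" using \<xi>(2)[rule_format, of x0 "inv x0"] \<xi>1 x0 by simp
    let ?h = "\<lambda>y. cnj (autocorr f y) * \<xi> y"
    note cf = autocorr_cont[OF f]
    have "mean (\<lambda>y. cnj (autocorr F y) * \<xi> y) = mean (\<lambda>y. 2 * ?h y - ?h (x0 \<otimes> y) - ?h (inv x0 \<otimes> y))"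
    proof (rule mean_cong)
      fix y assume y: "y \<in> carrier G"
      have "autocorr F y = twist (-1) x0 (autocorr f) y"
        unfolding F_def[abs_def] by (rule twist_autocorr[OF f x0(1) y, symmetric]) simp
      then have eq: "autocorr F y = 2 * autocorr f y - autocorr f (x0 \<otimes> y) - autocorr f (inv x0 \<otimes> y)"
        by (simp add: twist_def)
      have "\<xi> (x0 \<otimes> y) = \<xi> y" "\<xi> (inv x0 \<otimes> y) = \<xi> y"
        using \<xi>(2) \<xi>1 \<xi>i x0 y by auto
      then show "cnj (autocorr F y) * \<xi> y = 2 * ?h y - ?h (x0 \<otimes> y) - ?h (inv x0 \<otimes> y)"
        unfolding eq by (simp add: algebra_simps)
    qed
    also have "\<dots> = 2 * mean ?h - mean (\<lambda>y. ?h (x0 \<otimes> y)) - mean (\<lambda>y. ?h (inv x0 \<otimes> y))"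
      by (subst mean_diff mean_cmult; (intro cont_intros cf \<xi>(1) x0)?)+ simp
    also have "mean (\<lambda>y. ?h (x0 \<otimes> y)) = mean ?h"
      by (rule mean_translate; intro cont_intros cf \<xi>(1) x0)
    also have "mean (\<lambda>y. ?h (inv x0 \<otimes> y)) = mean ?h"
      by (rule mean_translate; intro cont_intros cf \<xi>(1) x0)
    finally show False using \<xi>(4) by simp
  qed
  with \<xi> show ?thesis by blast
qed

end

section \<open>Homomorphisms on the dual group are evaluations\<close>

lemma char_group_carrier_iff:
  "c \<in> carrier (char_group G T) \<longleftrightarrow> c \<in> extensional (carrier G) \<and>
     (\<forall>x\<in>carrier G. \<forall>y\<in>carrier G. c (x \<otimes>\<^bsub>G\<^esub> y) = c x * c y) \<and>
     (\<forall>x\<in>carrier G. cmod (c x) = 1) \<and> continuous_map T euclidean c"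
  if "topspace T = carrier G"
  using that by (auto simp: char_group_def hom_def circle_group_def continuous_map_in_subtopology Pi_iff)

lemma unit_complex_cnj: "cmod z = 1 \<Longrightarrow> z * cnj z = 1"
  by (simp flip: complex_norm_square)

context compact_ab_group
begin

abbreviation dual :: "('a \<Rightarrow> complex) monoid" where
  "dual \<equiv> char_group G T"

lemmas dual_iff = char_group_carrier_iff[OF topspace_T]

lemma dual_mult: "d \<in> carrier dual \<Longrightarrow> x \<in> carrier G \<Longrightarrow> y \<in> carrier G \<Longrightarrow> d (x \<otimes> y) = d x * d y"
  and dual_norm: "d \<in> carrier dual \<Longrightarrow> x \<in> carrier G \<Longrightarrow> cmod (d x) = 1"
  and dual_cont: "d \<in> carrier dual \<Longrightarrow> cont d"
  and dual_ext: "d \<in> carrier dual \<Longrightarrow> d \<in> extensional (carrier G)"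
  by (simp_all add: dual_iff)

lemma dual_one: "d \<in> carrier dual \<Longrightarrow> d \<one> = 1"
  using dual_mult[of d \<one> \<one>] dual_norm[of d \<one>] by auto

lemma dual_inv: 
  assumes "d \<in> carrier dual" "x \<in> carrier G"
  shows "d (inv x) = cnj (d x)"
proof -
  have "d x * d (inv x) = 1" using dual_mult[of d x "inv x"] assms by (simp add: dual_one)
  moreover have "d x * cnj (d x) = 1" by (rule unit_complex_cnj[OF dual_norm[OF assms]])
  moreover have "d x \<noteq> 0" using dual_norm[OF assms] by auto
  ultimately show ?thesis by (metis mult_left_cancel)
qed

lemma dual_mult_apply: "x \<in> carrier G \<Longrightarrow> (c \<otimes>\<^bsub>dual\<^esub> d) x = c x * d x"
  and dual_one_apply: "x \<in> carrier G \<Longrightarrow> \<one>\<^bsub>dual\<^esub> x = 1"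
  by (simp_all add: char_group_def)

lemma dual_mult_closed:
  assumes "c \<in> carrier dual" "d \<in> carrier dual"
  shows "c \<otimes>\<^bsub>dual\<^esub> d \<in> carrier dual"
proof -
  have "cont (\<lambda>x. c x * d x)"
    by (intro cont_intros dual_cont[OF assms(1)] dual_cont[OF assms(2)])
  then have "cont (c \<otimes>\<^bsub>dual\<^esub> d)"
    by (rule continuous_map_eq) (simp add: dual_mult_apply)
  moreover have "c \<otimes>\<^bsub>dual\<^esub> d \<in> extensional (carrier G)"
    by (simp add: char_group_def)
  ultimately show ?thesis
    using assms unfolding dual_iff[of "c \<otimes>\<^bsub>dual\<^esub> d"] by (simp add: dual_mult_apply dual_mult dual_norm norm_mult)
qed

lemma dual_eqI:
  assumes "c \<in> carrier dual" "d \<in> carrier dual" "\<And>x. x \<in> carrier G \<Longrightarrow> c x = d x"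
  shows "c = d"
  using assms by (meson dual_ext extensionalityI)

lemma dual_one_closed: "\<one>\<^bsub>dual\<^esub> \<in> carrier dual"
  unfolding dual_iff
proof (intro conjI)
  show "cont \<one>\<^bsub>dual\<^esub>"
    by (rule continuous_map_eq[OF continuous_map_constant[of _ 1]]) (simp add: dual_one_apply)
  show "\<one>\<^bsub>dual\<^esub> \<in> extensional (carrier G)" by (simp add: char_group_def)
qed (simp_all add: dual_one_apply)

lemma comm_group_dual: "comm_group dual"
proof (rule comm_groupI)
  fix c d e assume cde: "c \<in> carrier dual" "d \<in> carrier dual" "e \<in> carrier dual"
  show "c \<otimes>\<^bsub>dual\<^esub> d \<otimes>\<^bsub>dual\<^esub> e = c \<otimes>\<^bsub>dual\<^esub> (d \<otimes>\<^bsub>dual\<^esub> e)"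
    by (rule dual_eqI) (auto intro!: dual_mult_closed cde simp: dual_mult_apply)
next
  fix c d assume cd: "c \<in> carrier dual" "d \<in> carrier dual"
  show "c \<otimes>\<^bsub>dual\<^esub> d = d \<otimes>\<^bsub>dual\<^esub> c"
    by (rule dual_eqI) (auto intro!: dual_mult_closed cd simp: dual_mult_apply)
next
  fix c assume c: "c \<in> carrier dual"
  show "\<one>\<^bsub>dual\<^esub> \<otimes>\<^bsub>dual\<^esub> c = c"
    by (rule dual_eqI) (auto intro!: dual_mult_closed c dual_one_closed simp: dual_mult_apply dual_one_apply)
  let ?i = "\<lambda>x\<in>carrier G. cnj (c x)"
  have i: "?i \<in> carrier dual"
    unfolding dual_iff
  proof (intro conjI)
    have "cont (\<lambda>x. cnj (c x))" by (intro cont_intros dual_cont[OF c])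
    then show "cont ?i" by (rule continuous_map_eq) simp
  qed (use c in \<open>simp_all add: dual_mult dual_norm\<close>)
  moreover have "?i \<otimes>\<^bsub>dual\<^esub> c = \<one>\<^bsub>dual\<^esub>"
  proof (rule dual_eqI)
    fix x assume x: "x \<in> carrier G"
    show "(?i \<otimes>\<^bsub>dual\<^esub> c) x = \<one>\<^bsub>dual\<^esub> x"
      using unit_complex_cnj[OF dual_norm[OF c x]] x by (simp add: dual_mult_apply dual_one_apply mult.commute)
  qed (intro dual_mult_closed i c dual_one_closed)+
  ultimately show "\<exists>d\<in>carrier dual. d \<otimes>\<^bsub>dual\<^esub> c = \<one>\<^bsub>dual\<^esub>" by blast
qed (rule dual_one_closed dual_mult_closed; assumption?)+

lemma dual_inv_apply:
  assumes "d \<in> carrier dual" "x \<in> carrier G"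
  shows "(inv\<^bsub>dual\<^esub> d) x = cnj (d x)"
proof -
  interpret D: comm_group dual by (rule comm_group_dual)
  have "d x * (inv\<^bsub>dual\<^esub> d) x = 1"
    using arg_cong[OF D.r_inv[OF assms(1)], of "\<lambda>f. f x"] assms(2) by (simp add: dual_mult_apply dual_one_apply)
  moreover have "d x * cnj (d x) = 1" by (rule unit_complex_cnj[OF dual_norm[OF assms]])
  moreover have "d x \<noteq> 0" using dual_norm[OF assms] by auto
  ultimately show ?thesis by (metis mult_left_cancel)
qed

lemma mean_dual:
  assumes d: "d \<in> carrier dual"
  shows "mean d = (if d = \<one>\<^bsub>dual\<^esub> then 1 else 0)"
proof (cases "d = \<one>\<^bsub>dual\<^esub>")
  case True
  then have "mean d = mean (\<lambda>x. 1)" by (intro mean_cong) (simp add: dual_one_apply)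
  then show ?thesis using True by (simp add: mean_const)
next
  case False
  interpret D: comm_group dual by (rule comm_group_dual)
  obtain b where b: "b \<in> carrier G" "d b \<noteq> 1"
    using dual_eqI[OF d D.one_closed] False dual_one_apply by metis
  have "mean d = mean (\<lambda>x. d (b \<otimes> x))"
    by (rule mean_translate[OF dual_cont[OF d] b(1), symmetric])
  also have "\<dots> = mean (\<lambda>x. d b * d x)"
    by (rule mean_cong) (simp add: dual_mult[OF d b(1)])
  also have "\<dots> = d b * mean d" by (rule mean_cmult[OF dual_cont[OF d]])
  finally show ?thesis using b(2) False by simp
qed

text \<open>
  The trigonometric polynomial \<open>\<Sum> d\<close>, twisted by \<open>\<phi>\<close>. It is given by a list of characters, with
  repetitions, so that products and powers correspond to operations on lists that do not involve \<open>\<phi>\<close>.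
\<close>

definition trig :: "(('a \<Rightarrow> complex) \<Rightarrow> complex) \<Rightarrow> ('a \<Rightarrow> complex) list \<Rightarrow> 'a \<Rightarrow> complex" where
  "trig \<phi> ds x = (\<Sum>d\<leftarrow>ds. cnj (\<phi> d) * d x)"

context
  fixes \<phi> assumes \<phi>: "\<phi> \<in> hom dual circle_group"
begin

lemma dual_hom_norm: "d \<in> carrier dual \<Longrightarrow> cmod (\<phi> d) = 1"
  using hom_in_carrier[OF \<phi>] by (simp add: circle_group_def)

lemma dual_hom_mult: "d \<in> carrier dual \<Longrightarrow> e \<in> carrier dual \<Longrightarrow> \<phi> (d \<otimes>\<^bsub>dual\<^esub> e) = \<phi> d * \<phi> e"
  using hom_mult[OF \<phi>] by (simp add: circle_group_def)

lemma dual_hom_one: "\<phi> \<one>\<^bsub>dual\<^esub> = 1"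
proof -
  interpret D: comm_group dual by (rule comm_group_dual)
  show ?thesis
    using dual_hom_mult[of "\<one>\<^bsub>dual\<^esub>" "\<one>\<^bsub>dual\<^esub>"] dual_hom_norm[of "\<one>\<^bsub>dual\<^esub>"] by auto
qed

lemma dual_hom_inv:
  assumes d: "d \<in> carrier dual"
  shows "\<phi> (inv\<^bsub>dual\<^esub> d) = cnj (\<phi> d)"
proof -
  interpret D: comm_group dual by (rule comm_group_dual)
  have "\<phi> d * \<phi> (inv\<^bsub>dual\<^esub> d) = 1"
    using dual_hom_mult[OF d D.inv_closed[OF d]] d dual_hom_one by simp
  moreover have "\<phi> d * cnj (\<phi> d) = 1" by (rule unit_complex_cnj[OF dual_hom_norm[OF d]])
  moreover have "\<phi> d \<noteq> 0" using dual_hom_norm[OF d] by auto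
  ultimately show ?thesis by (metis mult_left_cancel)
qed

end

lemma trig_cont:
  assumes "set ds \<subseteq> carrier dual"
  shows "cont (trig \<phi> ds)"
  using assms
proof (induction ds)
  case Nil
  then show ?case by (simp add: trig_def[abs_def])
next
  case (Cons d ds)
  then have d: "d \<in> carrier dual" and IH: "cont (trig \<phi> ds)" by auto
  have "cont (\<lambda>x. cnj (\<phi> d) * d x + trig \<phi> ds x)"
    by (intro cont_intros dual_cont[OF d] IH)
  then show ?case by (simp add: trig_def[abs_def])
qed

lemma trig_mult:
  assumes ds: "set ds \<subseteq> carrier dual" and es: "set es \<subseteq> carrier dual"
  shows "\<exists>fs. set fs \<subseteq> carrier dual \<and>
    (\<forall>\<phi>\<in>hom dual circle_group. \<forall>x\<in>carrier G. trig \<phi> fs x = trig \<phi> ds x * trig \<phi> es x)"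
proof -
  let ?fs = "concat (map (\<lambda>d. map (\<lambda>e. d \<otimes>\<^bsub>dual\<^esub> e) es) ds)"
  have "set ?fs \<subseteq> carrier dual" using ds es by (auto intro!: dual_mult_closed)
  moreover have "trig \<phi> ?fs x = trig \<phi> ds x * trig \<phi> es x"
    if \<phi>: "\<phi> \<in> hom dual circle_group" and x: "x \<in> carrier G" for \<phi> x
    using ds
  proof (induction ds)
    case Nil
    then show ?case by (simp add: trig_def)
  next
    case (Cons d ds)
    have "(\<Sum>e\<leftarrow>es. cnj (\<phi> (d \<otimes>\<^bsub>dual\<^esub> e)) * (d \<otimes>\<^bsub>dual\<^esub> e) x) = cnj (\<phi> d) * d x * trig \<phi> es x"
      using es
    proof (induction es)
      case Nil
      then show ?case by (simp add: trig_def)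
    next
      case (Cons e es)
      have "\<phi> (d \<otimes>\<^bsub>dual\<^esub> e) = \<phi> d * \<phi> e"
        using Cons.prems \<open>set (d # ds) \<subseteq> carrier dual\<close> by (simp add: dual_hom_mult[OF \<phi>])
      with Cons x show ?case by (simp add: trig_def dual_mult_apply algebra_simps)
    qed
    moreover have "trig \<phi> (concat (map (\<lambda>d. map (\<lambda>e. d \<otimes>\<^bsub>dual\<^esub> e) es) ds)) x = trig \<phi> ds x * trig \<phi> es x"
      using Cons by simp
    ultimately show ?case by (simp add: trig_def algebra_simps o_def)
  qed
  ultimately show ?thesis by (intro exI[of _ ?fs]) simp
qed

lemma trig_power:
  assumes ds: "set ds \<subseteq> carrier dual"
  shows "\<exists>fs. set fs \<subseteq> carrier dual \<and>
    (\<forall>\<phi>\<in>hom dual circle_group. \<forall>x\<in>carrier G. trig \<phi> fs x = trig \<phi> ds x ^ m)"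
proof (induction m)
  case 0
  show ?case
    by (intro exI[of _ "[\<one>\<^bsub>dual\<^esub>]"]) (simp add: trig_def dual_one_apply dual_one_closed dual_hom_one)
next
  case (Suc m)
  then obtain fs where fs: "set fs \<subseteq> carrier dual"
    "\<forall>\<phi>\<in>hom dual circle_group. \<forall>x\<in>carrier G. trig \<phi> fs x = trig \<phi> ds x ^ m" by blast
  from trig_mult[OF ds fs(1)] fs(2) show ?case by simp
qed

text \<open>Only the trivial character has non-zero mean, and every homomorphism is 1 there.\<close>

lemma mean_trig:
  assumes "\<phi> \<in> hom dual circle_group" "\<phi>' \<in> hom dual circle_group" "set ds \<subseteq> carrier dual"
  shows "mean (trig \<phi> ds) = mean (trig \<phi>' ds)"
proof -
  show ?thesis
    using assms(3)
  proof (induction ds)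
    case Nil
    then show ?case by (simp add: trig_def[abs_def])
  next
    case (Cons d ds)
    then have d: "d \<in> carrier dual" and ds: "set ds \<subseteq> carrier dual" by auto
    have *: "mean (trig \<phi> (d # ds)) = cnj (\<phi> d) * mean d + mean (trig \<phi> ds)" for \<phi>
    proof -
      have "mean (trig \<phi> (d # ds)) = mean (\<lambda>x. cnj (\<phi> d) * d x + trig \<phi> ds x)"
        by (simp add: trig_def[abs_def])
      also have "\<dots> = mean (\<lambda>x. cnj (\<phi> d) * d x) + mean (trig \<phi> ds)"
        by (rule mean_add; intro cont_intros dual_cont[OF d] trig_cont[OF ds])
      also have "mean (\<lambda>x. cnj (\<phi> d) * d x) = cnj (\<phi> d) * mean d"
        by (rule mean_cmult[OF dual_cont[OF d]])
      finally show ?thesis .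
    qed
    show ?case
      using Cons.IH[OF ds] dual_hom_one[OF assms(1)] dual_hom_one[OF assms(2)]
      by (simp add: * mean_dual[OF d])
  qed
qed

text \<open>
  For every \<open>d\<close> in the list add the real function \<open>2 + 2 * Re (cnj (\<phi> d) * d x)\<close>, which lies between 0
  and 4 and is 4 only where \<open>d x = \<phi> d\<close>. If the sum \<open>R \<phi>\<close> never attained its bound \<open>M\<close>, it would stay
  below some \<open>r0 < M\<close>, and the mean of \<open>(R \<phi>)^m\<close> would be at most \<open>r0^m\<close>. But this is also the mean of
  the \<open>m\<close>-th power of the untwisted sum, which is \<open>M\<close> at \<open>\<one>\<close> and larger than some \<open>r > r0\<close> on an open
  set; so it is at least \<open>C * r^m\<close> with \<open>C\<close> independent of \<open>m\<close>.
\<close>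

lemma finite_interpolation:
  assumes \<phi>: "\<phi> \<in> hom dual circle_group" and F: "set F \<subseteq> carrier dual"
  shows "\<exists>x\<in>carrier G. \<forall>d\<in>set F. d x = \<phi> d"
proof (rule ccontr)
  interpret D: comm_group dual by (rule comm_group_dual)
  assume no: "\<not> (\<exists>x\<in>carrier G. \<forall>d\<in>set F. d x = \<phi> d)"
  define \<phi>' where "\<phi>' = (\<lambda>d::'a \<Rightarrow> complex. 1::complex)"
  have \<phi>': "\<phi>' \<in> hom dual circle_group" by (auto simp: hom_def \<phi>'_def circle_group_def)
  \<comment> \<open>The four characters for each \<open>d\<close> produce the summand \<open>2 + 2 * Re (cnj (\<phi> d) * d x)\<close>.\<close>
  define ds where "ds = concat (map (\<lambda>d. [\<one>\<^bsub>dual\<^esub>, \<one>\<^bsub>dual\<^esub>, d, inv\<^bsub>dual\<^esub> d]) F)"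
  have ds: "set ds \<subseteq> carrier dual" using F by (auto simp: ds_def)
  define R where "R \<phi> x = (\<Sum>d\<leftarrow>F. 2 + 2 * Re (cnj (\<phi> d) * d x))" for \<phi> :: "('a \<Rightarrow> complex) \<Rightarrow> complex" and x
  have trig_R: "trig \<phi> ds x = of_real (R \<phi> x)" if \<phi>: "\<phi> \<in> hom dual circle_group" and x: "x \<in> carrier G" for \<phi> x
  proof -
    show ?thesis
      using F unfolding ds_def R_def
    proof (induction F)
      case Nil
      then show ?case by (simp add: trig_def)
    next
      case (Cons d F)
      then have d: "d \<in> carrier dual" by simp
      have "trig \<phi> (concat (map (\<lambda>d. [\<one>\<^bsub>dual\<^esub>, \<one>\<^bsub>dual\<^esub>, d, inv\<^bsub>dual\<^esub> d]) F)) x = of_real (\<Sum>d\<leftarrow>F. 2 + 2 * Re (cnj (\<phi> d) * d x))"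
        using Cons by simp
      moreover have "1 + (1 + (cnj (\<phi> d) * d x + cnj (\<phi> (inv\<^bsub>dual\<^esub> d)) * (inv\<^bsub>dual\<^esub> d) x)) = of_real (2 + 2 * Re (cnj (\<phi> d) * d x))"
        using d x by (simp add: dual_hom_inv[OF \<phi>] dual_inv_apply complex_eq_iff)
      ultimately show ?case
        by (simp add: trig_def dual_hom_one[OF \<phi>] dual_one_apply[OF x] add.assoc[symmetric])
    qed
  qed
  have unit: "cmod (cnj (\<phi> d) * d x) = 1" if "d \<in> set F" "x \<in> carrier G" for d x
    using dual_hom_norm[OF \<phi>, of d] dual_norm[of d x] F that by (auto simp: norm_mult)
  have R_nonneg: "0 \<le> R \<phi> x" if \<phi>: "\<phi> \<in> hom dual circle_group" and x: "x \<in> carrier G" for \<phi> x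
    unfolding R_def
  proof (rule sum_list_nonneg)
    fix r assume "r \<in> set (map (\<lambda>d. 2 + 2 * Re (cnj (\<phi> d) * d x)) F)"
    then obtain d where d: "d \<in> set F" and r: "r = 2 + 2 * Re (cnj (\<phi> d) * d x)" by auto
    have "cmod (cnj (\<phi> d) * d x) = 1"
      using dual_hom_norm[OF \<phi>, of d] dual_norm[of d x] F d x by (auto simp: norm_mult)
    then show "0 \<le> r" unfolding r using abs_Re_le_cmod[of "cnj (\<phi> d) * d x"] by linarith
  qed
  define M where "M = 4 * real (length F)"
  have R_one: "R \<phi>' \<one> = M"
    unfolding R_def M_def using F by (induction F) (auto simp: \<phi>'_def dual_one)
  have R_less: "R \<phi> x < M" if x: "x \<in> carrier G" for x
  proof -
    obtain d where d: "d \<in> set F" "d x \<noteq> \<phi> d" using no x by blast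
    obtain l r where lr: "F = l @ d # r" using split_list[OF d(1)] by blast
    have le: "Re (cnj (\<phi> e) * e x) \<le> 1" if "e \<in> set F" for e
      using complex_Re_le_cmod[of "cnj (\<phi> e) * e x"] unit[OF that x] by simp
    have sum_le: "(\<Sum>d\<leftarrow>xs. 2 + 2 * Re (cnj (\<phi> d) * d x)) \<le> 4 * real (length xs)" if "set xs \<subseteq> set F" for xs
      using that
    proof (induction xs)
      case (Cons e xs)
      then have "Re (cnj (\<phi> e) * e x) \<le> 1" by (intro le) simp
      with Cons show ?case by simp
    qed simp
    have "Re (cnj (\<phi> d) * d x) \<noteq> 1"
    proof
      let ?z = "cnj (\<phi> d) * d x"
      assume "Re ?z = 1"
      moreover have "(Re ?z)^2 + (Im ?z)^2 = 1" using unit[OF d(1) x] by (metis cmod_power2 one_power2)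
      ultimately have "Re ?z = 1" "Im ?z = 0" by simp_all
      then have "?z = 1" by (simp only: complex_eq_iff one_complex.simps)
      moreover have "\<phi> d * cnj (\<phi> d) = 1"
        using F d(1) by (intro unit_complex_cnj dual_hom_norm[OF \<phi>]) auto
      ultimately have "d x = \<phi> d" by (metis mult.assoc mult.right_neutral mult_1)
      with d(2) show False by simp
    qed
    then have "2 + 2 * Re (cnj (\<phi> d) * d x) < 4" using le[OF d(1)] by simp
    moreover have "set l \<subseteq> set F" "set r \<subseteq> set F" using lr by auto
    ultimately show ?thesis
      using sum_le[of l] sum_le[of r] by (simp add: R_def M_def lr)
  qed
  have trig_ds_cont: "cont (trig \<phi> ds)" for \<phi> by (rule trig_cont[OF ds])
  have R_cont: "cont (R \<phi>)" if "\<phi> \<in> hom dual circle_group" for \<phi>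
  proof (rule continuous_map_eq)
    show "cont (Re \<circ> trig \<phi> ds)"
      by (rule continuous_map_compose[OF trig_ds_cont]) (auto intro: continuous_on_Re continuous_on_id)
    show "(Re \<circ> trig \<phi> ds) x = R \<phi> x" if "x \<in> topspace T" for x
      using trig_R[OF \<open>\<phi> \<in> hom dual circle_group\<close>] that by simp
  qed
  have "compact (R \<phi> ` carrier G)"
    using image_compactin[OF _ R_cont[OF \<phi>], of "carrier G"] compact by (simp add: compact_space_def)
  then obtain r0 where r0: "r0 \<in> R \<phi> ` carrier G" "\<forall>r\<in>R \<phi> ` carrier G. r \<le> r0"
    using compact_attains_sup[of "R \<phi> ` carrier G"] one_closed by blast
  have "0 \<le> r0" "r0 < M" using r0(1) R_nonneg[OF \<phi>] R_less by auto
  define r where "r = (r0 + M) / 2"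
  have r: "0 < r" "r0 < r" "r < M" using \<open>0 \<le> r0\<close> \<open>r0 < M\<close> by (auto simp: r_def)
  let ?U = "{x \<in> topspace T. R \<phi>' x \<in> {r<..}}"
  have U: "openin T ?U" "\<one> \<in> ?U"
    using openin_continuous_map_preimage[OF R_cont[OF \<phi>'], of "{r<..}"] R_one r by auto
  obtain C where C: "C > 0" "\<forall>f d. cont f \<longrightarrow> (\<forall>x\<in>carrier G. 0 \<le> Re (f x)) \<longrightarrow>
       (\<forall>x\<in>?U. d \<le> Re (f x)) \<longrightarrow> C * d \<le> Re (mean f)"
    using mean_lower_bound[OF U] by blast
  have "C \<le> (r0 / r) ^ m" for m
  proof -
    obtain fs where fs: "set fs \<subseteq> carrier dual"
      "\<forall>\<phi>\<in>hom dual circle_group. \<forall>x\<in>carrier G. trig \<phi> fs x = trig \<phi> ds x ^ m"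
      using trig_power[OF ds] by blast
    have fs_R: "trig \<phi> fs x = of_real (R \<phi> x ^ m)" if "\<phi> \<in> hom dual circle_group" "x \<in> carrier G" for \<phi> x
      using fs(2) trig_R[OF that] that by simp
    have "C * r ^ m \<le> Re (mean (trig \<phi>' fs))"
    proof (rule C(2)[rule_format, OF trig_cont[OF fs(1)]])
      show "0 \<le> Re (trig \<phi>' fs x)" if "x \<in> carrier G" for x
        using fs_R[OF \<phi>' that] R_nonneg[OF \<phi>' that] by simp
      show "r ^ m \<le> Re (trig \<phi>' fs x)" if "x \<in> ?U" for x
        using fs_R[OF \<phi>', of x] that r by (auto intro!: power_mono)
    qed
    also have "mean (trig \<phi>' fs) = mean (trig \<phi> fs)" by (rule mean_trig[OF \<phi>' \<phi> fs(1)])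
    also have "Re (mean (trig \<phi> fs)) \<le> r0 ^ m"
    proof -
      have "cmod (mean (trig \<phi> fs)) \<le> r0 ^ m"
      proof (rule norm_mean_le[OF trig_cont[OF fs(1)]])
        fix x assume x: "x \<in> carrier G"
        have "R \<phi> x ^ m \<le> r0 ^ m" using r0(2) x R_nonneg[OF \<phi> x] by (intro power_mono) auto
        then show "cmod (trig \<phi> fs x) \<le> r0 ^ m"
          using R_nonneg[OF \<phi> x] by (simp add: fs_R[OF \<phi> x] norm_power)
      qed
      then show ?thesis using complex_Re_le_cmod[of "mean (trig \<phi> fs)"] by linarith
    qed
    finally show ?thesis using r by (simp add: power_divide field_simps)
  qed
  moreover have "(\<lambda>m. (r0 / r) ^ m) \<longlonglongrightarrow> 0"
    using r \<open>0 \<le> r0\<close> by (intro LIMSEQ_realpow_zero) auto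
  ultimately have "C \<le> 0" by (intro LIMSEQ_le_const) auto
  with C(1) show False by simp
qed

text \<open>The closed sets \<open>{x. d x = \<phi> d}\<close> have the finite intersection property by \<open>finite_interpolation\<close>.\<close>

theorem dual_homomorphism_is_evaluation:
  assumes \<phi>: "\<phi> \<in> hom dual circle_group"
  shows "\<exists>x\<in>carrier G. \<forall>d\<in>carrier dual. d x = \<phi> d"
proof -
  let ?E = "\<lambda>d. {x \<in> topspace T. d x \<in> {\<phi> d}}"
  have closed: "closedin T (?E d)" if "d \<in> carrier dual" for d
    by (rule closedin_continuous_map_preimage[OF dual_cont[OF that]]) simp
  have "\<Inter>(insert (topspace T) (?E ` carrier dual)) \<noteq> {}"
  proof (rule compact[unfolded compact_space_fip, rule_format], intro conjI allI ballI impI)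
    fix C assume "C \<in> insert (topspace T) (?E ` carrier dual)"
    then show "closedin T C" using closed closedin_topspace[of T] by blast
  next
    fix \<F> assume \<F>: "finite \<F> \<and> \<F> \<subseteq> insert (topspace T) (?E ` carrier dual)"
    then have "finite (\<F> - {topspace T})" "\<F> - {topspace T} \<subseteq> ?E ` carrier dual" by auto
    from finite_subset_image[OF this]
    obtain F where F: "finite F" "F \<subseteq> carrier dual" "\<F> - {topspace T} = ?E ` F"
      by blast
    obtain xs where xs: "set xs = F" using finite_list[OF F(1)] by blast
    obtain x where x: "x \<in> carrier G" "\<forall>d\<in>set xs. d x = \<phi> d"
      using finite_interpolation[OF \<phi>, of xs] F(2) xs by blast
    have "x \<in> C" if "C \<in> \<F>" for C
    proof (cases "C = topspace T")
      case False
      then have "C \<in> ?E ` F" using F(3) that by blast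
      then show ?thesis using x xs by auto
    qed (use x in simp)
    then show "\<Inter>\<F> \<noteq> {}" by blast
  qed
  then obtain x where "x \<in> topspace T" "\<forall>d\<in>carrier dual. x \<in> ?E d" by auto
  then show ?thesis by auto
qed

end

section \<open>The universal property of the finest topology\<close>

lemma circle_carrier [simp]: "z \<in> carrier circle_group \<longleftrightarrow> cmod z = 1"
  and circle_mult [simp]: "z \<otimes>\<^bsub>circle_group\<^esub> w = z * w"
  and circle_one [simp]: "\<one>\<^bsub>circle_group\<^esub> = 1"
  by (simp_all add: circle_group_def)

lemma comm_group_circle: "comm_group circle_group"
proof (rule comm_groupI)
  fix z assume "z \<in> carrier circle_group"
  then show "\<exists>w\<in>carrier circle_group. w \<otimes>\<^bsub>circle_group\<^esub> z = \<one>\<^bsub>circle_group\<^esub>"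
    using unit_complex_cnj[of z] by (intro bexI[of _ "cnj z"]) (simp_all add: mult.commute)
qed (simp_all add: norm_mult)

lemma circle_inv: "cmod z = 1 \<Longrightarrow> inv\<^bsub>circle_group\<^esub> z = cnj z"
proof -
  interpret comm_group circle_group by (rule comm_group_circle)
  show "cmod z = 1 \<Longrightarrow> inv\<^bsub>circle_group\<^esub> z = cnj z"
    using unit_complex_cnj[of z] by (intro inv_equality) (simp_all add: mult.commute)
qed

lemma topological_ab_group_circle: "topological_ab_group circle_group circle_topology"
proof -
  let ?P = "prod_topology circle_topology circle_topology"
  have id: "continuous_map circle_topology euclidean (\<lambda>z. z)" by (simp add: continuous_map_from_subtopology)
  have "continuous_map ?P euclidean (\<lambda>p. fst p * snd p)"
    by (intro continuous_map_complex_mult) (auto intro!: continuous_on_fst continuous_on_snd continuous_on_id)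
  then have "continuous_map ?P circle_topology (\<lambda>p. fst p * snd p)"
    by (auto simp: continuous_map_in_subtopology norm_mult)
  moreover have "continuous_map circle_topology circle_topology cnj"
    using continuous_map_cnj[OF id] by (auto simp: continuous_map_in_subtopology)
  then have "continuous_map circle_topology circle_topology (\<lambda>z. inv\<^bsub>circle_group\<^esub> z)"
    by (rule continuous_map_eq) (simp add: circle_inv)
  ultimately show ?thesis
    using comm_group_circle by (simp add: topological_ab_group_def case_prod_unfold circle_group_def)
qed

lemma null_seq_carrier: "z \<in> carrier null_seq_group \<longleftrightarrow> (\<forall>n. cmod (z n) = 1) \<and> z \<longlonglongrightarrow> 1"
  and null_seq_mult [simp]: "(z \<otimes>\<^bsub>null_seq_group\<^esub> w) = (\<lambda>n. z n * w n)"
  and null_seq_one [simp]: "\<one>\<^bsub>null_seq_group\<^esub> = (\<lambda>n. 1)"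
  by (simp_all add: null_seq_group_def)

lemma null_seq_mult_closed:
  assumes "z \<in> carrier null_seq_group" "w \<in> carrier null_seq_group"
  shows "(\<lambda>n. z n * w n) \<in> carrier null_seq_group"
  using assms tendsto_mult[of z 1 sequentially w 1] by (simp add: null_seq_carrier norm_mult)

lemma null_seq_cnj_closed:
  assumes "z \<in> carrier null_seq_group"
  shows "(\<lambda>n. cnj (z n)) \<in> carrier null_seq_group"
  using assms tendsto_cnj[of z 1 sequentially] by (simp add: null_seq_carrier)

lemma comm_group_null_seq: "comm_group null_seq_group"
proof (rule comm_groupI)
  show "\<one>\<^bsub>null_seq_group\<^esub> \<in> carrier null_seq_group" by (simp add: null_seq_carrier)
  fix z assume z: "z \<in> carrier null_seq_group"
  have "cnj (z n) * z n = 1" for n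
    using z unit_complex_cnj[of "z n"] by (simp add: null_seq_carrier mult.commute)
  then show "\<exists>w\<in>carrier null_seq_group. w \<otimes>\<^bsub>null_seq_group\<^esub> z = \<one>\<^bsub>null_seq_group\<^esub>"
    by (intro bexI[OF _ null_seq_cnj_closed[OF z]]) simp
qed (simp_all add: null_seq_mult_closed fun_eq_iff)

lemma null_seq_inv: "z \<in> carrier null_seq_group \<Longrightarrow> inv\<^bsub>null_seq_group\<^esub> z = (\<lambda>n. cnj (z n))"
proof -
  interpret comm_group null_seq_group by (rule comm_group_null_seq)
  assume z: "z \<in> carrier null_seq_group"
  have "cnj (z n) * z n = 1" for n
    using z unit_complex_cnj[of "z n"] by (simp add: null_seq_carrier mult.commute)
  then show ?thesis using z null_seq_cnj_closed[OF z] by (intro inv_equality) simp_all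
qed

lemma null_seq_dist_le_iff:
  assumes "z \<in> carrier null_seq_group" "w \<in> carrier null_seq_group"
  shows "null_seq_dist z w \<le> B \<longleftrightarrow> (\<forall>n. cmod (z n - w n) \<le> B)"
proof -
  have bd: "bdd_above (range (\<lambda>n. cmod (z n - w n)))"
  proof (rule bdd_aboveI2)
    fix n
    show "cmod (z n - w n) \<le> 2"
      using assms norm_triangle_ineq4[of "z n" "w n"] by (simp add: null_seq_carrier)
  qed
  show ?thesis
    using assms by (auto simp: null_seq_dist_def cSUP_le_iff[OF _ bd])
qed

lemma null_seq_dist_nth_le:
  assumes "z \<in> carrier null_seq_group" "w \<in> carrier null_seq_group"
  shows "cmod (z n - w n) \<le> null_seq_dist z w"
  using null_seq_dist_le_iff[OF assms, of "null_seq_dist z w"] by simp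

lemma topspace_null_seq [simp]: "topspace null_seq_topology = carrier null_seq_group"
  unfolding null_seq_topology_def by (rule Metric_space.topspace_mtopology[OF Metric_space_null_seq])

lemma topological_ab_group_null_seq: "topological_ab_group null_seq_group null_seq_topology"
proof -
  interpret N: Metric_space "carrier null_seq_group" null_seq_dist by (rule Metric_space_null_seq)
  have top: "null_seq_topology = N.mtopology" by (simp add: null_seq_topology_def)
  have "continuous_map (prod_topology N.mtopology N.mtopology) N.mtopology (\<lambda>p. fst p \<otimes>\<^bsub>null_seq_group\<^esub> snd p)"
    unfolding N.continuous_map_to_metric
  proof (intro ballI allI impI)
    fix p \<epsilon> assume p: "p \<in> topspace (prod_topology N.mtopology N.mtopology)" and "(\<epsilon>::real) > 0"
    obtain z w where zw: "p = (z, w)" "z \<in> carrier null_seq_group" "w \<in> carrier null_seq_group"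
      using p by (cases p) auto
    let ?U = "N.mball z (\<epsilon>/3) \<times> N.mball w (\<epsilon>/3)"
    have "fst q \<otimes>\<^bsub>null_seq_group\<^esub> snd q \<in> N.mball (fst p \<otimes>\<^bsub>null_seq_group\<^esub> snd p) \<epsilon>" if q: "q \<in> ?U" for q
    proof -
      obtain z' w' where q': "q = (z', w')" "z' \<in> carrier null_seq_group" "w' \<in> carrier null_seq_group"
        and d: "null_seq_dist z z' < \<epsilon>/3" "null_seq_dist w w' < \<epsilon>/3"
        using q by (cases q) auto
      have "cmod (z n * w n - z' n * w' n) \<le> 2 * \<epsilon> / 3" for n
      proof -
        have "z n * w n - z' n * w' n = (z n - z' n) * w n + z' n * (w n - w' n)"
          by (simp add: algebra_simps)
        also have "cmod \<dots> \<le> cmod (z n - z' n) * cmod (w n) + cmod (z' n) * cmod (w n - w' n)"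
          by (metis norm_mult norm_triangle_ineq)
        also have "\<dots> = cmod (z n - z' n) + cmod (w n - w' n)"
          using zw q' by (simp add: null_seq_carrier)
        finally show ?thesis
          using null_seq_dist_nth_le[OF zw(2) q'(2), of n] null_seq_dist_nth_le[OF zw(3) q'(3), of n] d by simp
      qed
      then have "null_seq_dist (\<lambda>n. z n * w n) (\<lambda>n. z' n * w' n) \<le> 2 * \<epsilon> / 3"
        using zw q' by (subst null_seq_dist_le_iff) (auto intro: null_seq_mult_closed)
      then show ?thesis
        using zw q' \<open>\<epsilon> > 0\<close> by (simp add: null_seq_mult_closed)
    qed
    moreover have "openin (prod_topology N.mtopology N.mtopology) ?U"
      by (simp add: openin_prod_Times_iff)
    moreover have "p \<in> ?U" using zw \<open>\<epsilon> > 0\<close> by simp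
    ultimately show "\<exists>U. openin (prod_topology N.mtopology N.mtopology) U \<and> p \<in> U \<and>
        (\<forall>q\<in>U. fst q \<otimes>\<^bsub>null_seq_group\<^esub> snd q \<in> N.mball (fst p \<otimes>\<^bsub>null_seq_group\<^esub> snd p) \<epsilon>)"
      by blast
  qed
  moreover have "continuous_map N.mtopology N.mtopology (\<lambda>z n. cnj (z n))"
    unfolding N.continuous_map_to_metric
  proof (intro ballI allI impI)
    fix z \<epsilon> assume "z \<in> topspace N.mtopology" and "(\<epsilon>::real) > 0"
    then have z: "z \<in> carrier null_seq_group" by simp
    have "(\<lambda>n. cnj (w n)) \<in> N.mball (\<lambda>n. cnj (z n)) \<epsilon>" if "w \<in> N.mball z \<epsilon>" for w
    proof -
      have w: "w \<in> carrier null_seq_group" "null_seq_dist z w < \<epsilon>" using that by auto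
      have "cmod (cnj (z n) - cnj (w n)) \<le> null_seq_dist z w" for n
        using null_seq_dist_nth_le[OF z w(1), of n] by (simp flip: complex_cnj_diff)
      then have "null_seq_dist (\<lambda>n. cnj (z n)) (\<lambda>n. cnj (w n)) \<le> null_seq_dist z w"
        using z w by (subst null_seq_dist_le_iff) (auto intro: null_seq_cnj_closed)
      then show ?thesis using w z by (simp add: null_seq_cnj_closed)
    qed
    then show "\<exists>U. openin N.mtopology U \<and> z \<in> U \<and> (\<forall>w\<in>U. (\<lambda>n. cnj (w n)) \<in> N.mball (\<lambda>n. cnj (z n)) \<epsilon>)"
      using z \<open>\<epsilon> > 0\<close> by (intro exI[of _ "N.mball z \<epsilon>"]) simp
  qed
  then have "continuous_map N.mtopology N.mtopology (\<lambda>z. inv\<^bsub>null_seq_group\<^esub> z)"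
    by (rule continuous_map_eq) (simp add: null_seq_inv)
  ultimately show ?thesis
    using comm_group_null_seq
    by (simp add: topological_ab_group_def top case_prod_unfold del: null_seq_mult)
qed

lemma topological_ab_group_pullback:
  assumes K: "comm_group K" and S: "topological_ab_group H S" and h: "h \<in> hom K H"
  shows "topological_ab_group K (pullback_topology (carrier K) h S)"
proof -
  interpret K: comm_group K by (rule K)
  interpret H: comm_group H using S by (simp add: topological_ab_group_def)
  interpret h: group_hom K H h using h by unfold_locales
  let ?P = "pullback_topology (carrier K) h S"
  have topH: "topspace S = carrier H" and multH: "continuous_map (prod_topology S S) S (\<lambda>(x, y). x \<otimes>\<^bsub>H\<^esub> y)"
    and invH: "continuous_map S S (\<lambda>x. inv\<^bsub>H\<^esub> x)"
    using S by (auto simp: topological_ab_group_def)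
  have topP: "topspace ?P = carrier K"
    using hom_in_carrier[OF h] by (auto simp: topspace_pullback_topology topH)
  have cont_h: "continuous_map ?P S h"
  proof -
    have "continuous_map ?P S (id \<circ> h)" by (rule continuous_map_pullback) simp
    then show ?thesis by simp
  qed
  have "continuous_map (prod_topology ?P ?P) ?P (\<lambda>p. fst p \<otimes>\<^bsub>K\<^esub> snd p)"
  proof (rule continuous_map_pullback')
    have "continuous_map (prod_topology ?P ?P) (prod_topology S S) (\<lambda>p. (h (fst p), h (snd p)))"
      using continuous_map_compose[OF continuous_map_fst cont_h] continuous_map_compose[OF continuous_map_snd cont_h]
      by (intro continuous_map_pairedI) (auto simp: o_def)
    from continuous_map_compose[OF this multH]
    have "continuous_map (prod_topology ?P ?P) S (\<lambda>p. h (fst p) \<otimes>\<^bsub>H\<^esub> h (snd p))"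
      by (simp add: o_def)
    then show "continuous_map (prod_topology ?P ?P) S (h \<circ> (\<lambda>p. fst p \<otimes>\<^bsub>K\<^esub> snd p))"
      by (rule continuous_map_eq) (auto simp: topP)
  qed (auto simp: topP)
  moreover have "continuous_map ?P ?P (\<lambda>x. inv\<^bsub>K\<^esub> x)"
  proof (rule continuous_map_pullback')
    have "continuous_map ?P S (\<lambda>x. inv\<^bsub>H\<^esub> h x)"
      using continuous_map_compose[OF cont_h invH] by (simp add: o_def)
    then show "continuous_map ?P S (h \<circ> (\<lambda>x. inv\<^bsub>K\<^esub> x))"
      by (rule continuous_map_eq) (auto simp: topP)
  qed (auto simp: topP)
  ultimately show ?thesis using K topP by (simp add: topological_ab_group_def case_prod_unfold)
qed

text \<open>The pullback of \<open>S\<close> is a group topology in which \<open>u\<close> tends to the identity, so the finest one contains its open sets.\<close>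

lemma finest_topology_hom_continuous:
  assumes K: "T_sequence K u" and S: "topological_ab_group H S" and h: "h \<in> hom K H"
    and lim: "limitin S (\<lambda>n. h (u n)) \<one>\<^bsub>H\<^esub> sequentially"
  shows "continuous_map (finest_topology K u) S h"
proof -
  let ?P = "pullback_topology (carrier K) h S"
  have top: "topspace (finest_topology K u) = carrier K" and "comm_group K"
    using finest_topology_group_topology(1)[OF K] by (auto simp: topological_ab_group_def)
  interpret K: comm_group K by fact
  interpret H: comm_group H using S by (simp add: topological_ab_group_def)
  interpret h: group_hom K H h using h by unfold_locales
  have topH: "topspace S = carrier H" using S by (simp add: topological_ab_group_def)
  have u: "u n \<in> carrier K" for n using K by (auto simp: T_sequence_def)
  have P: "topological_ab_group K ?P" by (rule topological_ab_group_pullback[OF \<open>comm_group K\<close> S h])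
  have "limitin ?P u \<one>\<^bsub>K\<^esub> sequentially"
    unfolding limitin_def
  proof (intro conjI allI impI)
    show "\<one>\<^bsub>K\<^esub> \<in> topspace ?P" using P by (simp add: topological_ab_group_def)
    fix U assume "openin ?P U \<and> \<one>\<^bsub>K\<^esub> \<in> U"
    then obtain V where V: "openin S V" "U = h -` V \<inter> carrier K" "\<one>\<^bsub>K\<^esub> \<in> U"
      by (auto simp: openin_pullback_topology)
    then have "\<one>\<^bsub>H\<^esub> \<in> V" by auto
    then have "\<forall>\<^sub>F n in sequentially. h (u n) \<in> V" using lim V(1) by (auto simp: limitin_def)
    then show "\<forall>\<^sub>F n in sequentially. u n \<in> U" using u V(2) by (auto elim: eventually_mono)
  qed
  then have "openin (finest_topology K u) (h -` V \<inter> carrier K)" if "openin S V" for V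
    by (rule finest_topology_finest[OF P]) (use that in \<open>auto simp: openin_pullback_topology\<close>)
  then show ?thesis
    unfolding continuous_map_alt top using hom_in_carrier[OF h] by (auto simp: topH)
qed

section \<open>The dual of the T-sequence topology\<close>

locale T_sequence_of_characters = compact_ab_group G T for G :: "('a, 'm) monoid_scheme" (structure) and T +
  fixes u
  assumes metrizable: "metrizable_space T" and T_seq: "T_sequence dual u"
begin

abbreviation F where "F \<equiv> finest_topology dual u"

abbreviation bidual where "bidual \<equiv> char_group dual F"

abbreviation orbit :: "'a \<Rightarrow> nat \<Rightarrow> complex" where "orbit g \<equiv> (\<lambda>n. u n g)"

lemma u_dual: "u n \<in> carrier dual"
  using T_seq by (auto simp: T_sequence_def)

lemma F_group: "topological_ab_group dual F" and u_lim: "limitin F u \<one>\<^bsub>dual\<^esub> sequentially"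
  using finest_topology_group_topology[OF T_seq] by auto

lemma topspace_F [simp]: "topspace F = carrier dual"
  using F_group by (simp add: topological_ab_group_def)

lemmas bidual_iff = char_group_carrier_iff[OF topspace_F]

lemma Hausdorff: "Hausdorff_space T"
  by (rule metrizable_imp_Hausdorff_space[OF metrizable])

lemma dual_separates:
  assumes x: "x \<in> carrier G" and y: "y \<in> carrier G" and eq: "\<And>d. d \<in> carrier dual \<Longrightarrow> d x = d y"
  shows "x = y"
proof (rule ccontr)
  assume "x \<noteq> y"
  let ?z = "x \<otimes> inv y"
  have "?z \<noteq> \<one>"
  proof
    assume "?z = \<one>"
    then have "?z \<otimes> y = y" using y by simp
    then show False using \<open>x \<noteq> y\<close> x y by (simp add: m_assoc)
  qed
  then obtain c where c: "cont c" "\<forall>a\<in>carrier G. \<forall>x\<in>carrier G. c (a \<otimes> x) = c a * c x"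
    "\<forall>x\<in>carrier G. cmod (c x) = 1" "c ?z \<noteq> 1"
    using characters_separate_from_one[OF Hausdorff, of ?z] x y by blast
  let ?d = "restrict c (carrier G)"
  have d: "?d \<in> carrier dual"
    unfolding dual_iff using c continuous_map_eq[OF c(1), of ?d] by simp
  have "?d ?z = ?d x * cnj (?d y)"
    using x y by (simp only: dual_mult[OF d] dual_inv[OF d] inv_closed)
  also have "\<dots> = 1" using eq[OF d] unit_complex_cnj[OF dual_norm[OF d y]] by simp
  finally show False using c(4) x y by simp
qed

lemma s_set_iff: "g \<in> s_set G u \<longleftrightarrow> g \<in> carrier G \<and> orbit g \<longlonglongrightarrow> 1"
  by (simp add: s_set_def)

lemma orbit_closed: "g \<in> s_set G u \<Longrightarrow> orbit g \<in> carrier null_seq_group"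
  by (simp add: s_set_iff null_seq_carrier dual_norm[OF u_dual])

text \<open>Evaluation at \<open>g\<close> maps \<open>u n\<close> to \<open>u n g\<close>, so \<open>g \<in> s_set G u\<close> is the condition of \<open>finest_topology_hom_continuous\<close>.\<close>

lemma evaluation_in_bidual:
  assumes g: "g \<in> s_set G u"
  shows "(\<lambda>y\<in>carrier dual. y g) \<in> carrier bidual"
proof -
  have gG: "g \<in> carrier G" and lim: "orbit g \<longlonglongrightarrow> 1" using g by (auto simp: s_set_iff)
  have "continuous_map F circle_topology (\<lambda>y. y g)"
  proof (rule finest_topology_hom_continuous[OF T_seq topological_ab_group_circle])
    show "(\<lambda>y. y g) \<in> hom dual circle_group"
      using gG by (auto simp: hom_def dual_norm dual_mult_apply)
    show "limitin circle_topology (\<lambda>n. u n g) \<one>\<^bsub>circle_group\<^esub> sequentially"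
      using lim gG by (simp add: limitin_subtopology dual_norm[OF u_dual])
  qed
  then have "continuous_map F euclidean (\<lambda>y. y g)" by (simp add: continuous_map_in_subtopology)
  then have "continuous_map F euclidean (\<lambda>y\<in>carrier dual. y g)" by (rule continuous_map_eq) simp
  then show ?thesis
    unfolding bidual_iff using gG by (simp add: dual_mult_closed dual_mult_apply dual_norm)
qed

lemma bidual_is_evaluation:
  assumes c: "c \<in> carrier bidual"
  shows "\<exists>g\<in>s_set G u. c = (\<lambda>y\<in>carrier dual. y g)"
proof -
  have "c \<in> hom dual circle_group" using c by (simp add: char_group_def)
  then obtain g where g: "g \<in> carrier G" "\<forall>y\<in>carrier dual. y g = c y"
    using dual_homomorphism_is_evaluation by blast
  have "limitin euclidean (c \<circ> u) (c \<one>\<^bsub>dual\<^esub>) sequentially"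
    using c by (intro continuous_map_limit[OF _ u_lim]) (simp add: bidual_iff)
  moreover have "c \<circ> u = orbit g" using g u_dual by (auto simp: fun_eq_iff)
  moreover have "c \<one>\<^bsub>dual\<^esub> = 1"
    using g dual_one_apply[OF g(1)] dual_one_closed
    by simp
  ultimately have "g \<in> s_set G u" using g by (simp add: s_set_iff)
  moreover have "c = (\<lambda>y\<in>carrier dual. y g)"
    using c g by (intro extensionalityI[of _ "carrier dual"]) (simp_all add: bidual_iff)
  ultimately show ?thesis by blast
qed

lemma G_set_iff: "p \<in> G_set G u \<longleftrightarrow> fst p \<in> s_set G u \<and> snd p = orbit (fst p)"
  by (cases p) (auto simp: G_set_def)

lemma eval_char_apply: "y \<in> carrier dual \<Longrightarrow> eval_char G T p y = y (fst p)"
  by (simp add: eval_char_def)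

lemma eval_char_image: "eval_char G T ` G_set G u = carrier bidual"
proof
  show "eval_char G T ` G_set G u \<subseteq> carrier bidual"
    using evaluation_in_bidual by (auto simp: eval_char_def G_set_iff)
  show "carrier bidual \<subseteq> eval_char G T ` G_set G u"
  proof
    fix c assume "c \<in> carrier bidual"
    then obtain g where g: "g \<in> s_set G u" "c = (\<lambda>y\<in>carrier dual. y g)"
      using bidual_is_evaluation by blast
    then have "(g, orbit g) \<in> G_set G u" "c = eval_char G T (g, orbit g)"
      by (auto simp: G_set_iff eval_char_def)
    then show "c \<in> eval_char G T ` G_set G u" by blast
  qed
qed

lemma eval_char_inj: "inj_on (eval_char G T) (G_set G u)"
proof (rule inj_onI)
  fix p q assume p: "p \<in> G_set G u" and q: "q \<in> G_set G u" and eq: "eval_char G T p = eval_char G T q"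
  have "d (fst p) = d (fst q)" if "d \<in> carrier dual" for d
    using eval_char_apply[OF that, of p] eval_char_apply[OF that, of q] eq by simp
  then have "fst p = fst q"
    using p q by (intro dual_separates) (auto simp: G_set_iff s_set_iff)
  then show "p = q" using p q by (simp add: G_set_iff prod_eq_iff)
qed

lemma orbit_mult:
  assumes "g \<in> carrier G" "h \<in> carrier G"
  shows "orbit (g \<otimes> h) = (\<lambda>n. u n g * u n h)"
  using assms by (simp add: dual_mult[OF u_dual])

lemma s_set_mult: 
  assumes "g \<in> s_set G u" "h \<in> s_set G u"
  shows "g \<otimes> h \<in> s_set G u"
  using assms tendsto_mult[of "orbit g" 1 sequentially "orbit h" 1]
  by (simp add: s_set_iff orbit_mult)

lemma G_set_subgroup: "subgroup (G_set G u) (G \<times>\<times> null_seq_group)"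
proof -
  interpret N: comm_group null_seq_group by (rule comm_group_null_seq)
  interpret P: group "G \<times>\<times> null_seq_group"
    by (rule DirProd_group[OF is_group N.is_group])
  show ?thesis
  proof
    show "G_set G u \<subseteq> carrier (G \<times>\<times> null_seq_group)"
      using orbit_closed by (auto simp: G_set_def s_set_iff)
    show "\<one>\<^bsub>G \<times>\<times> null_seq_group\<^esub> \<in> G_set G u"
      by (simp add: G_set_iff s_set_iff dual_one[OF u_dual])
  next
    fix p q assume p: "p \<in> G_set G u" and q: "q \<in> G_set G u"
    then show "p \<otimes>\<^bsub>G \<times>\<times> null_seq_group\<^esub> q \<in> G_set G u"
      by (cases p; cases q) (simp add: G_set_iff s_set_mult, simp add: s_set_iff orbit_mult)
  next
    fix p assume p: "p \<in> G_set G u"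
    then obtain g where g: "p = (g, orbit g)" "g \<in> s_set G u" by (cases p) (auto simp: G_set_iff)
    then have gG: "g \<in> carrier G" by (simp add: s_set_iff)
    have i: "orbit (inv g) = (\<lambda>n. cnj (u n g))" using gG by (simp add: dual_inv[OF u_dual])
    have "inv\<^bsub>G \<times>\<times> null_seq_group\<^esub> p = (inv g, orbit (inv g))"
      using inv_DirProd[OF is_group N.is_group gG orbit_closed[OF g(2)]] null_seq_inv[OF orbit_closed[OF g(2)]]
      by (simp add: g(1) i)
    moreover have "inv g \<in> s_set G u"
      using g(2) tendsto_cnj[of "orbit g" 1 sequentially] by (simp add: s_set_iff i)
    ultimately show "inv\<^bsub>G \<times>\<times> null_seq_group\<^esub> p \<in> G_set G u" by (simp add: G_set_iff)
  qed
qed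

lemma eval_char_iso: "eval_char G T \<in> iso (G_group G u) bidual"
proof -
  have carr: "carrier (G_group G u) = G_set G u" by (simp add: G_group_def)
  have "eval_char G T \<in> hom (G_group G u) bidual"
    unfolding hom_def carr
  proof (intro CollectI conjI ballI)
    show "eval_char G T \<in> G_set G u \<rightarrow> carrier bidual" using eval_char_image by auto
    fix p q assume p: "p \<in> G_set G u" and q: "q \<in> G_set G u"
    then have "fst p \<in> carrier G" "fst q \<in> carrier G" by (auto simp: G_set_iff s_set_iff)
    moreover have "fst (p \<otimes>\<^bsub>G_group G u\<^esub> q) = fst p \<otimes> fst q"
      by (cases p; cases q) (simp add: G_group_def DirProd_def)
    ultimately show "eval_char G T (p \<otimes>\<^bsub>G_group G u\<^esub> q) = eval_char G T p \<otimes>\<^bsub>bidual\<^esub> eval_char G T q"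
      by (auto simp: eval_char_def char_group_def[of dual F] dual_mult fun_eq_iff)
  qed
  then show ?thesis
    using eval_char_inj eval_char_image by (simp add: iso_def bij_betw_def carr)
qed

lemma radical_eq: "von_Neumann_radical dual F = annihilator G T (s_set G u)"
proof -
  have ev: "(\<lambda>y\<in>carrier dual. y g) y = 1 \<longleftrightarrow> y g = 1" if "y \<in> carrier dual" for y g using that by simp
  have "carrier bidual = (\<lambda>g. \<lambda>y\<in>carrier dual. y g) ` s_set G u"
    using evaluation_in_bidual bidual_is_evaluation by auto
  then have "von_Neumann_radical dual F = (\<Inter>g\<in>s_set G u. {y \<in> carrier dual. y g = 1})"
    by (auto simp: von_Neumann_radical_def kernel_def)
  moreover have "\<one> \<in> s_set G u"
    by (simp add: s_set_iff dual_one[OF u_dual])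
  ultimately show ?thesis by (auto simp: annihilator_def)
qed

text \<open>
  The map \<open>\<Psi>\<close> below is a homomorphism into \<open>null_seq_group\<close> that sends \<open>u\<close> to a sequence tending to the
  identity: \<open>\<bar>\<Psi> (u n) j - 1\<bar>\<close> is \<open>\<bar>u n (g j) - u n g0\<bar>\<close>, which is small for large \<open>j\<close> uniformly in \<open>n\<close>, and
  for each of the remaining \<open>j\<close> when \<open>n\<close> is large. So \<open>\<Psi>\<close> is continuous, and compact sets of null
  sequences have uniformly small tails.
\<close>

lemma uniform_convergence_on_compact:
  assumes g: "\<And>j. g j \<in> s_set G u" and g0: "g0 \<in> s_set G u"
    and lim: "limitin T g g0 sequentially"
    and lim': "limitin null_seq_topology (\<lambda>j. orbit (g j)) (orbit g0) sequentially"
    and K: "compactin F K" and "\<epsilon> > 0"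
  shows "\<forall>\<^sub>F j in sequentially. \<forall>y\<in>K. cmod (y (g j) - y g0) < \<epsilon>"
proof -
  interpret N: Metric_space "carrier null_seq_group" null_seq_dist by (rule Metric_space_null_seq)
  have top: "null_seq_topology = N.mtopology" by (simp add: null_seq_topology_def)
  have gG: "g j \<in> carrier G" "g0 \<in> carrier G" for j using g g0 by (auto simp: s_set_iff)
  have K_dual: "K \<subseteq> carrier dual" using compactin_subset_topspace[OF K] by simp
  define \<Psi> where "\<Psi> y = (\<lambda>j. y (g j) * cnj (y g0))" for y :: "'a \<Rightarrow> complex"
  have diff: "cmod (\<Psi> y j - 1) = cmod (y (g j) - y g0)" if y: "y \<in> carrier dual" for y j
  proof -
    have "\<Psi> y j - 1 = (y (g j) - y g0) * cnj (y g0)"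
      using unit_complex_cnj[OF dual_norm[OF y gG(2)]] by (simp add: \<Psi>_def algebra_simps)
    then show ?thesis using dual_norm[OF y gG(2)] by (simp add: norm_mult)
  qed
  have \<Psi>_closed: "\<Psi> y \<in> carrier null_seq_group" if y: "y \<in> carrier dual" for y
  proof -
    have "limitin euclidean (y \<circ> g) (y g0) sequentially"
      by (rule continuous_map_limit[OF dual_cont[OF y] lim])
    then have "(\<lambda>j. y (g j)) \<longlonglongrightarrow> y g0" by (simp add: o_def)
    then have "\<Psi> y \<longlonglongrightarrow> y g0 * cnj (y g0)" unfolding \<Psi>_def by (intro tendsto_mult tendsto_const)
    then show ?thesis
      using unit_complex_cnj[OF dual_norm[OF y gG(2)]] dual_norm[OF y] gG by (simp add: null_seq_carrier \<Psi>_def norm_mult)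
  qed
  have one_closed': "(\<lambda>n. 1) \<in> carrier null_seq_group" by (simp add: null_seq_carrier)
  have "continuous_map F null_seq_topology \<Psi>"
  proof (rule finest_topology_hom_continuous[OF T_seq topological_ab_group_null_seq])
    show "\<Psi> \<in> hom dual null_seq_group"
      using \<Psi>_closed gG by (auto simp: hom_def \<Psi>_def dual_mult_apply fun_eq_iff)
    show "limitin null_seq_topology (\<lambda>n. \<Psi> (u n)) \<one>\<^bsub>null_seq_group\<^esub> sequentially"
      unfolding top N.limitin_metric
    proof (intro conjI allI impI)
      show "\<one>\<^bsub>null_seq_group\<^esub> \<in> carrier null_seq_group" by (simp add: one_closed')
      fix e :: real assume "e > 0"
      have "\<forall>\<^sub>F j in sequentially. orbit (g j) \<in> carrier null_seq_group \<and> null_seq_dist (orbit (g j)) (orbit g0) < e/2"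
        using lim' \<open>e > 0\<close> unfolding top N.limitin_metric by (meson half_gt_zero)
      then obtain J where J: "\<And>j. j \<ge> J \<Longrightarrow> null_seq_dist (orbit (g j)) (orbit g0) < e/2"
        by (auto simp: eventually_sequentially)
      have near: "\<forall>\<^sub>F n in sequentially. cmod (u n h - 1) < e/4" if "h \<in> s_set G u" for h
        using tendstoD[of "orbit h" 1 sequentially "e/4"] that \<open>e > 0\<close> by (simp add: s_set_iff dist_norm)
      have "\<forall>\<^sub>F n in sequentially. \<forall>j\<in>{..<J}. cmod (u n (g j) - 1) < e/4"
        using near[OF g] by (simp add: eventually_ball_finite)
      with near[OF g0]
      show "\<forall>\<^sub>F n in sequentially. \<Psi> (u n) \<in> carrier null_seq_group \<and> null_seq_dist (\<Psi> (u n)) \<one>\<^bsub>null_seq_group\<^esub> < e"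
      proof (rule eventually_elim2)
        fix n assume n: "cmod (u n g0 - 1) < e/4" "\<forall>j\<in>{..<J}. cmod (u n (g j) - 1) < e/4"
        have "cmod (\<Psi> (u n) j - 1) \<le> e/2" for j
        proof (cases "j < J")
          case True
          then have "cmod (u n (g j) - 1) < e/4" using n(2) by simp
          then show ?thesis
            using n(1) norm_triangle_ineq4[of "u n (g j) - 1" "u n g0 - 1"] by (simp add: diff[OF u_dual])
        next
          case False
          then have "null_seq_dist (orbit (g j)) (orbit g0) < e/2" using J by simp
          then show ?thesis
            using null_seq_dist_nth_le[OF orbit_closed[OF g[of j]] orbit_closed[OF g0], of n] by (simp add: diff[OF u_dual])
        qed
        then have "null_seq_dist (\<Psi> (u n)) (\<lambda>n. 1) \<le> e/2"
          by (simp only: null_seq_dist_le_iff[OF \<Psi>_closed[OF u_dual] one_closed']) simp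
        then show "\<Psi> (u n) \<in> carrier null_seq_group \<and> null_seq_dist (\<Psi> (u n)) \<one>\<^bsub>null_seq_group\<^esub> < e"
          using \<Psi>_closed[OF u_dual] \<open>e > 0\<close> by simp
      qed
    qed
  qed
  then have "compactin N.mtopology (\<Psi> ` K)" using image_compactin[OF K] by (simp add: top)
  then have "N.mtotally_bounded (\<Psi> ` K)" by (rule N.compactin_imp_mtotally_bounded)
  then obtain Z where Z: "finite Z" "Z \<subseteq> \<Psi> ` K" "\<Psi> ` K \<subseteq> (\<Union>z\<in>Z. N.mball z (\<epsilon>/2))"
    unfolding N.mtotally_bounded_def using \<open>\<epsilon> > 0\<close> by (meson half_gt_zero)
  have "\<forall>z\<in>Z. \<forall>\<^sub>F j in sequentially. cmod (z j - 1) < \<epsilon>/2"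
  proof
    fix z assume "z \<in> Z"
    then have "z \<in> carrier null_seq_group" using Z(2) K_dual \<Psi>_closed by auto
    then show "\<forall>\<^sub>F j in sequentially. cmod (z j - 1) < \<epsilon>/2"
      using tendstoD[of z 1 sequentially "\<epsilon>/2"] \<open>\<epsilon> > 0\<close> by (simp add: null_seq_carrier dist_norm)
  qed
  then have "\<forall>\<^sub>F j in sequentially. \<forall>z\<in>Z. cmod (z j - 1) < \<epsilon>/2" using Z(1) by (simp add: eventually_ball_finite)
  then show ?thesis
  proof (rule eventually_mono, intro ballI)
    fix j y assume j: "\<forall>z\<in>Z. cmod (z j - 1) < \<epsilon>/2" and y: "y \<in> K"
    have "\<Psi> y \<in> (\<Union>z\<in>Z. N.mball z (\<epsilon>/2))" using Z(3) y by blast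
    then obtain z where z: "z \<in> Z" "z \<in> carrier null_seq_group" "\<Psi> y \<in> carrier null_seq_group" "null_seq_dist z (\<Psi> y) < \<epsilon>/2"
      by auto
    have "cmod (z j - \<Psi> y j) < \<epsilon>/2" using null_seq_dist_nth_le[OF z(2,3), of j] z(4) by simp
    moreover have "cmod (z j - 1) < \<epsilon>/2" using j z(1) by simp
    ultimately have "cmod (\<Psi> y j - 1) < \<epsilon>"
      using norm_triangle_ineq4[of "z j - 1" "z j - \<Psi> y j"] by simp
    then show "cmod (y (g j) - y g0) < \<epsilon>" using diff y K_dual by (metis subsetD)
  qed
qed


lemma openin_char_topology:
  assumes "compactin F K" "openin circle_topology U"
  shows "openin (char_topology dual F) {c \<in> carrier bidual. c ` K \<subseteq> U}"
  unfolding char_topology_def using assms by (intro topology_generated_by_Basis) blast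

lemma topspace_char_topology: "topspace (char_topology dual F) = carrier bidual"
proof -
  let ?B = "{{c \<in> carrier bidual. c ` K \<subseteq> U} | K U. compactin F K \<and> openin circle_topology U}"

  have "carrier bidual \<in> ?B"
    by (rule CollectI, rule exI[of _ "{}"], rule exI[of _ "{}"]) simp
  moreover have "V \<subseteq> carrier bidual" if "V \<in> ?B" for V using that by auto
  ultimately have "\<Union>?B = carrier bidual" by (intro equalityI Union_least Union_upper)
  then show ?thesis by (simp add: char_topology_def)
qed

lemma topspace_G_topology: "topspace (G_topology G T u) = G_set G u"
  using orbit_closed by (auto simp: G_topology_def G_set_def s_set_iff)

lemma metrizable_G_topology: "metrizable_space (G_topology G T u)"
proof -
  have "metrizable_space null_seq_topology"
    unfolding metrizable_space_def null_seq_topology_def using Metric_space_null_seq by blast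
  then show ?thesis
    unfolding G_topology_def
    by (intro metrizable_space_subtopology) (simp add: metrizable_space_prod_topology metrizable)
qed

lemma G_topology_convergence:
  assumes "limitin (G_topology G T u) \<sigma> l sequentially"
  shows "limitin T (\<lambda>j. fst (\<sigma> j)) (fst l) sequentially"
    and "limitin null_seq_topology (\<lambda>j. snd (\<sigma> j)) (snd l) sequentially"
proof -
  have lim: "limitin (prod_topology T null_seq_topology) \<sigma> l sequentially"
    using assms by (simp add: G_topology_def limitin_subtopology)
  show "limitin T (\<lambda>j. fst (\<sigma> j)) (fst l) sequentially"
    using continuous_map_limit[OF continuous_map_fst lim] by (simp add: o_def)
  show "limitin null_seq_topology (\<lambda>j. snd (\<sigma> j)) (snd l) sequentially"
    using continuous_map_limit[OF continuous_map_snd lim] by (simp add: o_def)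
qed

text \<open>
  Since \<open>G_topology\<close> is metrizable, sequences suffice, as \<open>uniform_convergence_on_compact\<close> requires. The
  compact image of \<open>K\<close> has a positive distance from the complement of \<open>U\<close>.
\<close>

lemma eval_char_subbasic_preimage_open:
  assumes K: "compactin F K" and U: "openin circle_topology U"
  shows "openin (G_topology G T u) {p \<in> G_set G u. eval_char G T p ` K \<subseteq> U}"
proof -
  let ?P = "{p \<in> G_set G u. eval_char G T p ` K \<subseteq> U}"
  obtain M d where "Metric_space M d" and M: "G_topology G T u = Metric_space.mtopology M d"
    using metrizable_G_topology unfolding metrizable_space_def by blast
  then interpret M: Metric_space M d by simp
  have M_eq: "M = G_set G u" using topspace_G_topology unfolding M by simp
  have K_dual: "K \<subseteq> carrier dual" using compactin_subset_topspace[OF K] by simp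
  obtain V where V: "open V" "U = sphere 0 1 \<inter> V" using U by (auto simp: openin_open)
  have "closedin M.mtopology (M - ?P)"
    unfolding M.metric_closedin_iff_sequentially_closed
  proof (intro conjI allI impI)
    fix \<sigma> l assume "range \<sigma> \<subseteq> M - ?P \<and> limitin M.mtopology \<sigma> l sequentially"
    then have \<sigma>: "\<And>j. \<sigma> j \<in> G_set G u" "\<And>j. \<sigma> j \<notin> ?P" and lim: "limitin (G_topology G T u) \<sigma> l sequentially"
      by (auto simp: M M_eq)
    have l: "l \<in> G_set G u" using limitin_topspace[OF lim] by (simp add: topspace_G_topology)
    have "l \<notin> ?P"
    proof
      assume lP: "l \<in> ?P"
      let ?c = "eval_char G T l"
      have "?c \<in> carrier bidual" using eval_char_image l by blast
      then have "compact (?c ` K)" using image_compactin[OF K, of euclidean ?c] by (simp add: bidual_iff)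
      moreover have "?c ` K \<subseteq> V" using lP V(2) by blast
      ultimately obtain \<epsilon> where \<epsilon>: "\<epsilon> > 0" "(\<Union>z\<in>?c ` K. ball z \<epsilon>) \<subseteq> V"
        using compact_subset_open_imp_ball_epsilon_subset V(1) by metis
      have g: "fst (\<sigma> j) \<in> s_set G u" "snd (\<sigma> j) = orbit (fst (\<sigma> j))" for j using \<sigma>(1) by (simp_all add: G_set_iff)
      have g0: "fst l \<in> s_set G u" "snd l = orbit (fst l)" using l by (simp_all add: G_set_iff)
      have "\<forall>\<^sub>F j in sequentially. \<forall>y\<in>K. cmod (y (fst (\<sigma> j)) - y (fst l)) < \<epsilon>"
        using G_topology_convergence[OF lim]
        by (intro uniform_convergence_on_compact g g0 K \<epsilon>(1)) (simp_all add: g(2) g0(2))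
      then obtain j where j: "\<forall>y\<in>K. cmod (y (fst (\<sigma> j)) - y (fst l)) < \<epsilon>"
        by (auto simp: eventually_sequentially)
      have "eval_char G T (\<sigma> j) y \<in> U" if y: "y \<in> K" for y
      proof -
        have yd: "y \<in> carrier dual" using y K_dual by blast
        have "eval_char G T (\<sigma> j) y \<in> ball (?c y) \<epsilon>"
          using j y by (simp add: eval_char_apply[OF yd] dist_norm norm_minus_commute)
        then have "eval_char G T (\<sigma> j) y \<in> V" using \<epsilon>(2) y by blast
        moreover have "cmod (eval_char G T (\<sigma> j) y) = 1"
          using g(1)[of j] by (simp add: eval_char_apply[OF yd] s_set_iff dual_norm[OF yd])
        ultimately show ?thesis by (simp add: V(2))
      qed
      then have "\<sigma> j \<in> ?P" using \<sigma>(1) by blast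
      then show False using \<sigma>(2) by blast
    qed
    then show "l \<in> M - ?P" using l by (simp add: M_eq)
  qed simp
  then have "openin M.mtopology (M - (M - ?P))" using openin_diff[OF openin_topspace, of M.mtopology] by simp
  moreover have "M - (M - ?P) = ?P" by (auto simp: M_eq)
  ultimately show ?thesis by (simp add: M)
qed

lemma eval_char_continuous:
  "continuous_map (G_topology G T u) (char_topology dual F) (eval_char G T)"
  unfolding char_topology_def
proof (rule continuous_on_generated_topo)
  let ?B = "{{c \<in> carrier bidual. c ` K \<subseteq> U} | K U. compactin F K \<and> openin circle_topology U}"
  show "eval_char G T ` topspace (G_topology G T u) \<subseteq> \<Union>?B"
    using topspace_char_topology eval_char_image by (simp add: char_topology_def topspace_G_topology)
  fix V assume "V \<in> ?B"
  then obtain K U where KU: "V = {c \<in> carrier bidual. c ` K \<subseteq> U}" "compactin F K" "openin circle_topology U" by blast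
  have "eval_char G T -` V \<inter> topspace (G_topology G T u) = {p \<in> G_set G u. eval_char G T p ` K \<subseteq> U}"
    unfolding KU(1) topspace_G_topology using eval_char_image by blast
  then show "openin (G_topology G T u) (eval_char G T -` V \<inter> topspace (G_topology G T u))"
    using eval_char_subbasic_preimage_open[OF KU(2,3)] by simp
qed

lemma openin_circle_ball: "openin circle_topology (sphere 0 1 \<inter> ball z r)"
  by (intro openin_open_Int) simp

text \<open>
  Characters separate \<open>g0\<close> from every point of the compact complement of \<open>W\<close>, with a gap \<open>1 / (m + 1)\<close>;
  finitely many pairs of a character and a gap suffice, and finite sets of characters are compact.
\<close>

lemma nbhd_controls_group_coordinate:
  assumes g0: "g0 \<in> s_set G u" and W: "openin T W" "g0 \<in> W"
  shows "\<exists>V. openin (char_topology dual F) V \<and> (\<lambda>y\<in>carrier dual. y g0) \<in> V \<and>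
    (\<forall>g\<in>s_set G u. (\<lambda>y\<in>carrier dual. y g) \<in> V \<longrightarrow> g \<in> W)"
proof -
  let ?O = "\<lambda>(y, m). {h \<in> topspace T. y h \<in> - cball (y g0) (inverse (real (Suc m)))}"
  have g0G: "g0 \<in> carrier G" using g0 by (simp add: s_set_iff)
  have open_O: "openin T (?O (y, m))" if "y \<in> carrier dual" for y m
  proof -
    have "openin euclidean (- cball (y g0) (inverse (real (Suc m))))" by (simp only: open_openin[symmetric]) (rule open_Compl[OF closed_cball])
    from openin_continuous_map_preimage[OF dual_cont[OF that] this] show ?thesis by simp
  qed
  have "closedin T (topspace T - W)" using W(1) by blast
  then have "compactin T (carrier G - W)" using closedin_compact_space[OF compact] by simp
  moreover have "carrier G - W \<subseteq> \<Union>(?O ` (carrier dual \<times> UNIV))"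
  proof
    fix h assume h: "h \<in> carrier G - W"
    then have "h \<noteq> g0" using W(2) by blast
    then obtain y where y: "y \<in> carrier dual" "y h \<noteq> y g0" using dual_separates[of h g0] h g0G by blast
    then have "cmod (y g0 - y h) > 0" by simp
    then obtain m where "inverse (real (Suc m)) < cmod (y g0 - y h)" using reals_Archimedean by blast
    then have "h \<in> ?O (y, m)" using h by (simp add: dist_norm)
    with y(1) show "h \<in> \<Union>(?O ` (carrier dual \<times> UNIV))" by blast
  qed
  moreover have "\<forall>V\<in>?O ` (carrier dual \<times> UNIV). openin T V" using open_O by blast
  ultimately obtain \<F> where \<F>: "finite \<F>" "\<F> \<subseteq> ?O ` (carrier dual \<times> UNIV)" "carrier G - W \<subseteq> \<Union>\<F>"
    unfolding compactin_def by meson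
  obtain S where S: "finite S" "S \<subseteq> carrier dual \<times> UNIV" "\<F> = ?O ` S"
    using finite_subset_image[OF \<F>(1,2)] by blast
  \<comment> \<open>The whole carrier is added because \<open>S\<close> may be empty.\<close>
  let ?V = "\<lambda>(y, m). {c \<in> carrier bidual. c ` {y} \<subseteq> sphere 0 1 \<inter> ball (y g0) (inverse (real (Suc m)))}"
  have "openin (char_topology dual F) (\<Inter>(insert (carrier bidual) (?V ` S)))"
  proof (rule openin_Inter)
    fix X assume "X \<in> insert (carrier bidual) (?V ` S)"
    then show "openin (char_topology dual F) X"
    proof
      assume "X = carrier bidual"
      then show ?thesis using openin_topspace[of "char_topology dual F"] by (simp add: topspace_char_topology)
    next
      assume "X \<in> ?V ` S"
      then obtain y m where y: "(y, m) \<in> S" "X = ?V (y, m)" by auto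
      then have "compactin F {y}" using S(2) by auto
      then show ?thesis unfolding y(2) prod.case by (intro openin_char_topology openin_circle_ball)
    qed
  qed (use S in auto)
  moreover have "(\<lambda>y\<in>carrier dual. y g0) \<in> \<Inter>(insert (carrier bidual) (?V ` S))"
    using evaluation_in_bidual[OF g0] S(2) dual_norm g0G by auto
  moreover have "g \<in> W" if g: "g \<in> s_set G u" and gV: "(\<lambda>y\<in>carrier dual. y g) \<in> \<Inter>(insert (carrier bidual) (?V ` S))" for g
  proof (rule ccontr)
    assume "g \<notin> W"
    then have "g \<in> \<Union>\<F>" using \<F>(3) g by (auto simp: s_set_iff)
    then obtain y m where ym: "(y, m) \<in> S" "g \<in> ?O (y, m)" unfolding S(3) by blast
    then have "(\<lambda>y\<in>carrier dual. y g) \<in> ?V (y, m)" using gV by blast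
    then show False using ym S(2) by auto
  qed
  ultimately show ?thesis by blast
qed

text \<open>
  The tail \<open>{u n | n \<ge> N}\<close> with its limit \<open>\<one>\<close> is compact, and the values there are close to 1 both for \<open>g0\<close> and for
  \<open>g\<close>; the finitely many other \<open>u n\<close> are controlled one by one.
\<close>

lemma nbhd_controls_orbit:
  assumes g0: "g0 \<in> s_set G u" and "\<epsilon> > 0"
  shows "\<exists>V. openin (char_topology dual F) V \<and> (\<lambda>y\<in>carrier dual. y g0) \<in> V \<and>
    (\<forall>g\<in>s_set G u. (\<lambda>y\<in>carrier dual. y g) \<in> V \<longrightarrow> null_seq_dist (orbit g0) (orbit g) < \<epsilon>)"
proof -
  have g0G: "g0 \<in> carrier G" using g0 by (simp add: s_set_iff)
  have "\<forall>\<^sub>F n in sequentially. cmod (u n g0 - 1) < \<epsilon>/4"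
    using tendstoD[of "orbit g0" 1 sequentially "\<epsilon>/4"] g0 \<open>\<epsilon> > 0\<close> by (simp add: s_set_iff dist_norm)
  then obtain N where N: "\<And>n. n \<ge> N \<Longrightarrow> cmod (u n g0 - 1) < \<epsilon>/4" by (auto simp: eventually_sequentially)
  let ?K = "insert \<one>\<^bsub>dual\<^esub> (u ` {N..})"
  have K: "compactin F ?K"
    using u_dual by (intro compactin_sequence_with_limit[OF u_lim]) auto
  let ?L = "{c \<in> carrier bidual. c ` ?K \<subseteq> sphere 0 1 \<inter> ball 1 (\<epsilon>/4)}"
  let ?V = "\<lambda>n. {c \<in> carrier bidual. c ` {u n} \<subseteq> sphere 0 1 \<inter> ball (u n g0) (\<epsilon>/2)}"
  let ?W = "\<Inter>(insert ?L (?V ` {..<N}))"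
  have "openin (char_topology dual F) ?W"
  proof (rule openin_Inter)
    fix X assume "X \<in> insert ?L (?V ` {..<N})"
    then consider "X = ?L" | n where "X = ?V n" by blast
    then show "openin (char_topology dual F) X"
    proof cases
      case 1
      show ?thesis unfolding 1 by (rule openin_char_topology[OF K openin_circle_ball])
    next
      case (2 n)
      have "compactin F {u n}" using u_dual by simp
      then show ?thesis unfolding 2 by (rule openin_char_topology[OF _ openin_circle_ball])
    qed
  qed auto
  moreover have "(\<lambda>y\<in>carrier dual. y g0) \<in> ?W"
  proof -
    have "\<one>\<^bsub>dual\<^esub> \<in> carrier dual" using limitin_topspace[OF u_lim] by simp
    moreover have "dist 1 (u n g0) < \<epsilon>/4" if "n \<ge> N" for n
      using N[OF that] by (simp add: dist_norm norm_minus_commute)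
    ultimately show ?thesis
      using evaluation_in_bidual[OF g0] u_dual dual_norm[OF u_dual g0G] dual_one_apply[OF g0G] \<open>\<epsilon> > 0\<close>
      by auto
  qed
  moreover have "null_seq_dist (orbit g0) (orbit g) < \<epsilon>"
    if g: "g \<in> s_set G u" and gW: "(\<lambda>y\<in>carrier dual. y g) \<in> ?W" for g
  proof -
    have "cmod (u n g0 - u n g) \<le> \<epsilon>/2" for n
    proof (cases "n < N")
      case True
      then have "(\<lambda>y\<in>carrier dual. y g) \<in> ?V n" using gW by blast
      then show ?thesis using u_dual by (auto simp: dist_norm)
    next
      case False
      then have "u n \<in> ?K" by auto
      moreover have "(\<lambda>y\<in>carrier dual. y g) \<in> ?L" using gW by blast
      ultimately have "(\<lambda>y\<in>carrier dual. y g) (u n) \<in> ball 1 (\<epsilon>/4)" by blast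
      then have "cmod (1 - u n g) < \<epsilon>/4" using u_dual by (simp add: dist_norm)
      then show ?thesis
        using N[of n] False norm_triangle_ineq[of "u n g0 - 1" "1 - u n g"] by simp
    qed
    then have "null_seq_dist (orbit g0) (orbit g) \<le> \<epsilon>/2"
      by (simp only: null_seq_dist_le_iff[OF orbit_closed[OF g0] orbit_closed[OF g]]) simp
    then show ?thesis using \<open>\<epsilon> > 0\<close> by simp
  qed
  ultimately show ?thesis by (intro exI[of _ ?W] conjI ballI impI)
qed

lemma eval_char_open_map:
  "open_map (G_topology G T u) (char_topology dual F) (eval_char G T)"
  unfolding open_map_def
proof (intro allI impI)
  interpret N: Metric_space "carrier null_seq_group" null_seq_dist by (rule Metric_space_null_seq)
  fix W assume "openin (G_topology G T u) W"
  then obtain W' where W': "openin (prod_topology T null_seq_topology) W'" "W = W' \<inter> G_set G u"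
    by (auto simp: G_topology_def openin_subtopology)
  show "openin (char_topology dual F) (eval_char G T ` W)"
  proof (subst openin_subopen, intro ballI)
    fix c assume "c \<in> eval_char G T ` W"
    then obtain g0 where g0: "(g0, orbit g0) \<in> W'" "g0 \<in> s_set G u" "c = (\<lambda>y\<in>carrier dual. y g0)"
      unfolding W'(2) by (auto simp: G_set_iff eval_char_def)
    obtain U B where U: "openin T U" "g0 \<in> U" and B: "openin null_seq_topology B" "orbit g0 \<in> B" and UB: "U \<times> B \<subseteq> W'"
      using W'(1) g0(1) unfolding openin_prod_topology_alt by blast
    obtain \<epsilon> where \<epsilon>: "\<epsilon> > 0" "N.mball (orbit g0) \<epsilon> \<subseteq> B"
      using B unfolding null_seq_topology_def N.openin_mtopology by blast
    obtain V1 where V1: "openin (char_topology dual F) V1" "c \<in> V1"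
      "\<forall>g\<in>s_set G u. (\<lambda>y\<in>carrier dual. y g) \<in> V1 \<longrightarrow> g \<in> U"
      using nbhd_controls_group_coordinate[OF g0(2) U] g0(3) by blast
    obtain V2 where V2: "openin (char_topology dual F) V2" "c \<in> V2"
      "\<forall>g\<in>s_set G u. (\<lambda>y\<in>carrier dual. y g) \<in> V2 \<longrightarrow> null_seq_dist (orbit g0) (orbit g) < \<epsilon>"
      using nbhd_controls_orbit[OF g0(2) \<epsilon>(1)] g0(3) by blast
    have "V1 \<inter> V2 \<subseteq> eval_char G T ` W"
    proof
      fix e assume e: "e \<in> V1 \<inter> V2"
      then have "e \<in> carrier bidual" using openin_subset[OF V1(1)] by (auto simp: topspace_char_topology)
      then obtain g where g: "g \<in> s_set G u" "e = (\<lambda>y\<in>carrier dual. y g)"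
        using bidual_is_evaluation by blast
      have "g \<in> U" using V1(3) g e by blast
      moreover have "null_seq_dist (orbit g0) (orbit g) < \<epsilon>" using V2(3) g e by blast
      then have "orbit g \<in> B" using \<epsilon>(2) orbit_closed[OF g(1)] orbit_closed[OF g0(2)] by auto
      ultimately have "(g, orbit g) \<in> W" using UB g(1) by (auto simp: W'(2) G_set_iff)
      moreover have "e = eval_char G T (g, orbit g)" by (simp add: eval_char_def g(2))
      ultimately show "e \<in> eval_char G T ` W" by blast
    qed
    then show "\<exists>V. openin (char_topology dual F) V \<and> c \<in> V \<and> V \<subseteq> eval_char G T ` W"
      using V1(1,2) V2(1,2) by (intro exI[of _ "V1 \<inter> V2"]) auto
  qed
qed

lemma eval_char_homeomorphic:
  "homeomorphic_map (G_topology G T u) (char_topology dual F) (eval_char G T)"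
  using eval_char_continuous eval_char_open_map eval_char_image eval_char_inj
  by (intro bijective_open_imp_homeomorphic_map) (simp_all add: topspace_G_topology topspace_char_topology)

end

theorem theorem4:
  fixes A :: "('a, 'm) monoid_scheme" and T :: "'a topology" and u :: "nat \<Rightarrow> 'a \<Rightarrow> complex"
  assumes "topological_ab_group A T"
    and "compact_space T" and "metrizable_space T" and "infinite (carrier A)"
    and "T_sequence (char_group A T) u"
  shows "subgroup (G_set A u) (A \<times>\<times> null_seq_group) \<and>
         eval_char A T \<in>
           iso (G_group A u)
             (char_group (char_group A T) (finest_topology (char_group A T) u)) \<and>
         homeomorphic_map (G_topology A T u)
           (char_topology (char_group A T) (finest_topology (char_group A T) u))
           (eval_char A T) \<and>
         von_Neumann_radical (char_group A T) (finest_topology (char_group A T) u) =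
           annihilator A T (s_set A u)"
proof -
  interpret comm_group A using assms(1) by (simp add: topological_ab_group_def)
  interpret T_sequence_of_characters A T u
    using assms by unfold_locales
  show ?thesis
    by (intro conjI G_set_subgroup eval_char_iso eval_char_homeomorphic radical_eq)
qed

end
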